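(* Let $k$ be a field of characteristic $0$, let $d\ge 1$, and let $G=([m]\cup[\tilde n],E)$ be a subgraph of $K_{m,n}$. If $L_G^{k}(d)$ is radical (resp. is a complete intersection, resp. is prime), then $I_{d+1}^{k}(X_G^{\mathrm{gen}})$ is radical (resp. has maximal height, resp. is prime).
   Context: $[m]=\{1,\dots,m\}$ and $[\tilde n]=\{\tilde 1,\dots,\tilde n\}$; $K_{m,n}$ is the complete bipartite graph with bipartition $[m]\cup[\tilde n]$ and edges $\{i,\tilde j\}$. For a finite simple graph $G=(V,E)$, a field $k$ and an integer $d\ge 1$, let $S=k[y_{v,\ell} : v\in V,\ \ell\in\{1,\dots,d\}]$, and for every edge $e=\{u,v\}\in E$ put $f_e^{(d)}=\sum_{\ell=1}^d y_{u,\ell}\,y_{v,\ell}$. The Lovász–Saks–Schrijver ideal is $L_G^{k}(d)=(f_e^{(d)} : e\in E)\subseteq S$. An ideal is a complete intersection if it is generated by a regular sequence (the zero ideal counts). Let $S^{\mathrm{gen}}=k[x_{ij} : (i,j)\in[m]\times[n]]$ and let $X_{m,n}^{\mathrm{gen}}=(x_{ij})$ be the $m\times n$ matrix of variables. $X_G^{\mathrm{gen}}$ is the matrix obtained from $X_{m,n}^{\mathrm{gen}}$ by replacing the entry in position $(i,j)$ with $0$ for all $\{i,\tilde j\}\in E$. For a matrix $X$ with entries in $S^{\mathrm{gen}}$, $I_t^{k}(X)\subseteq S^{\mathrm{gen}}$ is the ideal generated by the $t$-minors of $X$. "$I_t^k(X_G^{\mathrm{gen}})$ has maximal height" means that its height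 equals that of $I_t^k(X_{m,n}^{\mathrm{gen}})$, which is $(m+1-t)(n+1-t)$ for $t\le\min(m,n)$ (and both ideals are zero for $t>\min(m,n)$). *)

theory Defs
  imports
    "HOL-Library.Poly_Mapping"
    "HOL-Library.Extended_Nat"
    "HOL-Algebra.Ideal"
    "Jordan_Normal_Form.Determinant"
    "Jordan_Normal_Form.DL_Submatrix"
begin

section \<open>Ideals of a commutative ring\<close>

definition radical_of :: "('a, 'b) ring_scheme \<Rightarrow> 'a set \<Rightarrow> 'a set" where
  "radical_of R I = {a \<in> carrier R. \<exists>n::nat. 0 < n \<and> a [^]\<^bsub>R\<^esub> n \<in> I}"

definition is_radical_ideal :: "'a set \<Rightarrow> ('a, 'b) ring_scheme \<Rightarrow> bool" where
  "is_radical_ideal I R \<longleftrightarrow> ideal I R \<and> radical_of R I = I"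

text \<open>The second condition says that \<open>fs ! i\<close> is a nonzerodivisor modulo the ideal generated by
  its predecessors. The empty sequence is regular (in a nonzero ring) and generates the zero
  ideal.\<close>

definition regular_sequence :: "('a, 'b) ring_scheme \<Rightarrow> 'a list \<Rightarrow> bool" where
  "regular_sequence R fs \<longleftrightarrow>
     set fs \<subseteq> carrier R \<and>
     (\<forall>i<length fs. \<forall>a\<in>carrier R.
        fs ! i \<otimes>\<^bsub>R\<^esub> a \<in> Idl\<^bsub>R\<^esub> (set (take i fs)) \<longrightarrow> a \<in> Idl\<^bsub>R\<^esub> (set (take i fs))) \<and>
     Idl\<^bsub>R\<^esub> (set fs) \<noteq> carrier R"

definition complete_intersection :: "'a set \<Rightarrow> ('a, 'b) ring_scheme \<Rightarrow> bool" where
  "complete_intersection I R \<longleftrightarrow> (\<exists>fs. regular_sequence R fs \<and> I = Idl\<^bsub>R\<^esub> (set fs))"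

definition prime_height :: "('a, 'b) ring_scheme \<Rightarrow> 'a set \<Rightarrow> enat" where
  "prime_height R P =
     Sup {enat r | r. \<exists>Q :: nat \<Rightarrow> 'a set.
            (\<forall>i\<le>r. primeideal (Q i) R) \<and> (\<forall>i<r. Q i \<subset> Q (Suc i)) \<and> Q r = P}"

definition ideal_height :: "('a, 'b) ring_scheme \<Rightarrow> 'a set \<Rightarrow> enat" where
  "ideal_height R I = Inf {prime_height R P | P. primeideal P R \<and> I \<subseteq> P}"


section \<open>Polynomial rings\<close>

text \<open>Finitely supported maps from exponent vectors \<open>'v \<Rightarrow>\<^sub>0 nat\<close> to \<open>'k\<close> are the polynomials in
  variables indexed by the whole type \<open>'v\<close>; \<open>poly_ring K X\<close> is the ring of those that involve
  only variables from \<open>X\<close>. The argument \<open>K\<close> merely names the coefficient field.\<close>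

type_synonym ('v, 'k) mpoly = "('v \<Rightarrow>\<^sub>0 nat) \<Rightarrow>\<^sub>0 'k"

definition Var :: "'v \<Rightarrow> ('v, 'k::field) mpoly" where
  "Var v = Poly_Mapping.single (Poly_Mapping.single v 1) 1"

definition poly_ring :: "'k::field itself \<Rightarrow> 'v set \<Rightarrow> ('v, 'k) mpoly ring" where
  "poly_ring K X =
     \<lparr>carrier = {p. \<forall>\<mu>\<in>Poly_Mapping.keys p. Poly_Mapping.keys \<mu> \<subseteq> X},
      monoid.mult = (*), one = 1, zero = 0, add = (+)\<rparr>"

lemma poly_ring_simps [simp]:
  "monoid.mult (poly_ring K X) = (*)" "one (poly_ring K X) = 1"
  "zero (poly_ring K X) = 0" "add (poly_ring K X) = (+)"
  by (simp_all add: poly_ring_def)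

lemma poly_ring_carrier:
  "p \<in> carrier (poly_ring K X) \<longleftrightarrow>
     (\<forall>\<mu>\<in>Poly_Mapping.keys p. Poly_Mapping.keys \<mu> \<subseteq> X)"
  by (simp add: poly_ring_def)

lemma poly_ring_add_closed:
  assumes "p \<in> carrier (poly_ring K X)" "q \<in> carrier (poly_ring K X)"
  shows "p + q \<in> carrier (poly_ring K X)"
  using assms Poly_Mapping.keys_add[of p q] unfolding poly_ring_carrier by blast

lemma poly_ring_mult_closed:
  assumes "p \<in> carrier (poly_ring K X)" "q \<in> carrier (poly_ring K X)"
  shows "p * q \<in> carrier (poly_ring K X)"
  unfolding poly_ring_carrier
proof
  fix \<mu> assume "\<mu> \<in> Poly_Mapping.keys (p * q)"
  then obtain a b where "\<mu> = a + b" "a \<in> Poly_Mapping.keys p" "b \<in> Poly_Mapping.keys q"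
    using keys_mult[of p q] by blast
  then show "Poly_Mapping.keys \<mu> \<subseteq> X"
    using assms Poly_Mapping.keys_add[of a b] unfolding poly_ring_carrier by blast
qed

lemma poly_ring_cring: "cring (poly_ring K X)"
proof (rule cringI)
  show "abelian_group (poly_ring K X)"
  proof (rule abelian_groupI)
    fix x assume x: "x \<in> carrier (poly_ring K X)"
    show "\<exists>y\<in>carrier (poly_ring K X). y \<oplus>\<^bsub>poly_ring K X\<^esub> x = \<zero>\<^bsub>poly_ring K X\<^esub>"
      using x by (intro bexI[of _ "- x"]) (simp_all add: poly_ring_carrier)
  qed (auto simp: poly_ring_add_closed add.assoc add.commute, simp add: poly_ring_carrier)
  show "Group.comm_monoid (poly_ring K X)"
    by (rule comm_monoidI)
      (auto simp: poly_ring_mult_closed mult.assoc mult.commute, simp add: poly_ring_carrier)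
qed (simp add: distrib_right)

lemma Var_in_poly_ring: "v \<in> X \<Longrightarrow> Var v \<in> carrier (poly_ring K X)"
  by (simp add: poly_ring_carrier Var_def)


section \<open>Lovasz--Saks--Schrijver ideals\<close>

text \<open>A simple graph is given by its vertex set \<open>V\<close> and a set \<open>E\<close> of two-element subsets of \<open>V\<close>;
  the index set \<open>{1, ..., d}\<close> is rendered as \<open>{..<d}\<close>.\<close>

definition LSS_ring :: "'k::field itself \<Rightarrow> 'v set \<Rightarrow> nat \<Rightarrow> ('v \<times> nat, 'k) mpoly ring" where
  "LSS_ring K V d = poly_ring K (V \<times> {..<d})"

definition LSS_ideal ::
  "'k::field itself \<Rightarrow> 'v set \<Rightarrow> 'v set set \<Rightarrow> nat \<Rightarrow> ('v \<times> nat, 'k) mpoly set" where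
  "LSS_ideal K V E d =
     Idl\<^bsub>LSS_ring K V d\<^esub> {\<Sum>l<d. Var (u, l) * Var (v, l) | u v. {u, v} \<in> E}"


section \<open>Bipartite graphs and coordinate sections of determinantal ideals\<close>

text \<open>The two sides \<open>{1, ..., m}\<close> and \<open>{1~, ..., n~}\<close> are rendered zero-based as \<open>Inl ` {..<m}\<close> and
  \<open>Inr ` {..<n}\<close>, in accordance with the zero-based row and column indices of matrices.\<close>

definition bip_vertices :: "nat \<Rightarrow> nat \<Rightarrow> (nat + nat) set" where
  "bip_vertices m n = Inl ` {..<m} \<union> Inr ` {..<n}"

definition complete_bip_edges :: "nat \<Rightarrow> nat \<Rightarrow> (nat + nat) set set" where
  "complete_bip_edges m n = {{Inl i, Inr j} | i j. i < m \<and> j < n}"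

definition gen_ring :: "'k::field itself \<Rightarrow> nat \<Rightarrow> nat \<Rightarrow> (nat \<times> nat, 'k) mpoly ring" where
  "gen_ring K m n = poly_ring K ({..<m} \<times> {..<n})"

definition X_gen :: "'k::field itself \<Rightarrow> nat \<Rightarrow> nat \<Rightarrow> (nat \<times> nat, 'k) mpoly mat" where
  "X_gen K m n = mat m n Var"

definition X_gen_graph ::
  "'k::field itself \<Rightarrow> nat \<Rightarrow> nat \<Rightarrow> (nat + nat) set set \<Rightarrow> (nat \<times> nat, 'k) mpoly mat" where
  "X_gen_graph K m n E =
     mat m n (\<lambda>(i, j). if {Inl i, Inr j} \<in> E then 0 else X_gen K m n $$ (i, j))"

definition minors :: "nat \<Rightarrow> 'a::comm_ring_1 mat \<Rightarrow> 'a set" where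
  "minors t A =
     {det (submatrix A I J) | I J.
        I \<subseteq> {..<dim_row A} \<and> J \<subseteq> {..<dim_col A} \<and> card I = t \<and> card J = t}"

text \<open>The ambient ring is the full ring \<open>gen_ring\<close> in all \<open>m * n\<close> variables also when some of
  them do not occur in \<open>A\<close>.\<close>

definition det_ideal ::
  "'k::field itself \<Rightarrow> nat \<Rightarrow> (nat \<times> nat, 'k) mpoly mat \<Rightarrow> (nat \<times> nat, 'k) mpoly set" where
  "det_ideal K t A = Idl\<^bsub>gen_ring K (dim_row A) (dim_col A)\<^esub> (minors t A)"

definition has_maximal_height ::
  "'k::field itself \<Rightarrow> nat \<Rightarrow> nat \<Rightarrow> nat \<Rightarrow> (nat + nat) set set \<Rightarrow> bool" where
  "has_maximal_height K t m n E \<longleftrightarrow>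
     ideal_height (gen_ring K m n) (det_ideal K t (X_gen_graph K m n E)) =
     ideal_height (gen_ring K m n) (det_ideal K t (X_gen K m n))"

end

theory Submission
  imports Defs "HOL-Library.Product_Lexorder"
begin

text \<open>
  Let \<open>\<phi>\<close> be the ring homomorphism that sends \<open>x\<^sub>i\<^sub>j\<close> to the edge polynomial
  \<open>f\<^sub>i\<^sub>j = \<Sum>l<d. y\<^sub>i\<^sub>l y\<^sub>j\<^sub>l\<close>. Its kernel is the ideal of the \<open>(d + 1)\<close>-minors: monomials whose support
  has no strict chain of \<open>d + 1\<close> cells span modulo the minors, and their images are independent
  by a triangularity argument. The image of \<open>\<phi>\<close> is a direct summand of the big polynomial ring as
  a module over itself: over the rationals, the adjoint of multiplication by \<open>f\<^sub>i\<^sub>j\<close> for the Fischer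
  inner product maps the image to itself, so orthogonal projection is a linear retraction, and it
  extends to any field of characteristic zero. Hence the preimage of the ideal of the \<open>f\<^sub>e\<close> is
  generated by the minors and the \<open>x\<^sub>e\<close>, for edges \<open>e\<close>; radicality and primality pull back along \<open>\<phi>\<close>
  and survive the adjunction of the variables \<open>x\<^sub>e\<close>.

  The height of an ideal is the number of variables minus the largest size of a set of variables
  that is independent modulo the ideal. For the minors with zeros at the edges this size is at least
  that for the generic minors, since the generic minors degenerate to them. If the \<open>f\<^sub>e\<close> generate a
  complete intersection, they are quasi-regular, and variables independent modulo the special minors
  stay independent modulo the generic ones after adding all \<open>x\<^sub>e\<close>, so that the sizes agree.
\<close>

section \<open>Polynomials and substitutions\<close>

text \<open>A complete intersection is given by some regular sequence, which need not consist of the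
  edge polynomials. Regularity depends on the order and on the choice of generators, so the proof
  passes to quasi-regularity, which survives an invertible change of generators; the point to settle
  is that both generating sets have the same size. Dimension theory is replaced by counting. If all
  monomials reduce to exponents that are large at no more than \<open>a\<close> variables at a time,
  then only O(q^a) of them have degree at most \<open>q\<close>, too few for \<open>a + 1\<close>
  algebraically independent elements. This count bounds chains of primes, independent sets of cells,
  and the degeneration. Both heights are \<open>m * n\<close> minus the number of cells in the first
  \<open>d\<close> rows or columns: these contain no strict chain of \<open>d + 1\<close> cells, and
  no other set without such a chain is larger. Characteristic zero enters three times: polynomials
  with natural coefficients multiply without cancellation, the Fischer form is positive on rational
  polynomials, and equal traces give equal numbers of generators.\<close>

abbreviation "lookup \<equiv> Poly_Mapping.lookup"
abbreviation "keys \<equiv> Poly_Mapping.keys"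
abbreviation "single \<equiv> Poly_Mapping.single"

abbreviation cst :: "'c::zero \<Rightarrow> ('v, 'c) mpoly" where
  "cst c \<equiv> single 0 c"

abbreviation mon :: "('v \<Rightarrow>\<^sub>0 nat) \<Rightarrow> ('v, 'c::comm_ring_1) mpoly" where
  "mon \<mu> \<equiv> single \<mu> 1"

abbreviation vr :: "'v \<Rightarrow> ('v, 'c::comm_ring_1) mpoly" where
  "vr v \<equiv> mon (single v (Suc 0))"

lemma keys_add_nat: "keys (\<mu> + \<nu> :: 'v \<Rightarrow>\<^sub>0 nat) = keys \<mu> \<union> keys \<nu>"
  by (auto simp: in_keys_iff lookup_add)

definition evm :: "('v \<Rightarrow> 'b::comm_semiring_1) \<Rightarrow> ('v \<Rightarrow>\<^sub>0 nat) \<Rightarrow> 'b" where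
  "evm f \<mu> = (\<Prod>v\<in>keys \<mu>. f v ^ lookup \<mu> v)"

lemma evm_superset: "finite A \<Longrightarrow> keys \<mu> \<subseteq> A \<Longrightarrow> evm f \<mu> = (\<Prod>v\<in>A. f v ^ lookup \<mu> v)"
  unfolding evm_def by (rule prod.mono_neutral_left) (auto simp: in_keys_iff)

lemma evm_zero [simp]: "evm f 0 = 1"
  by (simp add: evm_def)

lemma evm_add: "evm f (\<mu> + \<nu>) = evm f \<mu> * evm f \<nu>"
proof -
  let ?A = "keys \<mu> \<union> keys \<nu>"
  have "evm f (\<mu> + \<nu>) = (\<Prod>v\<in>?A. f v ^ lookup (\<mu> + \<nu>) v)"
    by (rule evm_superset) (auto simp: keys_add_nat)
  also have "\<dots> = (\<Prod>v\<in>?A. f v ^ lookup \<mu> v) * (\<Prod>v\<in>?A. f v ^ lookup \<nu> v)"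
    by (simp add: lookup_add power_add prod.distrib)
  finally show ?thesis
    by (simp add: evm_superset[of ?A])
qed

lemma evm_single [simp]: "evm f (single v n) = f v ^ n"
  by (cases "n = 0") (simp_all add: evm_def)

text \<open>Substitution, currying and the retraction of \<open>ex_retraction\<close> are all linear
  extensions of a map given on exponents; the multiplicative ones are covered by
  \<open>lext_mult\<close>.\<close>

definition lext :: "('c::zero \<Rightarrow> 'b) \<Rightarrow> ('e \<Rightarrow> 'b) \<Rightarrow> ('e \<Rightarrow>\<^sub>0 'c) \<Rightarrow> 'b::comm_ring_1" where
  "lext \<iota> h p = (\<Sum>\<mu>\<in>keys p. \<iota> (lookup p \<mu>) * h \<mu>)"

lemma lext_superset:
  assumes "finite A" "keys p \<subseteq> A" "\<iota> 0 = 0"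
  shows "lext \<iota> h p = (\<Sum>\<mu>\<in>A. \<iota> (lookup p \<mu>) * h \<mu>)"
  unfolding lext_def using assms by (intro sum.mono_neutral_left) (auto simp: in_keys_iff)

lemma lext_zero [simp]: "lext \<iota> h 0 = 0"
  by (simp add: lext_def)

lemma lext_single: "\<iota> 0 = 0 \<Longrightarrow> lext \<iota> h (single \<mu> c) = \<iota> c * h \<mu>"
  by (cases "c = 0") (simp_all add: lext_def)

lemma lext_add:
  assumes "\<iota> 0 = 0" "\<And>a b. \<iota> (a + b) = \<iota> a + \<iota> b"
  shows "lext \<iota> h (p + q) = lext \<iota> h p + lext \<iota> h q"
proof -
  let ?A = "keys p \<union> keys q"
  have "lext \<iota> h (p + q) = (\<Sum>\<mu>\<in>?A. \<iota> (lookup (p + q) \<mu>) * h \<mu>)"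
    using assms Poly_Mapping.keys_add[of p q] by (intro lext_superset) auto
  also have "\<dots> = (\<Sum>\<mu>\<in>?A. \<iota> (lookup p \<mu>) * h \<mu>) + (\<Sum>\<mu>\<in>?A. \<iota> (lookup q \<mu>) * h \<mu>)"
    by (simp add: lookup_add assms algebra_simps sum.distrib)
  finally show ?thesis
    using assms by (simp add: lext_superset[of ?A])
qed

lemma poly_mapping_sum_single: "p = (\<Sum>\<mu>\<in>keys p. single \<mu> (lookup p \<mu>))"
proof (rule poly_mapping_eqI)
  fix \<mu>
  have "lookup (\<Sum>\<mu>\<in>keys p. single \<mu> (lookup p \<mu>)) \<mu> = (\<Sum>\<nu>\<in>keys p. if \<nu> = \<mu> then lookup p \<mu> else 0)"
    by (auto simp: lookup_sum lookup_single when_def intro!: sum.cong)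
  also have "\<dots> = lookup p \<mu>"
    by (simp add: in_keys_iff)
  finally show "lookup p \<mu> = lookup (\<Sum>\<mu>\<in>keys p. single \<mu> (lookup p \<mu>)) \<mu>" ..
qed

lemma single_sum: "single \<mu> (sum f A) = (\<Sum>a\<in>A. single \<mu> (f a))"
  by (induction A rule: infinite_finite_induct) (simp_all add: single_add)

lemma pm_induct [case_names zero single add]:
  assumes "P 0" "\<And>\<mu> c. P (single \<mu> c)" "\<And>p q. P p \<Longrightarrow> P q \<Longrightarrow> P (p + q)"
  shows "P (p :: 'e \<Rightarrow>\<^sub>0 'c::comm_monoid_add)"
proof -
  have "P (\<Sum>\<mu>\<in>A. single \<mu> (lookup p \<mu>))" for A
    by (induction A rule: infinite_finite_induct) (use assms in auto)
  then show ?thesis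
    using poly_mapping_sum_single[of p] by metis
qed

lemma lext_mult:
  fixes \<iota> :: "'c::comm_ring_1 \<Rightarrow> 'b::comm_ring_1"
  assumes "comm_ring_hom \<iota>" "\<And>\<mu> \<nu>. h (\<mu> + \<nu>) = h \<mu> * h \<nu>"
  shows "lext \<iota> h (p * q) = lext \<iota> h p * lext \<iota> h q"
proof -
  interpret comm_ring_hom \<iota> by fact
  have add: "lext \<iota> h (x + y) = lext \<iota> h x + lext \<iota> h y" for x y
    by (rule lext_add) (simp_all add: hom_add)
  show ?thesis
  proof (induction p rule: pm_induct)
    case (single \<mu> c)
    show ?case
      by (induction q rule: pm_induct)
        (simp_all add: mult_single lext_single add distrib_left hom_mult assms(2) algebra_simps)
  qed (simp_all add: add distrib_right)
qed

definition ev :: "('c::comm_ring_1 \<Rightarrow> 'b) \<Rightarrow> ('v \<Rightarrow> 'b) \<Rightarrow> (('v, 'c) mpoly) \<Rightarrow> 'b::comm_ring_1" where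
  "ev \<iota> f = lext \<iota> (evm f)"

lemma ev_single: "comm_ring_hom \<iota> \<Longrightarrow> ev \<iota> f (single \<mu> c) = \<iota> c * evm f \<mu>"
proof -
  assume "comm_ring_hom \<iota>"
  then interpret comm_ring_hom \<iota> .
  show ?thesis unfolding ev_def by (rule lext_single) simp
qed

lemma comm_ring_hom_ev:
  assumes "comm_ring_hom \<iota>"
  shows "comm_ring_hom (ev \<iota> f)"
proof -
  interpret comm_ring_hom \<iota> by fact
  show ?thesis
  proof
    show "ev \<iota> f 1 = 1"
      by (simp add: single_one[symmetric] ev_single assms del: single_one)
    show "ev \<iota> f 0 = 0" by (simp add: ev_def)
  qed (simp_all add: ev_def lext_add hom_add lext_mult assms evm_add)
qed

lemma comm_ring_hom_cst: "comm_ring_hom (cst :: 'c::comm_ring_1 \<Rightarrow> ('v, 'c) mpoly)"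
  by standard (simp_all add: mult_single single_add)

lemma comm_ring_hom_id: "comm_ring_hom (\<lambda>x::'a::comm_ring_1. x)"
  by standard simp_all

text \<open>The carrier of \<open>poly_ring K X\<close> as a plain set. Computations take place in
  the type of all polynomials, where the type class laws apply, and membership in
  \<open>polys X\<close> keeps track of the variables.\<close>

definition polys :: "'v set \<Rightarrow> (('v, 'c::zero) mpoly) set" where
  "polys X = {p. \<forall>\<mu>\<in>keys p. keys \<mu> \<subseteq> X}"

lemma carrier_poly_ring [simp]: "carrier (poly_ring K X) = polys X"
  by (simp add: poly_ring_def polys_def)

lemma polysI: "(\<And>\<mu>. \<mu> \<in> keys p \<Longrightarrow> keys \<mu> \<subseteq> X) \<Longrightarrow> p \<in> polys X"
  by (simp add: polys_def)

lemma polysD: "p \<in> polys X \<Longrightarrow> \<mu> \<in> keys p \<Longrightarrow> keys \<mu> \<subseteq> X"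
  by (auto simp: polys_def)

lemma polys_mono: "X \<subseteq> Y \<Longrightarrow> polys X \<subseteq> polys Y"
  by (auto simp: polys_def)

lemma polys_UNIV [simp]: "polys UNIV = UNIV"
  by (auto simp: polys_def)

lemma polys_single [simp]: "single \<mu> c \<in> polys X \<longleftrightarrow> c = 0 \<or> keys \<mu> \<subseteq> X"
  by (auto simp: polys_def)

lemma polys_zero [simp]: "0 \<in> polys X"
  by (simp add: polys_def)

lemma polys_one [simp]: "(1 :: ('v, 'c::comm_ring_1) mpoly) \<in> polys X"
  by (simp add: single_one[symmetric] del: single_one)

lemma polys_add: "p \<in> polys X \<Longrightarrow> q \<in> polys X \<Longrightarrow> p + q \<in> polys X"
  for p :: "('v, 'c::comm_monoid_add) mpoly"
  using Poly_Mapping.keys_add[of p q] by (fastforce simp: polys_def)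

lemma polys_mult: "p \<in> polys X \<Longrightarrow> q \<in> polys X \<Longrightarrow> p * q \<in> polys X"
  for p :: "('v, 'c::comm_ring_1) mpoly"
proof (rule polysI)
  fix \<mu> assume p: "p \<in> polys X" and q: "q \<in> polys X" and "\<mu> \<in> keys (p * q)"
  then obtain a b where "\<mu> = a + b" "a \<in> keys p" "b \<in> keys q"
    using keys_mult[of p q] by blast
  then show "keys \<mu> \<subseteq> X"
    using polysD[OF p] polysD[OF q] by (simp add: keys_add_nat)
qed

lemma polys_uminus [simp]: "- p \<in> polys X \<longleftrightarrow> p \<in> polys X"
  for p :: "('v, 'c::comm_ring_1) mpoly"
  by (auto simp: polys_def in_keys_iff)

lemma polys_diff: "p \<in> polys X \<Longrightarrow> q \<in> polys X \<Longrightarrow> p - q \<in> polys X"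
  for p :: "('v, 'c::comm_ring_1) mpoly"
  using polys_add[of p X "- q"] by simp

lemma polys_sum: "(\<And>a. a \<in> A \<Longrightarrow> p a \<in> polys X) \<Longrightarrow> sum p A \<in> polys X"
  for p :: "'i \<Rightarrow> ('v, 'c::comm_monoid_add) mpoly"
  by (induction A rule: infinite_finite_induct) (auto intro: polys_add)

lemma polys_prod: "(\<And>a. a \<in> A \<Longrightarrow> p a \<in> polys X) \<Longrightarrow> prod p A \<in> polys X"
  for p :: "'i \<Rightarrow> ('v, 'c::comm_ring_1) mpoly"
  by (induction A rule: infinite_finite_induct) (auto intro: polys_mult)

lemma polys_power: "p \<in> polys X \<Longrightarrow> p ^ n \<in> polys X"
  for p :: "('v, 'c::comm_ring_1) mpoly"
  by (induction n) (auto intro: polys_mult)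

lemma exp_induct [case_names zero add]:
  assumes "P 0" "\<And>v \<mu>. P \<mu> \<Longrightarrow> P (single v (Suc 0) + \<mu>)"
  shows "P (\<mu> :: 'v \<Rightarrow>\<^sub>0 nat)"
proof (induction "\<Sum>v\<in>keys \<mu>. lookup \<mu> v" arbitrary: \<mu> rule: less_induct)
  case less
  show ?case
  proof (cases "\<mu> = 0")
    case False
    then obtain v where v: "v \<in> keys \<mu>"
      using keys_eq_empty by blast
    let ?\<nu> = "\<mu> - single v (Suc 0)"
    have eq: "\<mu> = single v (Suc 0) + ?\<nu>"
      using v by (intro poly_mapping_eqI) (auto simp: lookup_add lookup_minus lookup_single when_def in_keys_iff)
    have "(\<Sum>v\<in>keys ?\<nu>. lookup ?\<nu> v) = (\<Sum>v\<in>keys \<mu>. lookup ?\<nu> v)"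
      by (rule sum.mono_neutral_left) (auto simp: in_keys_iff lookup_minus)
    also have "\<dots> < (\<Sum>v\<in>keys \<mu>. lookup \<mu> v)"
      using v by (intro sum_strict_mono_ex1) (auto simp: lookup_minus in_keys_iff intro!: bexI[of _ v])
    finally show ?thesis
      using less assms(2) eq by metis
  qed (use assms(1) in simp)
qed

lemma exp_induct_on [consumes 1, case_names zero add]:
  assumes "keys \<mu> \<subseteq> X" "P 0" "\<And>v \<mu>. v \<in> X \<Longrightarrow> keys \<mu> \<subseteq> X \<Longrightarrow> P \<mu> \<Longrightarrow> P (single v (Suc 0) + \<mu>)"
  shows "P (\<mu> :: 'v \<Rightarrow>\<^sub>0 nat)"
proof -
  have "keys \<mu> \<subseteq> X \<longrightarrow> P \<mu>"
    by (induction \<mu> rule: exp_induct) (use assms in \<open>auto simp: keys_add_nat\<close>)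
  then show ?thesis using assms(1) by simp
qed

lemma polys_lin_induct [consumes 1, case_names zero single add]:
  assumes "p \<in> polys X" "P 0" "\<And>\<mu> c. keys \<mu> \<subseteq> X \<Longrightarrow> P (single \<mu> c)"
    "\<And>p q. P p \<Longrightarrow> P q \<Longrightarrow> P (p + q)"
  shows "P (p :: ('v, 'c::comm_ring_1) mpoly)"
proof -
  have "A \<subseteq> keys p \<Longrightarrow> P (\<Sum>\<mu>\<in>A. single \<mu> (lookup p \<mu>))" for A
    by (induction A rule: infinite_finite_induct) (use assms(2-4) polysD[OF assms(1)] in auto)
  then show ?thesis
    using poly_mapping_sum_single[of p] by (metis order_refl)
qed

lemma polys_induct [consumes 1, case_names const var add mult]:
  assumes "p \<in> polys X" "\<And>c. P (cst c)" "\<And>v. v \<in> X \<Longrightarrow> P (vr v)"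
    and add: "\<And>p q. P p \<Longrightarrow> P q \<Longrightarrow> P (p + q)" and mult: "\<And>p q. P p \<Longrightarrow> P q \<Longrightarrow> P (p * q)"
  shows "P (p :: ('v, 'c::comm_ring_1) mpoly)"
  using assms(1)
proof (induction p rule: polys_lin_induct)
  case zero
  then show ?case using assms(2)[of 0] by simp
next
  case (single \<mu> c)
  have "P (mon \<mu>)" using single
    by (induction \<mu> rule: exp_induct_on)
      (use assms(2)[of 1] mult[OF assms(3), of _ "mon _"] in \<open>auto simp: mult_single\<close>)
  then show ?case
    using mult[OF assms(2)[of c]] by (metis mult_single add_0 mult.right_neutral)
qed (use add in auto)

lemma ev_in_polys:
  assumes "p \<in> polys X" "\<And>v. v \<in> X \<Longrightarrow> f v \<in> polys Y"
  shows "ev cst f p \<in> polys Y"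
proof -
  interpret comm_ring_hom "ev cst f" by (rule comm_ring_hom_ev[OF comm_ring_hom_cst])
  show ?thesis using assms(1)
  proof (induction p rule: polys_induct)
    case (const c) then show ?case by (simp add: ev_single comm_ring_hom_cst)
  qed (use assms(2) in \<open>simp_all add: ev_single comm_ring_hom_cst hom_add hom_mult polys_add polys_mult\<close>)
qed

lemma hom_eq_on_polys:
  assumes "comm_ring_hom F" "comm_ring_hom G" "p \<in> polys X"
    "\<And>c. F (cst c) = G (cst c)" "\<And>v. v \<in> X \<Longrightarrow> F (vr v) = G (vr v)"
  shows "F p = G p"
proof -
  interpret F: comm_ring_hom F by fact
  interpret G: comm_ring_hom G by fact
  show ?thesis using assms(3)
    by (induction p rule: polys_induct) (use assms in \<open>simp_all add: F.hom_add G.hom_add F.hom_mult G.hom_mult\<close>)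
qed

lemma comm_ring_hom_compose:
  assumes "comm_ring_hom F" "comm_ring_hom G"
  shows "comm_ring_hom (\<lambda>x. F (G x))"
proof -
  interpret F: comm_ring_hom F by fact
  interpret G: comm_ring_hom G by fact
  show ?thesis by standard (simp_all add: F.hom_add G.hom_add F.hom_mult G.hom_mult)
qed

lemma ring_homI:
  assumes "F 1 = 1" "\<And>x y. F (x + y) = F x + F y" "\<And>x y. F (x * y) = F x * F y"
  shows "comm_ring_hom (F :: 'a::comm_ring_1 \<Rightarrow> 'b::comm_ring_1)"
proof
  show "F 0 = 0" using assms(2)[of 0 0] by simp
qed (use assms in auto)

text \<open>An ideal is a submodule of the ring over itself, so a generated ideal is a span.
  \<open>idg G\<close> is formed in the ring of all variables; \<open>Idl_poly_ring\<close> leads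
  back to the ring over \<open>X\<close>.\<close>

global_interpretation idl: Modules.module "(*) :: 'a::comm_ring_1 \<Rightarrow> 'a \<Rightarrow> 'a"
  defines idg = idl.span
  by standard (simp_all add: algebra_simps)

lemma idg_mult: "a \<in> idg G \<Longrightarrow> b * a \<in> idg G"
  by (rule idl.span_scale)

lemma idg_mult_right: "a \<in> idg G \<Longrightarrow> a * b \<in> idg G"
  using idg_mult[of a G b] by (simp add: mult.commute)

lemma idg_minimal: "G \<subseteq> idg H \<Longrightarrow> idg G \<subseteq> idg H"
  using idl.span_minimal idl.subspace_span by blast

lemma idg_induct [consumes 1, case_names zero step]:
  assumes "a \<in> idg G" "P 0" "\<And>b g x. g \<in> G \<Longrightarrow> P x \<Longrightarrow> P (b * g + x)"
  shows "P a"
  using idl.span_induct_alt[of a G P] assms by auto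

text \<open>Coefficients are indexed by \<open>I\<close> and not by the generators, so that repeated
  generators do no harm and the coefficients can later be read as rows of a matrix.\<close>

lemma idg_imageD:
  assumes "a \<in> idg (f ` I)" "finite I"
  shows "\<exists>c. a = (\<Sum>i\<in>I. c i * f i)"
  using assms(1)
proof (induction rule: idg_induct)
  case zero
  then show ?case by (intro exI[of _ "\<lambda>_. 0"]) simp
next
  case (step b g x)
  then obtain c i where c: "x = (\<Sum>i\<in>I. c i * f i)" "i \<in> I" "g = f i" by auto
  have "b * g + x = (\<Sum>j\<in>I. (if j = i then b else 0) * f j) + (\<Sum>j\<in>I. c j * f j)"
    using c assms(2) by (simp add: if_distrib[of "\<lambda>t. t * _"] sum.delta cong: if_cong)
  also have "\<dots> = (\<Sum>j\<in>I. ((if j = i then b else 0) + c j) * f j)"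
    by (simp add: sum.distrib distrib_right)
  finally show ?case by (intro exI)
qed

lemma idg_hom_image:
  assumes "comm_ring_hom F" "a \<in> idg G" "\<And>g. g \<in> G \<Longrightarrow> F g \<in> idg H"
  shows "F a \<in> idg H"
proof -
  interpret comm_ring_hom F by fact
  show ?thesis using assms(2)
    by (induction rule: idg_induct) (simp_all add: hom_add hom_mult assms(3) idl.span_add idg_mult idl.span_zero)
qed

lemma hom_cong_idg:
  assumes "comm_ring_hom F" "comm_ring_hom G" "p \<in> polys X"
    "\<And>c. F (cst c) - G (cst c) \<in> idg J" "\<And>v. v \<in> X \<Longrightarrow> F (vr v) - G (vr v) \<in> idg J"
  shows "F p - G p \<in> idg J"
proof -
  interpret F: comm_ring_hom F by fact
  interpret G: comm_ring_hom G by fact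
  show ?thesis using assms(3)
  proof (induction p rule: polys_induct)
    case (add p q)
    have "F (p + q) - G (p + q) = (F p - G p) + (F q - G q)"
      by (simp add: F.hom_add G.hom_add)
    then show ?case using add by (metis idl.span_add)
  next
    case (mult p q)
    have "F (p * q) - G (p * q) = F p * (F q - G q) + G q * (F p - G p)"
      by (simp add: F.hom_mult G.hom_mult algebra_simps)
    then show ?case using mult by (metis idl.span_add idg_mult)
  qed (use assms in auto)
qed

section \<open>Restricting variables\<close>

text \<open>With \<open>W = - X\<close> this is the retraction of the full ring onto
  \<open>polys X\<close>; with \<open>W\<close> a set of cells it turns the generic matrix into that
  of the graph.\<close>

definition kill :: "'v set \<Rightarrow> (('v, 'c::comm_ring_1) mpoly) \<Rightarrow> ('v, 'c) mpoly" where
  "kill W = ev cst (\<lambda>v. if v \<in> W then 0 else vr v)"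

lemma comm_ring_hom_kill: "comm_ring_hom (kill W)"
  unfolding kill_def by (rule comm_ring_hom_ev[OF comm_ring_hom_cst])

lemma kill_cst [simp]: "kill W (cst c) = cst c"
  by (simp add: kill_def ev_single comm_ring_hom_cst)

lemma kill_vr: "kill W (vr v) = (if v \<in> W then 0 else vr v)"
  by (simp add: kill_def ev_single comm_ring_hom_cst)

lemma kill_id: "p \<in> polys X \<Longrightarrow> X \<inter> W = {} \<Longrightarrow> kill W p = p"
  by (rule hom_eq_on_polys[OF comm_ring_hom_kill comm_ring_hom_id]) (auto simp: kill_vr)

lemma kill_in_polys: "p \<in> polys X \<Longrightarrow> kill W p \<in> polys (X - W)"
  unfolding kill_def by (rule ev_in_polys) auto

lemma mon_eq_evm: "(mon \<mu> :: ('v, 'c::comm_ring_1) mpoly) = evm vr \<mu>"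
proof (induction \<mu> rule: exp_induct)
  case (add v \<mu>)
  have "(mon (single v (Suc 0) + \<mu>) :: ('v, 'c) mpoly) = vr v * mon \<mu>"
    by (simp add: mult_single)
  then show ?case by (simp add: add.IH evm_add)
qed simp

lemma kill_mon: "kill W (mon \<mu>) = (if keys \<mu> \<inter> W = {} then mon \<mu> else 0)"
proof (cases "keys \<mu> \<inter> W = {}")
  case True
  then show ?thesis using kill_id[of "mon \<mu>" "keys \<mu>" W] by simp
next
  case False
  then obtain v where "v \<in> keys \<mu>" "v \<in> W" by blast
  then have "evm (\<lambda>v. if v \<in> W then 0 else vr v) \<mu> = 0"
    unfolding evm_def by (intro prod_zero) (auto intro!: bexI[of _ v] simp: in_keys_iff power_0_left)
  then show ?thesis using False by (simp add: kill_def ev_single comm_ring_hom_cst)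
qed

text \<open>Additional variables create no new elements: \<open>kill (- X)\<close> fixes the
  generators and moves the coefficients of a combination into \<open>polys X\<close>.\<close>

lemma Idl_poly_ring:
  fixes G :: "('v, 'k::field) mpoly set"
  assumes "G \<subseteq> polys X"
  shows "Idl\<^bsub>poly_ring K X\<^esub> G = polys X \<inter> idg G"
proof -
  interpret cring "poly_ring K X" by (rule poly_ring_cring)
  have G: "G \<subseteq> carrier (poly_ring K X)" using assms by simp
  interpret I: ideal "Idl\<^bsub>poly_ring K X\<^esub> G" "poly_ring K X" by (rule genideal_ideal[OF G])
  have sub: "G \<subseteq> Idl\<^bsub>poly_ring K X\<^esub> G" by (rule genideal_self[OF G])
  show ?thesis
  proof
    have "ideal (polys X \<inter> idg G) (poly_ring K X)"
    proof (rule idealI)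
      show "ring (poly_ring K X)" by (rule ring_axioms)
      show "subgroup (polys X \<inter> idg G) (add_monoid (poly_ring K X))"
      proof (rule add.subgroupI)
        have "0 \<in> polys X \<inter> idg G" by (simp add: idl.span_zero)
        then show "polys X \<inter> idg G \<noteq> {}" by blast
        show "\<ominus>\<^bsub>poly_ring K X\<^esub> a \<in> polys X \<inter> idg G" if "a \<in> polys X \<inter> idg G" for a
        proof -
          have "\<ominus>\<^bsub>poly_ring K X\<^esub> a = - a"
            using that by (intro minus_equality) auto
          then show ?thesis using that idl.span_neg by auto
        qed
      qed (use idl.span_zero[of G] in \<open>auto intro: polys_add idl.span_add\<close>)
    qed (auto intro: polys_mult idg_mult idg_mult_right)
    then show "Idl\<^bsub>poly_ring K X\<^esub> G \<subseteq> polys X \<inter> idg G"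
      by (rule genideal_minimal) (use assms in \<open>auto intro: idl.span_base\<close>)
    show "polys X \<inter> idg G \<subseteq> Idl\<^bsub>poly_ring K X\<^esub> G"
    proof
      fix a assume a: "a \<in> polys X \<inter> idg G"
      interpret kill: comm_ring_hom "kill (- X) :: ('v, 'k) mpoly \<Rightarrow> _" by (rule comm_ring_hom_kill)
      have kp: "kill (- X) b \<in> polys X" for b :: "('v, 'k) mpoly"
        using kill_in_polys[of b UNIV "- X"] by simp
      have "a \<in> idg G" using a by simp
      then have "kill (- X) a \<in> Idl\<^bsub>poly_ring K X\<^esub> G"
      proof (induction rule: idg_induct)
        case zero
        then show ?case using I.zero_closed by simp
      next
        case (step b g x)
        have "kill (- X) g = g" using step(1) assms by (intro kill_id[of _ X]) auto
        then have "kill (- X) (b * g + x) = kill (- X) b * g + kill (- X) x"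
          by (simp add: kill.hom_add kill.hom_mult)
        moreover have "kill (- X) b * g \<in> Idl\<^bsub>poly_ring K X\<^esub> G"
          using I.I_l_closed[of g "kill (- X) b"] sub step(1) kp by auto
        ultimately show ?case using I.a_closed[of "kill (- X) b * g" "kill (- X) x"] step(2) by simp
      qed
      moreover have "kill (- X) a = a" using a by (intro kill_id[of _ X]) auto
      ultimately show "a \<in> Idl\<^bsub>poly_ring K X\<^esub> G" by simp
    qed
  qed
qed

section \<open>Polynomials with polynomial coefficients\<close>

definition rest :: "'v set \<Rightarrow> ('v \<Rightarrow>\<^sub>0 nat) \<Rightarrow> 'v \<Rightarrow>\<^sub>0 nat" where
  "rest W \<mu> = Abs_poly_mapping (\<lambda>v. if v \<in> W then lookup \<mu> v else 0)"

lemma lookup_rest: "lookup (rest W \<mu>) v = (if v \<in> W then lookup \<mu> v else 0)"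
proof -
  have "finite {v. (if v \<in> W then lookup \<mu> v else 0) \<noteq> 0}"
    by (rule finite_subset[of _ "keys \<mu>"]) (auto simp: in_keys_iff)
  then show ?thesis by (simp add: rest_def)
qed

lemma keys_rest: "keys (rest W \<mu>) = keys \<mu> \<inter> W"
  by (auto simp: in_keys_iff lookup_rest split: if_splits)

lemma rest_add: "rest W (\<mu> + \<nu>) = rest W \<mu> + rest W \<nu>"
  by (rule poly_mapping_eqI) (simp add: lookup_rest lookup_add)

lemma rest_split: "rest W \<mu> + rest (- W) \<mu> = \<mu>"
  by (rule poly_mapping_eqI) (simp add: lookup_rest lookup_add)

lemma rest_id: "keys \<mu> \<subseteq> W \<Longrightarrow> rest W \<mu> = \<mu>"
  by (rule poly_mapping_eqI) (auto simp: lookup_rest in_keys_iff)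

lemma rest_0: "keys \<mu> \<inter> W = {} \<Longrightarrow> rest W \<mu> = 0"
  by (rule poly_mapping_eqI) (auto simp: lookup_rest in_keys_iff)

text \<open>\<open>curry_in W p\<close> regards \<open>p\<close> as a polynomial in the variables outside \<open>W\<close>, with coefficients
  that are polynomials in the variables from \<open>W\<close>.\<close>

definition curry_in ::
  "'v set \<Rightarrow> (('v, 'c::comm_ring_1) mpoly) \<Rightarrow> ('v \<Rightarrow>\<^sub>0 nat) \<Rightarrow>\<^sub>0 (('v, 'c) mpoly)" where
  "curry_in W = lext (\<lambda>c. single 0 (cst c)) (\<lambda>\<mu>. single (rest (- W) \<mu>) (mon (rest W \<mu>)))"

lemma comm_ring_hom_cst_cst: "comm_ring_hom (\<lambda>c::'c::comm_ring_1. single 0 (cst c))"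
  by (rule ring_homI) (simp_all add: single_add mult_single)

lemma curry_in_single:
  "curry_in W (single \<mu> c) = single (rest (- W) \<mu>) (single (rest W \<mu>) c)"
  by (simp add: curry_in_def lext_single mult_single)

lemma curry_in_add: "curry_in W (p + q) = curry_in W p + curry_in W q"
  unfolding curry_in_def by (rule lext_add) (simp_all add: single_add)

lemma curry_in_zero [simp]: "curry_in W 0 = 0"
  by (simp add: curry_in_def)

lemma curry_in_mult: "curry_in W (p * q) = curry_in W p * curry_in W q"
  unfolding curry_in_def by (rule lext_mult[OF comm_ring_hom_cst_cst]) (simp add: rest_add mult_single)

lemma comm_ring_hom_curry_in: "comm_ring_hom (curry_in W)"
  by (rule ring_homI)
    (simp_all add: curry_in_add curry_in_mult curry_in_single rest_0 single_one[symmetric] del: single_one)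

lemma curry_in_on: "p \<in> polys W \<Longrightarrow> curry_in W p = single 0 p"
proof (induction p rule: polys_lin_induct)
  case (single \<mu> c)
  then have "keys \<mu> \<inter> - W = {}" by auto
  then show ?case using single by (simp add: curry_in_single rest_id rest_0)
qed (simp_all add: curry_in_add single_add)

lemma lookup_single_mult: "lookup (single 0 c * p) \<mu> = c * lookup p \<mu>"
  for p :: "('v, 'c::comm_ring_1) mpoly"
  by (simp add: Poly_Mapping.map.rep_eq when_def flip: mult_map_scale_conv_mult)

lemma lookup_curry_in_mult_left:
  "p \<in> polys W \<Longrightarrow> lookup (curry_in W (p * q)) \<alpha> = p * lookup (curry_in W q) \<alpha>"
  by (simp add: curry_in_mult curry_in_on lookup_single_mult)

lemma lookup_curry_in_polys:
  assumes "p \<in> polys X"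
  shows "lookup (curry_in W p) \<alpha> \<in> polys (X \<inter> W)"
  using assms
proof (induction p rule: polys_lin_induct)
  case (single \<mu> c)
  then show ?case by (auto simp: curry_in_single lookup_single when_def keys_rest)
qed (auto simp: curry_in_add lookup_add intro: polys_add)

lemma keys_curry_in:
  assumes "p \<in> polys X" "\<alpha> \<in> keys (curry_in W p)"
  shows "keys \<alpha> \<subseteq> X - W"
proof -
  have "lookup (curry_in W p) \<alpha> \<noteq> 0 \<longrightarrow> keys \<alpha> \<subseteq> X - W" using assms(1)
  proof (induction p rule: polys_lin_induct)
    case (single \<mu> c)
    then show ?case by (auto simp: curry_in_single lookup_single when_def keys_rest)
  qed (auto simp: curry_in_add lookup_add)
  then show ?thesis using assms(2) by (simp add: in_keys_iff)
qed

lemma uncurry: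
  fixes p :: "('v, 'c::comm_ring_1) mpoly"
  shows "p = (\<Sum>\<alpha>\<in>keys (curry_in W p). mon \<alpha> * lookup (curry_in W p) \<alpha>)"
proof -
  let ?u = "lext (\<lambda>c. c) (mon :: _ \<Rightarrow> ('v, 'c) mpoly) :: _ \<Rightarrow> ('v, 'c) mpoly"
  have "?u (curry_in W p) = p"
  proof (induction p rule: pm_induct)
    case (single \<mu> c)
    then show ?case
      by (simp add: curry_in_single lext_single mult_single rest_split)
  qed (simp_all add: curry_in_add lext_add)
  then show ?thesis by (simp add: lext_def mult.commute)
qed

section \<open>Prime and radical ideals\<close>

definition pideal :: "'v set \<Rightarrow> (('v, 'c::comm_ring_1) mpoly) set \<Rightarrow> bool" where
  "pideal X I \<longleftrightarrow> I \<subseteq> polys X \<and> 0 \<in> I \<and> (\<forall>a\<in>I. \<forall>b\<in>I. a + b \<in> I) \<and> (\<forall>a\<in>polys X. \<forall>b\<in>I. a * b \<in> I)"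

definition pprime :: "'v set \<Rightarrow> (('v, 'c::comm_ring_1) mpoly) set \<Rightarrow> bool" where
  "pprime X I \<longleftrightarrow> pideal X I \<and> 1 \<notin> I \<and> (\<forall>a\<in>polys X. \<forall>b\<in>polys X. a * b \<in> I \<longrightarrow> a \<in> I \<or> b \<in> I)"

definition pradical :: "'v set \<Rightarrow> (('v, 'c::comm_ring_1) mpoly) set \<Rightarrow> bool" where
  "pradical X I \<longleftrightarrow> pideal X I \<and> (\<forall>a\<in>polys X. \<forall>n. a ^ n \<in> I \<longrightarrow> a \<in> I)"

lemma pidealD:
  assumes "pideal X I"
  shows "a \<in> I \<Longrightarrow> a \<in> polys X" "0 \<in> I" "a \<in> I \<Longrightarrow> b \<in> I \<Longrightarrow> a + b \<in> I"
    "a \<in> polys X \<Longrightarrow> b \<in> I \<Longrightarrow> a * b \<in> I" "a \<in> polys X \<Longrightarrow> b \<in> I \<Longrightarrow> b * a \<in> I"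
  using assms by (auto simp: pideal_def mult.commute)

lemma pideal_uminus: "pideal X I \<Longrightarrow> a \<in> I \<Longrightarrow> - a \<in> I"
  using pidealD(4)[of X I "- 1" a] by simp

lemma pideal_diff: "pideal X I \<Longrightarrow> a \<in> I \<Longrightarrow> b \<in> I \<Longrightarrow> a - b \<in> I"
  using pidealD(3)[of X I a "- b"] pideal_uminus[of X I b] by simp

lemma pideal_cancel: "pideal X I \<Longrightarrow> a - b \<in> I \<Longrightarrow> a \<in> I \<Longrightarrow> b \<in> I"
  using pideal_diff[of X I a "a - b"] by simp

lemma pideal_sum: "pideal X I \<Longrightarrow> (\<And>i. i \<in> A \<Longrightarrow> f i \<in> I) \<Longrightarrow> sum f A \<in> I"
  by (induction A rule: infinite_finite_induct) (auto intro: pidealD)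

lemma pideal_one: "pideal X I \<Longrightarrow> 1 \<in> I \<longleftrightarrow> I = polys X"
  using pidealD(4)[of X I _ 1] by (auto dest: pidealD(1))

lemma pideal_idg: "pideal X (polys X \<inter> idg G)"
  unfolding pideal_def by (auto simp: idl.span_zero intro: polys_add polys_mult idl.span_add idg_mult)

lemma ideal_poly_ring_iff: "ideal I (poly_ring K X) \<longleftrightarrow> pideal X I"
proof
  assume "ideal I (poly_ring K X)"
  then interpret ideal I "poly_ring K X" .
  show "pideal X I"
    unfolding pideal_def using a_subset I_l_closed
      additive_subgroup.zero_closed[OF additive_subgroup_axioms] additive_subgroup.a_closed[OF additive_subgroup_axioms]
    by auto
next
  assume I: "pideal X I"
  interpret cring "poly_ring K X" by (rule poly_ring_cring)
  show "ideal I (poly_ring K X)"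
  proof (rule idealI)
    show "subgroup I (add_monoid (poly_ring K X))"
    proof (rule add.subgroupI)
      show "\<ominus>\<^bsub>poly_ring K X\<^esub> a \<in> I" if "a \<in> I" for a
      proof -
        have "\<ominus>\<^bsub>poly_ring K X\<^esub> a = - a"
          using that I by (intro minus_equality) (auto dest: pidealD(1))
        then show ?thesis using that I by (simp add: pideal_uminus)
      qed
    qed (use I in \<open>auto intro: pidealD\<close>)
  qed (use I in \<open>auto intro: pidealD ring_axioms\<close>)
qed

lemma primeideal_poly_ring_iff: "primeideal I (poly_ring K X) \<longleftrightarrow> pprime X I"
proof
  assume "primeideal I (poly_ring K X)"
  then interpret primeideal I "poly_ring K X" .
  have "pideal X I" using is_ideal by (simp add: ideal_poly_ring_iff)
  then show "pprime X I"
    unfolding pprime_def using I_notcarr I_prime pideal_one by auto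
next
  assume I: "pprime X I"
  then have i: "pideal X I" by (simp add: pprime_def)
  show "primeideal I (poly_ring K X)"
    by (intro primeideal.intro primeideal_axioms.intro poly_ring_cring)
      (use I i pideal_one[OF i] in \<open>auto simp: ideal_poly_ring_iff pprime_def\<close>)
qed

lemma poly_ring_pow: "a [^]\<^bsub>poly_ring K X\<^esub> (n::nat) = a ^ n"
  by (induction n) (simp_all add: nat_pow_def mult.commute)

lemma is_radical_ideal_poly_ring_iff: "is_radical_ideal I (poly_ring K X) \<longleftrightarrow> pradical X I"
proof
  assume "is_radical_ideal I (poly_ring K X)"
  then have i: "pideal X I" and r: "radical_of (poly_ring K X) I = I"
    by (auto simp: is_radical_ideal_def ideal_poly_ring_iff)
  have "a \<in> I" if a: "a \<in> polys X" "a ^ n \<in> I" for a n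
  proof -
    \<comment> \<open>\<open>radical_of\<close> asks for a positive exponent, whereas
      \<open>pradical\<close> also admits 0.\<close>
    have "a ^ Suc n \<in> I" using pidealD(4)[OF i a(1) a(2)] by simp
    then have "a \<in> radical_of (poly_ring K X) I"
      using a(1) by (auto simp: radical_of_def poly_ring_pow)
    then show ?thesis by (simp only: r)
  qed
  then show "pradical X I" using i by (auto simp: pradical_def)
next
  assume r: "pradical X I"
  then have i: "pideal X I" by (simp add: pradical_def)
  have "a \<in> radical_of (poly_ring K X) I" if "a \<in> I" for a
    using that pidealD(1)[OF i that] unfolding radical_of_def by (auto simp: poly_ring_pow intro!: exI[of _ 1])
  then have "radical_of (poly_ring K X) I = I"
    using r by (auto simp: radical_of_def poly_ring_pow pradical_def)
  then show "is_radical_ideal I (poly_ring K X)"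
    using i by (simp add: is_radical_ideal_def ideal_poly_ring_iff)
qed

section \<open>Leading coefficients and extension of ideals to more variables\<close>

lemma poly_mapping_mult_sum:
  "(F :: 'e::monoid_add \<Rightarrow>\<^sub>0 'c::comm_ring_1) * G =
     (\<Sum>x\<in>keys F. \<Sum>y\<in>keys G. single (x + y) (lookup F x * lookup G y))"
proof -
  have "F * G = (\<Sum>x\<in>keys F. single x (lookup F x)) * (\<Sum>y\<in>keys G. single y (lookup G y))"
    using poly_mapping_sum_single[of F] poly_mapping_sum_single[of G] by metis
  then show ?thesis by (simp add: sum_product mult_single)
qed

text \<open>Modulo \<open>I\<close>, the exponents of \<open>F\<close> and \<open>G\<close> do not
  exceed \<open>a\<close> and \<open>b\<close>. Any pair of exponents with sum \<open>a + b\<close>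
  other than \<open>(a, b)\<close> has a member above its bound, so it contributes an element of
  \<open>I\<close>.\<close>

lemma leading_coeff_mult:
  fixes F G :: "'e::{linordered_cancel_ab_semigroup_add, ordered_cancel_comm_monoid_add} \<Rightarrow>\<^sub>0 (('v, 'c::comm_ring_1) mpoly)"
  assumes I: "pideal W I"
    and F: "\<And>x. lookup F x \<in> polys W" "\<And>x. a < x \<Longrightarrow> lookup F x \<in> I"
    and G: "\<And>x. lookup G x \<in> polys W" "\<And>x. b < x \<Longrightarrow> lookup G x \<in> I"
  shows "a + b < x \<Longrightarrow> lookup (F * G) x \<in> I"
    and "lookup (F * G) (a + b) - lookup F a * lookup G b \<in> I"
proof -
  have inI: "lookup F x * lookup G y \<in> I" if "a < x \<or> b < y" for x y
    using that F G pidealD(4,5)[OF I] by auto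
  have *: "a < u \<or> b < v" if "a + b < u + v" for u v
    using that add_mono[of u a v b] by (meson leD not_less)
  have L: "lookup (F * G) x = (\<Sum>u\<in>keys F. \<Sum>v\<in>keys G. lookup F u * lookup G v when u + v = x)" for x
    by (simp add: poly_mapping_mult_sum lookup_sum lookup_single)
  show "lookup (F * G) x \<in> I" if "a + b < x" for x
    unfolding L using that pidealD(2)[OF I] by (intro pideal_sum[OF I]) (auto simp: when_def intro!: inI *)
  have ab: "lookup F a * lookup G b =
      (\<Sum>u\<in>keys F. \<Sum>v\<in>keys G. lookup F u * lookup G v when u = a \<and> v = b)"
  proof -
    have "(\<Sum>u\<in>keys F. \<Sum>v\<in>keys G. lookup F u * lookup G v when u = a \<and> v = b) =
        (\<Sum>u\<in>keys F. lookup F u when u = a) * (\<Sum>v\<in>keys G. lookup G v when v = b)"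
      by (simp add: sum_product) (intro sum.cong, auto simp: when_def)
    then show ?thesis by (simp add: when_def in_keys_iff)
  qed
  have "lookup (F * G) (a + b) - lookup F a * lookup G b =
    (\<Sum>u\<in>keys F. \<Sum>v\<in>keys G. lookup F u * lookup G v when u + v = a + b \<and> \<not> (u = a \<and> v = b))"
    unfolding L ab sum_subtractf[symmetric] by (intro sum.cong) (auto simp: when_def)
  also have "\<dots> \<in> I"
  proof (intro pideal_sum[OF I])
    fix u v
    have "a < u \<or> b < v" if "u + v = a + b" "\<not> (u = a \<and> v = b)"
    proof (rule ccontr)
      assume "\<not> (a < u \<or> b < v)"
      then have "u \<le> a" "v \<le> b" by auto
      then have "u = a"
        using that(1) add_less_le_mono[of u a v b] by (auto simp: order_le_less)
      then show False using that by simp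
    qed
    then show "(lookup F u * lookup G v when u + v = a + b \<and> \<not> (u = a \<and> v = b)) \<in> I"
      using inI pidealD(2)[OF I] by (auto simp: when_def)
  qed
  finally show "lookup (F * G) (a + b) - lookup F a * lookup G b \<in> I" .
qed

lemma leading_coeff_exists:
  fixes F :: "'e::linorder \<Rightarrow>\<^sub>0 'a::zero"
  assumes "lookup F x \<notin> I" "0 \<in> I"
  obtains a where "lookup F a \<notin> I" "\<And>x. a < x \<Longrightarrow> lookup F x \<in> I"
proof -
  let ?K = "{x \<in> keys F. lookup F x \<notin> I}"
  have x: "x \<in> ?K" using assms by (auto simp: in_keys_iff)
  then have M: "Max ?K \<in> ?K" by (intro Max_in) auto
  have "lookup F y \<in> I" if "Max ?K < y" for y
  proof (rule ccontr)
    assume "lookup F y \<notin> I"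
    then have "y \<in> ?K" using assms(2) by (auto simp: in_keys_iff)
    then have "y \<le> Max ?K" by (intro Max_ge) auto
    then show False using that by simp
  qed
  then show ?thesis using that M by blast
qed

text \<open>\<open>extend W X I\<close> is the extension to the polynomial ring in \<open>X\<close> of an ideal \<open>I\<close> of the polynomial
  ring in \<open>W\<close>.\<close>

definition extend :: "'v set \<Rightarrow> 'v set \<Rightarrow> (('v, 'c::comm_ring_1) mpoly) set \<Rightarrow> (('v, 'c) mpoly) set" where
  "extend W X I = {p \<in> polys X. \<forall>\<alpha>. lookup (curry_in W p) \<alpha> \<in> I}"

context
  fixes W X :: "'v set" and I :: "(('v, 'c::comm_ring_1) mpoly) set"
  assumes I: "pideal W I" and WX: "W \<subseteq> X"
begin

lemma coeff_in: "p \<in> polys X \<Longrightarrow> lookup (curry_in W p) \<alpha> \<in> polys W"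
  using lookup_curry_in_polys[of p X W \<alpha>] WX by (simp add: Int_absorb1)

lemma pideal_extend: "pideal X (extend W X I)"
  unfolding pideal_def
proof (intro conjI ballI)
  fix a b :: "('v, 'c) mpoly"
  assume a: "a \<in> polys X" and b: "b \<in> extend W X I"
  have bX: "b \<in> polys X" and "\<And>x. lookup (curry_in W b) x \<in> I" using b by (auto simp: extend_def)
  then have "lookup (\<Sum>x\<in>keys (curry_in W a). \<Sum>y\<in>keys (curry_in W b).
      single (x + y) (lookup (curry_in W a) x * lookup (curry_in W b) y)) \<alpha> \<in> I" for \<alpha>
    unfolding lookup_sum lookup_single using coeff_in[OF a] pidealD(2)[OF I]
    by (intro pideal_sum[OF I]) (auto simp: when_def intro!: pidealD(4)[OF I])
  then have "lookup (curry_in W (a * b)) \<alpha> \<in> I" for \<alpha>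
    by (simp add: curry_in_mult flip: poly_mapping_mult_sum)
  then show "a * b \<in> extend W X I" using a bX by (simp add: extend_def polys_mult)
qed (use I in \<open>auto simp: extend_def curry_in_add lookup_add intro: polys_add pidealD\<close>)

lemma extend_contract: "p \<in> polys W \<Longrightarrow> p \<in> extend W X I \<longleftrightarrow> p \<in> I"
  using polys_mono[OF WX] pidealD(2)[OF I] by (auto simp: extend_def curry_in_on lookup_single when_def)

end

text \<open>As in Gauss's lemma, the last coefficients of \<open>a\<close> and \<open>b\<close>
  outside \<open>I\<close> multiply, modulo \<open>I\<close>, to a coefficient of
  \<open>a * b\<close>. The order on the variables supplies an order on exponents that is compatible
  with addition.\<close>

lemma pprime_extend:
  fixes I :: "(('v::linorder, 'c::comm_ring_1) mpoly) set"
  assumes I: "pprime W I" and WX: "W \<subseteq> X"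
  shows "pprime X (extend W X I)"
proof -
  have i: "pideal W I" using I by (simp add: pprime_def)
  have "a \<in> extend W X I \<or> b \<in> extend W X I"
    if ab: "a \<in> polys X" "b \<in> polys X" "a * b \<in> extend W X I" for a b
  proof (rule ccontr)
    assume "\<not> ?thesis"
    then obtain x y where "lookup (curry_in W a) x \<notin> I" "lookup (curry_in W b) y \<notin> I"
      using ab by (auto simp: extend_def)
    then obtain x y where x: "lookup (curry_in W a) x \<notin> I" "\<And>z. x < z \<Longrightarrow> lookup (curry_in W a) z \<in> I"
      and y: "lookup (curry_in W b) y \<notin> I" "\<And>z. y < z \<Longrightarrow> lookup (curry_in W b) z \<in> I"
      using leading_coeff_exists pidealD(2)[OF i] by metis
    let ?u = "lookup (curry_in W a) x" and ?v = "lookup (curry_in W b) y"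
    have in_W: "lookup (curry_in W p) z \<in> polys W" if "p \<in> polys X" for p z
      by (rule coeff_in[OF i WX that])
    have "lookup (curry_in W a * curry_in W b) (x + y) - ?u * ?v \<in> I"
      by (rule leading_coeff_mult(2)[OF i in_W[OF ab(1)] x(2) in_W[OF ab(2)] y(2)])
    moreover have "lookup (curry_in W a * curry_in W b) (x + y) \<in> I"
      using ab(3) by (simp add: extend_def curry_in_mult)
    ultimately have "?u * ?v \<in> I" by (rule pideal_cancel[OF i])
    then show False using I x(1) y(1) in_W[OF ab(1)] in_W[OF ab(2)] unfolding pprime_def by blast
  qed
  moreover have "1 \<notin> extend W X I"
    using extend_contract[OF i WX, of 1] I by (auto simp: pprime_def)
  ultimately show ?thesis using pideal_extend[OF i WX] by (simp add: pprime_def)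
qed

lemma pradical_extend:
  fixes I :: "(('v::linorder, 'c::comm_ring_1) mpoly) set"
  assumes I: "pradical W I" and WX: "W \<subseteq> X"
  shows "pradical X (extend W X I)"
proof -
  have i: "pideal W I" using I by (simp add: pradical_def)
  have "a \<in> extend W X I" if a: "a \<in> polys X" "a ^ n \<in> extend W X I" for a n
  proof (rule ccontr)
    let ?F = "curry_in W a"
    assume "\<not> ?thesis"
    then obtain x where "lookup ?F x \<notin> I" using a by (auto simp: extend_def)
    then obtain x where x: "lookup ?F x \<notin> I" "\<And>z. x < z \<Longrightarrow> lookup ?F z \<in> I"
      using leading_coeff_exists pidealD(2)[OF i] by metis
    interpret comm_ring_hom "curry_in W" by (rule comm_ring_hom_curry_in)
    have in_W: "lookup (curry_in W p) z \<in> polys W" if "p \<in> polys X" for p z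
      by (rule coeff_in[OF i WX that])
    \<comment> \<open>The \<open>n\<close>-fold sum of \<open>x\<close>: the exponent at which the
      \<open>n\<close>-th power has, modulo \<open>I\<close>, the \<open>n\<close>-th power of the
      leading coefficient.\<close>
    let ?y = "\<lambda>n. ((+) x ^^ n) 0"
    have "(\<forall>z. ?y n < z \<longrightarrow> lookup (?F ^ n) z \<in> I) \<and> lookup (?F ^ n) (?y n) - lookup ?F x ^ n \<in> I" for n
    proof (induction n)
      case 0
      then show ?case using pidealD(2)[OF i] by (auto simp: lookup_one when_def)
    next
      case (Suc n)
      have P: "lookup (?F ^ n) z \<in> polys W" for z
        using in_W[of "a ^ n"] a(1) by (simp add: hom_power polys_power)
      have S1: "lookup (?F ^ n) z \<in> I" if "?y n < z" for z
        using Suc that by blast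
      note L = leading_coeff_mult[where F = ?F and G = "?F ^ n" and a = x and b = "?y n", OF i in_W[OF a(1)] x(2) P S1]
      have 1: "lookup (?F * ?F ^ n) (x + ?y n) - lookup ?F x * lookup (?F ^ n) (?y n) \<in> I"
        by (rule L(2))
      have 2: "lookup ?F x * (lookup (?F ^ n) (?y n) - lookup ?F x ^ n) \<in> I"
        using Suc pidealD(4)[OF i in_W[OF a(1)]] by blast
      have "lookup (?F * ?F ^ n) (x + ?y n) - lookup ?F x * lookup ?F x ^ n \<in> I"
        using pidealD(3)[OF i 1 2] by (simp add: algebra_simps)
      moreover have "lookup (?F * ?F ^ n) z \<in> I" if "x + ?y n < z" for z
        by (rule L(1)[OF _ _ that])
      ultimately show ?case by (simp only: power_Suc funpow.simps comp_apply simp_thms) blast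
    qed
    moreover have "lookup (?F ^ n) (?y n) \<in> I"
      using a(2) by (simp add: extend_def hom_power)
    ultimately have "lookup ?F x ^ n \<in> I" using pideal_cancel[OF i] by blast
    then show False using I x(1) in_W[OF a(1)] unfolding pradical_def by blast
  qed
  then show ?thesis using pideal_extend[OF i WX] by (simp add: pradical_def)
qed

text \<open>Together with \<open>pideal_extend\<close> and \<open>extend_contract\<close> this
  identifies \<open>extend W X I\<close> as the smallest ideal over \<open>X\<close> that contains
  \<open>I\<close>.\<close>

lemma extend_subset:
  assumes J: "pideal X J" and IJ: "I \<subseteq> J"
  shows "extend W X I \<subseteq> J"
proof
  fix p assume p: "p \<in> extend W X I"
  then have pX: "p \<in> polys X" by (simp add: extend_def)
  have "(\<Sum>\<alpha>\<in>keys (curry_in W p). mon \<alpha> * lookup (curry_in W p) \<alpha>) \<in> J"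
  proof (intro pideal_sum[OF J] pidealD(4)[OF J])
    fix \<alpha> assume "\<alpha> \<in> keys (curry_in W p)"
    then show "mon \<alpha> \<in> polys X" using keys_curry_in[OF pX] by auto
  qed (use p IJ in \<open>auto simp: extend_def\<close>)
  then show "p \<in> J" using uncurry[of p W] by simp
qed

lemma lookup_single_mult_exp:
  "lookup (single \<nu> c * q) \<mu> =
     (if \<forall>v. lookup \<nu> v \<le> lookup \<mu> v then c * lookup q (\<mu> - \<nu>) else 0)"
  for q :: "('v, 'c::comm_ring_1) mpoly"
proof (induction q rule: pm_induct)
  case (single \<sigma> d)
  have "\<nu> + \<sigma> = \<mu> \<longleftrightarrow> (\<forall>v. lookup \<nu> v \<le> lookup \<mu> v) \<and> \<sigma> = \<mu> - \<nu>"
  proof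
    assume "(\<forall>v. lookup \<nu> v \<le> lookup \<mu> v) \<and> \<sigma> = \<mu> - \<nu>"
    then show "\<nu> + \<sigma> = \<mu>" by (auto intro!: poly_mapping_eqI simp: lookup_add lookup_minus)
  qed (auto simp: lookup_add)
  then show ?case by (auto simp: mult_single lookup_single when_def)
qed (simp_all add: distrib_left lookup_add)

lemma lookup_vr_mult: "lookup (vr v * q) (single v (Suc 0) + \<mu>) = lookup q \<mu>"
  for q :: "('v, 'c::comm_ring_1) mpoly"
  by (simp add: lookup_single_mult_exp lookup_add)

text \<open>Separates the terms divisible by \<open>v\<close>. It peels off the newest element of a
  sequence, for algebraic independence in \<open>indep_mod_step\<close> and for regular sequences in
  \<open>regular_imp_quasi_regular\<close>.\<close>

lemma split_var:
  fixes p :: "('v, 'c::comm_ring_1) mpoly"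
  obtains G H where "p = G + vr v * H"
    "\<And>\<mu>. lookup \<mu> v \<noteq> 0 \<Longrightarrow> lookup G \<mu> = 0"
    "\<And>\<mu>. lookup \<mu> v = 0 \<Longrightarrow> lookup G \<mu> = lookup p \<mu>"
    "\<And>\<mu>. lookup H \<mu> = lookup p (single v (Suc 0) + \<mu>)"
proof -
  define H where "H = Poly_Mapping.map_key ((+) (single v (Suc 0))) p"
  have H: "lookup H \<mu> = lookup p (single v (Suc 0) + \<mu>)" for \<mu>
    by (simp add: H_def Poly_Mapping.map_key.rep_eq)
  define G where "G = p - vr v * H"
  have G: "lookup G \<mu> = (if lookup \<mu> v = 0 then lookup p \<mu> else 0)" for \<mu>
  proof (cases "lookup \<mu> v = 0")
    case True
    then have "\<not> (\<forall>w. lookup (single v (Suc 0)) w \<le> lookup \<mu> w)"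
      by (auto intro!: exI[of _ v])
    then have "lookup (vr v * H) \<mu> = 0" by (simp only: lookup_single_mult_exp if_False)
    then show ?thesis using True by (simp add: G_def lookup_minus)
  next
    case False
    then have "\<mu> = single v (Suc 0) + (\<mu> - single v (Suc 0))"
      by (auto intro!: poly_mapping_eqI simp: lookup_add lookup_minus lookup_single when_def)
    then have "lookup (vr v * H) \<mu> = lookup p \<mu>"
      using lookup_vr_mult[of v H "\<mu> - single v (Suc 0)"] H by metis
    then show ?thesis using False by (simp add: G_def lookup_minus)
  qed
  show ?thesis by (rule that[of G H]) (simp_all add: G H, simp add: G_def)
qed

definition tdeg :: "('v \<Rightarrow>\<^sub>0 nat) \<Rightarrow> nat" where
  "tdeg \<mu> = (\<Sum>v\<in>keys \<mu>. lookup \<mu> v)"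

lemma tdeg_superset: "finite A \<Longrightarrow> keys \<mu> \<subseteq> A \<Longrightarrow> tdeg \<mu> = (\<Sum>v\<in>A. lookup \<mu> v)"
  unfolding tdeg_def by (rule sum.mono_neutral_left) (auto simp: in_keys_iff)

lemma tdeg_zero [simp]: "tdeg 0 = 0"
  by (simp add: tdeg_def)

lemma tdeg_single [simp]: "tdeg (single v n) = n"
  by (cases "n = 0") (simp_all add: tdeg_def)

lemma tdeg_add: "tdeg (\<mu> + \<nu>) = tdeg \<mu> + tdeg \<nu>"
  by (simp add: tdeg_superset[of "keys \<mu> \<union> keys \<nu>"] keys_add_nat lookup_add sum.distrib)

lemma tdeg_sum: "tdeg (sum f A) = (\<Sum>a\<in>A. tdeg (f a))"
  by (induction A rule: infinite_finite_induct) (simp_all add: tdeg_add)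

lemma lookup_le_tdeg: "lookup \<mu> v \<le> tdeg \<mu>"
proof (cases "v \<in> keys \<mu>")
  case True
  then show ?thesis unfolding tdeg_def by (rule member_le_sum) auto
qed (simp add: in_keys_iff)

section \<open>Counting monomials\<close>

global_interpretation mp: Vector_Spaces.vector_space
  "\<lambda>(c::'k::field) (p::('v, 'k) mpoly). cst c * p"
  by standard (simp_all add: distrib_left distrib_right single_add mult_single mult.assoc[symmetric])

text \<open>For a family, a repeated vector already is a dependence, with coefficients 1 and -1;
  otherwise the dimension bound for sets applies.\<close>

lemma (in Vector_Spaces.vector_space) dependent_family:
  assumes "finite A" "finite T" "\<And>a. a \<in> A \<Longrightarrow> v a \<in> span T" "card T < card A"
  shows "\<exists>c. (\<exists>a\<in>A. c a \<noteq> 0) \<and> (\<Sum>a\<in>A. c a *s v a) = 0"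
proof (cases "inj_on v A")
  case True
  have "dependent (v ` A)"
  proof (rule ccontr)
    assume "independent (v ` A)"
    then have "card (v ` A) \<le> card T"
      using independent_span_bound[of T "v ` A"] assms by auto
    then show False using assms True by (simp add: card_image)
  qed
  then obtain u where "\<exists>x\<in>v ` A. u x \<noteq> 0" "(\<Sum>x\<in>v ` A. u x *s x) = 0"
    using assms(1) dependent_finite[of "v ` A"] by auto
  then show ?thesis using True by (intro exI[of _ "u \<circ> v"]) (auto simp: sum.reindex)
next
  case False
  then obtain a b where ab: "a \<in> A" "b \<in> A" "a \<noteq> b" "v a = v b" by (auto simp: inj_on_def)
  let ?c = "\<lambda>x. (if x = a then 1 else 0) - (if x = b then 1 else 0)"
  have "(\<Sum>x\<in>A. ?c x *s v x) = (\<Sum>x\<in>A. if x = a then v x else 0) - (\<Sum>x\<in>A. if x = b then v x else 0)"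
    unfolding sum_subtractf[symmetric] by (intro sum.cong) (auto simp: scale_left_diff_distrib)
  also have "\<dots> = 0" using assms(1) ab by simp
  finally show ?thesis using ab by (intro exI[of _ ?c]) auto
qed

lemma finite_card_bounded_exps:
  assumes "finite X"
  shows "finite {\<mu>. keys \<mu> \<subseteq> X \<and> (\<forall>v\<in>X. lookup \<mu> v < b v)}" (is "finite ?S")
    and "card {\<mu>. keys \<mu> \<subseteq> X \<and> (\<forall>v\<in>X. lookup \<mu> v < b v)} \<le> (\<Prod>v\<in>X. b v)"
proof -
  let ?f = "\<lambda>\<mu>. restrict (lookup \<mu>) X"
  have inj: "inj_on ?f ?S"
  proof (rule inj_onI, rule poly_mapping_eqI)
    fix \<mu> \<nu> v assume *: "\<mu> \<in> ?S" "\<nu> \<in> ?S" "?f \<mu> = ?f \<nu>"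
    show "lookup \<mu> v = lookup \<nu> v"
    proof (cases "v \<in> X")
      case True then show ?thesis using fun_cong[OF *(3), of v] by simp
    next
      case False
      then have "v \<notin> keys \<mu>" "v \<notin> keys \<nu>" using * by auto
      then show ?thesis by (simp add: in_keys_iff)
    qed
  qed
  have sub: "?f ` ?S \<subseteq> PiE X (\<lambda>v. {..<b v})" by auto
  have fin: "finite (PiE X (\<lambda>v. {..<b v}))" using assms by (intro finite_PiE) auto
  show "finite ?S" using inj sub fin by (meson finite_imageD finite_subset)
  have "card ?S \<le> card (PiE X (\<lambda>v. {..<b v}))"
    by (rule card_inj_on_le[OF inj sub fin])
  then show "card ?S \<le> (\<Prod>v\<in>X. b v)" using assms by (simp add: card_PiE)
qed

lemma finite_tdeg_le: "finite X \<Longrightarrow> finite {\<mu>. keys \<mu> \<subseteq> X \<and> tdeg \<mu> \<le> q}"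
  by (rule finite_subset[OF _ finite_card_bounded_exps(1)[of X "\<lambda>_. Suc q"]])
    (auto simp: less_Suc_eq_le intro: order_trans[OF lookup_le_tdeg])

text \<open>For fixed \<open>Z\<close>, at most \<open>a\<close> entries range up to
  \<open>q\<close> and the others stay below \<open>c\<close>. Hence the count is bounded by a
  polynomial of degree \<open>a\<close> in \<open>q\<close>, which plays the role of a Hilbert
  function.\<close>

lemma card_sparse_exps:
  assumes X: "finite X" and c: "1 \<le> c"
    and T: "\<And>\<nu>. \<nu> \<in> T \<Longrightarrow> keys \<nu> \<subseteq> X \<and> (\<exists>Z\<subseteq>X. card Z \<le> a \<and> (\<forall>v\<in>X - Z. lookup \<nu> v < c))"
  shows "card {\<nu> \<in> T. tdeg \<nu> \<le> q} \<le> 2 ^ card X * ((q + 1) ^ a * c ^ card X)"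
proof -
  let ?B = "\<lambda>Z. {\<mu>. keys \<mu> \<subseteq> X \<and> (\<forall>v\<in>X. lookup \<mu> v < (if v \<in> Z then q + 1 else c))}"
  let ?Zs = "{Z. Z \<subseteq> X \<and> card Z \<le> a}"
  have fin: "finite ?Zs" using X by simp
  have B: "card (?B Z) \<le> (q + 1) ^ a * c ^ card X" if "Z \<in> ?Zs" for Z
  proof -
    have "(\<Prod>v\<in>X. if v \<in> Z then q + 1 else c) = (\<Prod>v\<in>X \<inter> Z. q + 1) * (\<Prod>v\<in>X - Z. c)"
      using prod.If_cases[OF X, of "\<lambda>v. v \<in> Z" "\<lambda>_. q + 1" "\<lambda>_. c"] by (simp add: Diff_eq)
    also have "\<dots> = (q + 1) ^ card Z * c ^ card (X - Z)"
      using that by (simp add: Int_absorb1)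
    also have "\<dots> \<le> (q + 1) ^ a * c ^ card X"
      using that X c by (intro mult_le_mono power_increasing) (auto intro: card_mono)
    finally show ?thesis by (rule order_trans[OF finite_card_bounded_exps(2)[OF X]])
  qed
  have "{\<nu> \<in> T. tdeg \<nu> \<le> q} \<subseteq> (\<Union>Z\<in>?Zs. ?B Z)"
  proof
    fix \<nu> assume n: "\<nu> \<in> {\<nu> \<in> T. tdeg \<nu> \<le> q}"
    then have "\<nu> \<in> T" and tq: "tdeg \<nu> \<le> q" by auto
    from T[OF this(1)] obtain Z where Z: "Z \<subseteq> X" "card Z \<le> a" "\<forall>v\<in>X - Z. lookup \<nu> v < c" "keys \<nu> \<subseteq> X"
      by blast
    have "lookup \<nu> v \<le> q" for v using lookup_le_tdeg[of \<nu> v] tq by (rule order_trans)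
    then have "\<nu> \<in> ?B Z" using Z by (auto simp: less_Suc_eq_le)
    then show "\<nu> \<in> (\<Union>Z\<in>?Zs. ?B Z)" using Z by blast
  qed
  moreover have "finite (\<Union>Z\<in>?Zs. ?B Z)"
    by (rule finite_UN_I[OF fin finite_card_bounded_exps(1)[OF X]])
  ultimately have "card {\<nu> \<in> T. tdeg \<nu> \<le> q} \<le> card (\<Union>Z\<in>?Zs. ?B Z)" by (rule card_mono[rotated])
  also have "\<dots> \<le> (\<Sum>Z\<in>?Zs. card (?B Z))" by (rule card_UN_le[OF fin])
  also have "\<dots> \<le> card ?Zs * ((q + 1) ^ a * c ^ card X)"
    using sum_bounded_above[of ?Zs "\<lambda>Z. card (?B Z)" "(q + 1) ^ a * c ^ card X"] B by simp
  also have "\<dots> \<le> 2 ^ card X * ((q + 1) ^ a * c ^ card X)"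
  proof (rule mult_le_mono1)
    have "card ?Zs \<le> card (Pow X)" using X by (intro card_mono) auto
    then show "card ?Zs \<le> 2 ^ card X" using X by (simp add: card_Pow)
  qed
  finally show ?thesis .
qed

definition polys_le :: "'v set \<Rightarrow> nat \<Rightarrow> (('v, 'c::comm_ring_1) mpoly) set" where
  "polys_le X q = {p. \<forall>\<mu>\<in>keys p. keys \<mu> \<subseteq> X \<and> tdeg \<mu> \<le> q}"

lemma polys_le_mult: "p \<in> polys_le X a \<Longrightarrow> p' \<in> polys_le X b \<Longrightarrow> p * p' \<in> polys_le X (a + b)"
proof -
  assume *: "p \<in> polys_le X a" "p' \<in> polys_le X b"
  show ?thesis unfolding polys_le_def
  proof (clarify)
    fix \<mu> assume "\<mu> \<in> keys (p * p')"
    then obtain x y where "\<mu> = x + y" "x \<in> keys p" "y \<in> keys p'" using keys_mult[of p p'] by blast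
    then show "keys \<mu> \<subseteq> X \<and> tdeg \<mu> \<le> a + b"
      using * unfolding polys_le_def by (force simp: keys_add_nat tdeg_add intro: add_mono)
  qed
qed

lemma polys_le_mono: "p \<in> polys_le X a \<Longrightarrow> a \<le> b \<Longrightarrow> p \<in> polys_le X b"
  by (force simp: polys_le_def)

lemma polys_le_one: "1 \<in> polys_le X a"
  by (simp add: polys_le_def single_one[symmetric] del: single_one)

lemma polys_le_power: "p \<in> polys_le X a \<Longrightarrow> p ^ n \<in> polys_le X (n * a)"
  by (induction n) (auto intro: polys_le_one polys_le_mult)

lemma polys_le_prod:
  "(\<And>i. i \<in> A \<Longrightarrow> p i \<in> polys_le X (f i)) \<Longrightarrow> prod p A \<in> polys_le X (sum f A)"
  by (induction A rule: infinite_finite_induct) (auto intro: polys_le_one polys_le_mult)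

lemma polys_le_exists: "p \<in> polys X \<Longrightarrow> \<exists>q. p \<in> polys_le X q"
proof (rule exI[of _ "\<Sum>\<mu>\<in>keys p. tdeg \<mu>"])
  assume p: "p \<in> polys X"
  have "tdeg \<mu> \<le> (\<Sum>\<mu>\<in>keys p. tdeg \<mu>)" if "\<mu> \<in> keys p" for \<mu>
    using that by (rule member_le_sum) auto
  then show "p \<in> polys_le X (\<Sum>\<mu>\<in>keys p. tdeg \<mu>)"
    using polysD[OF p] by (simp add: polys_le_def)
qed

lemma ev_sum_single:
  "comm_ring_hom \<iota> \<Longrightarrow> finite A \<Longrightarrow>
     ev \<iota> h (\<Sum>a\<in>A. single (e a) (c a)) = (\<Sum>a\<in>A. \<iota> (c a) * evm h (e a))"
proof -
  assume *: "comm_ring_hom \<iota>" "finite A"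
  interpret comm_ring_hom "ev \<iota> h" by (rule comm_ring_hom_ev[OF *(1)])
  show ?thesis by (simp add: hom_sum ev_single[OF *(1)])
qed

text \<open>Products of the \<open>h i\<close> of bounded degree are counted against the monomials from \<open>T\<close> of
  bounded degree.\<close>

lemma independent_le_growth:
  fixes \<Phi> :: "(('v, 'k::field) mpoly) \<Rightarrow> (('w, 'k) mpoly)"
  assumes hom: "comm_ring_hom \<Phi>" "\<And>c. \<Phi> (cst c) = cst c" and X: "finite X"
    and red: "\<And>\<mu>. keys \<mu> \<subseteq> X \<Longrightarrow>
      \<Phi> (mon \<mu>) \<in> mp.span ((\<lambda>\<nu>. \<Phi> (mon \<nu>)) ` {\<nu> \<in> T. tdeg \<nu> \<le> 2 * tdeg \<mu>})"
    and T: "\<And>\<nu>. \<nu> \<in> T \<Longrightarrow> keys \<nu> \<subseteq> X \<and> (\<exists>Z\<subseteq>X. card Z \<le> a \<and> (\<forall>v\<in>X - Z. lookup \<nu> v < c))"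
    and h: "\<And>i. i < s \<Longrightarrow> h i \<in> polys X"
    and ind: "\<And>H. H \<in> polys {..<s::nat} \<Longrightarrow> \<Phi> (ev cst h H) = 0 \<Longrightarrow> H = 0"
  shows "s \<le> a"
proof (rule ccontr)
  assume "\<not> s \<le> a"
  then have as: "Suc a \<le> s" by simp
  interpret \<Phi>: comm_ring_hom \<Phi> by fact
  interpret e: comm_ring_hom "ev cst h" by (rule comm_ring_hom_ev[OF comm_ring_hom_cst])
  have "\<forall>i. \<exists>q. i < s \<longrightarrow> h i \<in> polys_le X q"
    using polys_le_exists[OF h] by blast
  from choice[OF this] obtain D' where D': "\<And>i. i < s \<Longrightarrow> h i \<in> polys_le X (D' i)" by blast
  define D where "D = sum D' {..<s}"
  have D: "h i \<in> polys_le X D" if "i < s" for i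
  proof (rule polys_le_mono[OF D'[OF that]])
    show "D' i \<le> D" unfolding D_def using that by (intro member_le_sum) auto
  qed
  \<comment> \<open>\<open>c = 0\<close> is a legitimate input, but the count needs a positive
    bound.\<close>
  define c' where "c' = max c 1"
  have T': "keys \<nu> \<subseteq> X \<and> (\<exists>Z\<subseteq>X. card Z \<le> a \<and> (\<forall>v\<in>X - Z. lookup \<nu> v < c'))" if "\<nu> \<in> T" for \<nu>
  proof -
    from T[OF that] obtain Z where Z: "Z \<subseteq> X" "card Z \<le> a" "\<forall>v\<in>X - Z. lookup \<nu> v < c" "keys \<nu> \<subseteq> X"
      by blast
    then have "\<forall>v\<in>X - Z. lookup \<nu> v < c'"
      unfolding c'_def by (meson less_le_trans max.cobounded1)
    with Z show ?thesis by blast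
  qed
  \<comment> \<open>\<open>K\<close> collects the factors of the final bound on
    \<open>card Tq\<close> that do not involve \<open>n\<close>; the comparison ends in
    \<open>n + 1 \<le> K\<close>, which the choice \<open>n = K\<close> refutes.\<close>
  define K where "K = 2 ^ card X * c' ^ card X * (2 * s * D + 1) ^ a"
  define n where "n = K"
  define A where "A = PiE {..<s} (\<lambda>_. {..n})"
  \<comment> \<open>A product with all exponents at most \<open>n\<close> has degree at most
    \<open>s * (n * D)\<close>; the factor 2 is the slack that the reduction hypothesis
    allows.\<close>
  define q where "q = 2 * (s * (n * D))"
  define Tq where "Tq = {\<nu> \<in> T. tdeg \<nu> \<le> q}"
  define ex where "ex f = (\<Sum>i<s. single i (f i))" for f :: "nat \<Rightarrow> nat"
  define w where "w f = evm h (ex f)" for f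
  have lookup_ex: "lookup (ex f) i = (if i < s then f i else 0)" for f i
    by (auto simp: ex_def lookup_sum lookup_single when_def sum.delta' cong: if_cong)
  have keys_ex: "keys (ex f) \<subseteq> {..<s}" for f
    by (auto simp: in_keys_iff lookup_ex split: if_splits)
  have finA: "finite A" and cardA: "card A = (n + 1) ^ s"
    by (auto simp: A_def card_PiE intro: finite_PiE)
  have inj: "inj_on ex A"
  proof (rule inj_onI, rule ext)
    fix f g i assume fg: "f \<in> A" "g \<in> A" "ex f = ex g"
    show "f i = g i"
    proof (cases "i < s")
      case True then show ?thesis using lookup_ex[of f i] lookup_ex[of g i] fg by simp
    next
      case False
      then show ?thesis using fg unfolding A_def by (metis PiE_arb lessThan_iff)
    qed
  qed
  have finT: "finite Tq"
    using T by (intro finite_subset[OF _ finite_tdeg_le[OF X, of q]]) (auto simp: Tq_def)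
  have wq: "w f \<in> polys_le X (s * (n * D))" if "f \<in> A" for f
  proof -
    have "w f = (\<Prod>i<s. h i ^ f i)"
      unfolding w_def by (subst evm_superset[OF _ keys_ex]) (auto simp: lookup_ex)
    moreover have "h i ^ f i \<in> polys_le X (n * D)" if i: "i < s" for i
      by (rule polys_le_mono[OF polys_le_power[OF D[OF i]]])
        (use \<open>f \<in> A\<close> i in \<open>auto simp: A_def\<close>)
    then have "(\<Prod>i<s. h i ^ f i) \<in> polys_le X (\<Sum>i<s. n * D)"
      by (intro polys_le_prod) auto
    ultimately show ?thesis by simp
  qed
  have span: "\<Phi> (w f) \<in> mp.span ((\<lambda>\<nu>. \<Phi> (mon \<nu>)) ` Tq)" if f: "f \<in> A" for f
  proof -
    have "\<Phi> (w f) = \<Phi> (\<Sum>\<mu>\<in>keys (w f). cst (lookup (w f) \<mu>) * mon \<mu>)"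
      using poly_mapping_sum_single[of "w f"] by (simp add: mult_single)
    also have "\<dots> = (\<Sum>\<mu>\<in>keys (w f). cst (lookup (w f) \<mu>) * \<Phi> (mon \<mu>))"
      by (simp add: \<Phi>.hom_sum \<Phi>.hom_mult hom(2))
    also have "\<dots> \<in> mp.span ((\<lambda>\<nu>. \<Phi> (mon \<nu>)) ` Tq)"
    proof (intro mp.span_sum mp.span_scale)
      fix \<mu> assume "\<mu> \<in> keys (w f)"
      then have m: "keys \<mu> \<subseteq> X" "tdeg \<mu> \<le> s * (n * D)" using wq[OF f] by (auto simp: polys_le_def)
      then have "tdeg \<nu> \<le> q" if "tdeg \<nu> \<le> 2 * tdeg \<mu>" for \<nu> :: "'v \<Rightarrow>\<^sub>0 nat"
        using that unfolding q_def by linarith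
      then have "{\<nu> \<in> T. tdeg \<nu> \<le> 2 * tdeg \<mu>} \<subseteq> Tq" by (auto simp: Tq_def)
      then show "\<Phi> (mon \<mu>) \<in> mp.span ((\<lambda>\<nu>. \<Phi> (mon \<nu>)) ` Tq)"
        using red[OF m(1)] mp.span_mono[OF image_mono] by blast
    qed
    finally show ?thesis .
  qed
  \<comment> \<open>Otherwise the \<open>(n + 1) ^ s\<close> products would be linearly dependent
    under \<open>\<Phi>\<close>, and a linear dependence among them is a nonzero polynomial relation
    between the \<open>h i\<close>.\<close>
  have "card A \<le> card Tq"
  proof (rule ccontr)
    assume "\<not> ?thesis"
    then have "card Tq < card A" by (simp only: not_le)
    then have "card ((\<lambda>\<nu>. \<Phi> (mon \<nu>)) ` Tq) < card A"
      by (rule le_less_trans[OF card_image_le[OF finT]])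
    from mp.dependent_family[where v = "\<lambda>f. \<Phi> (w f)", OF finA finite_imageI[OF finT] span this]
    obtain k where k: "\<exists>f\<in>A. k f \<noteq> 0" "(\<Sum>f\<in>A. cst (k f) * \<Phi> (w f)) = 0"
      by blast
    define H where "H = (\<Sum>f\<in>A. single (ex f) (k f))"
    have "H \<in> polys {..<s}" unfolding H_def using keys_ex by (intro polys_sum) auto
    moreover have "\<Phi> (ev cst h H) = 0"
      using k(2) by (simp add: H_def ev_sum_single[OF comm_ring_hom_cst finA] \<Phi>.hom_sum \<Phi>.hom_mult hom(2) w_def)
    ultimately have H0: "H = 0" by (rule ind)
    have "k f = 0" if f: "f \<in> A" for f
    proof -
      have "lookup H (ex f) = (\<Sum>g\<in>A. if g = f then k f else 0)"
        unfolding H_def lookup_sum lookup_single using f inj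
        by (intro sum.cong) (auto simp: when_def dest: inj_onD)
      also have "\<dots> = k f" using finA f by simp
      finally show ?thesis using H0 by simp
    qed
    then show False using k(1) by blast
  qed
  also have "card Tq \<le> 2 ^ card X * ((q + 1) ^ a * c' ^ card X)"
    unfolding Tq_def by (rule card_sparse_exps[OF X _ T']) (auto simp: c'_def)
  also have "\<dots> \<le> 2 ^ card X * (((2 * s * D + 1) * (n + 1)) ^ a * c' ^ card X)"
    by (intro mult_le_mono2 mult_le_mono1 power_mono) (simp_all add: q_def algebra_simps)
  also have "\<dots> = K * (n + 1) ^ a"
    by (simp only: K_def power_mult_distrib ac_simps)
  finally have "(n + 1) ^ s \<le> K * (n + 1) ^ a" using cardA by simp
  moreover have "(n + 1) ^ Suc a \<le> (n + 1) ^ s" using as by (intro power_increasing) auto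
  ultimately have "(n + 1) * (n + 1) ^ a \<le> K * (n + 1) ^ a" by simp
  then have "n + 1 \<le> K" by (simp only: mult_le_cancel2) simp
  then show False by (simp add: n_def)
qed
section \<open>Heights of ideals in polynomial rings\<close>

lemma ev_cong_on:
  assumes "p \<in> polys X" "\<And>v. v \<in> X \<Longrightarrow> f v = g v"
  shows "ev cst f p = ev cst g p"
  by (rule hom_eq_on_polys[OF comm_ring_hom_ev[OF comm_ring_hom_cst] comm_ring_hom_ev[OF comm_ring_hom_cst] assms(1)])
    (use assms(2) in \<open>simp_all add: ev_single comm_ring_hom_cst\<close>)

text \<open>Algebraic independence of \<open>h 0\<close>, ..., \<open>h (s - 1)\<close> in the
  quotient by \<open>Q\<close>.\<close>

definition indep_mod :: "(nat \<Rightarrow> ('v, 'c) mpoly) \<Rightarrow> nat \<Rightarrow> (('v, 'c::comm_ring_1) mpoly) set \<Rightarrow> bool" where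
  "indep_mod h s Q \<longleftrightarrow> (\<forall>H\<in>polys {..<s}. ev cst h H \<in> Q \<longrightarrow> H = 0)"

lemma rename_zero:
  assumes "inj_on u I" "H \<in> polys I" "ev cst (\<lambda>i. vr (u i)) H = 0"
  shows "(H :: ('i, 'c::comm_ring_1) mpoly) = 0"
proof -
  note hom = comm_ring_hom_ev[OF comm_ring_hom_cst]
  let ?b = "\<lambda>v. vr (inv_into I u v)"
  have "ev cst ?b (ev cst (\<lambda>i. vr (u i)) H) = H"
    by (rule hom_eq_on_polys[OF comm_ring_hom_compose[OF hom hom] comm_ring_hom_id assms(2)])
      (use assms(1) in \<open>simp_all add: ev_single comm_ring_hom_cst inv_into_f_f\<close>)
  then have "ev cst ?b 0 = H" by (simp only: assms(3))
  then show ?thesis by (simp add: ev_def)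
qed

lemma indep_mod_vars:
  fixes Q :: "(('v, 'a::comm_ring_1) mpoly) set"
  assumes "inj_on u {..<s}" "u ` {..<s} \<subseteq> U" "polys U \<inter> Q \<subseteq> {0}"
  shows "indep_mod (\<lambda>i. vr (u i)) s Q"
  unfolding indep_mod_def
proof (intro ballI impI)
  fix H :: "(nat, 'a) mpoly"
  assume H: "H \<in> polys {..<s}" "ev cst (\<lambda>i. vr (u i)) H \<in> Q"
  have "ev cst (\<lambda>i. vr (u i)) H \<in> polys U"
    using H(1) by (rule ev_in_polys) (use assms(2) in auto)
  then have "ev cst (\<lambda>i. vr (u i)) H = 0" using H(2) assms(3) by blast
  then show "H = 0" by (rule rename_zero[OF assms(1) H(1)])
qed

text \<open>In a relation, the part free of the new variable vanishes since \<open>f \<in> Q'\<close>, and \<open>f\<close> can be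
  cancelled from the rest since \<open>f \<notin> Q\<close>.\<close>

lemma indep_mod_step:
  fixes Q Q' :: "(('v, 'c::comm_ring_1) mpoly) set"
  assumes Q: "pprime X Q" and Q': "pideal X Q'" and sub: "Q \<subseteq> Q'"
    and f: "f \<in> Q'" "f \<notin> Q" and h: "\<And>i. i < s \<Longrightarrow> h i \<in> polys X" and ind: "indep_mod h s Q'"
  shows "indep_mod (h(s := f)) (Suc s) Q"
proof -
  let ?h = "h(s := f)"
  note hom = comm_ring_hom_ev[OF comm_ring_hom_cst]
  interpret comm_ring_hom "ev cst ?h" by (rule hom)
  have fX: "f \<in> polys X" by (rule pidealD(1)[OF Q' f(1)])
  have hX: "?h i \<in> polys X" if "i < Suc s" for i using h fX that by (auto simp: less_Suc_eq)
  \<comment> \<open>Induction on a bound \<open>n\<close> for the degree in the new variable: once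
    the part free of it is gone, cancelling \<open>f\<close> lowers that degree by one.\<close>
  have main: "H = 0" if "H \<in> polys {..<Suc s}" "ev cst ?h H \<in> Q" "\<forall>\<mu>\<in>keys H. lookup \<mu> s < n" for H n
    using that
  proof (induction n arbitrary: H)
    case 0
    then show ?case by (metis ex_in_conv keys_eq_empty not_less0)
  next
    case (Suc n)
    obtain G K where GK: "H = G + vr s * K"
      "\<And>\<mu>. lookup \<mu> s \<noteq> 0 \<Longrightarrow> lookup G \<mu> = 0"
      "\<And>\<mu>. lookup \<mu> s = 0 \<Longrightarrow> lookup G \<mu> = lookup H \<mu>"
      "\<And>\<mu>. lookup K \<mu> = lookup H (single s (Suc 0) + \<mu>)"
      using split_var[of H s] by blast
    have G: "G \<in> polys {..<s}"
    proof (rule polysI)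
      fix \<mu> assume m: "\<mu> \<in> keys G"
      then have "lookup \<mu> s = 0" using GK(2) by (metis in_keys_iff)
      moreover from this have "\<mu> \<in> keys H" using m GK(3) by (metis in_keys_iff)
      then have "keys \<mu> \<subseteq> {..<Suc s}" by (rule polysD[OF Suc.prems(1)])
      moreover have "s \<notin> keys \<mu>" using calculation(1) by (simp add: in_keys_iff)
      ultimately show "keys \<mu> \<subseteq> {..<s}" by (auto simp: less_Suc_eq subset_iff)
    qed
    have kK: "single s (Suc 0) + \<mu> \<in> keys H" if "\<mu> \<in> keys K" for \<mu>
      using that GK(4) by (metis in_keys_iff)
    have K: "K \<in> polys {..<Suc s}"
    proof (rule polysI)
      fix \<mu> assume "\<mu> \<in> keys K"
      then have "keys (single s (Suc 0) + \<mu>) \<subseteq> {..<Suc s}" by (intro polysD[OF Suc.prems(1)] kK)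
      then show "keys \<mu> \<subseteq> {..<Suc s}" by (simp add: keys_add_nat)
    qed
    have evG: "ev cst ?h G = ev cst h G"
      using G by (rule ev_cong_on) auto
    have evH: "ev cst ?h H = ev cst h G + f * ev cst ?h K"
      by (simp add: GK(1) hom_add hom_mult ev_single comm_ring_hom_cst evG)
    have KX: "ev cst ?h K \<in> polys X" using K by (rule ev_in_polys) (use hX in auto)
    have "ev cst h G + f * ev cst ?h K \<in> Q'"
      using Suc.prems(2) sub unfolding evH by (rule rev_subsetD)
    moreover have "f * ev cst ?h K \<in> Q'" by (rule pidealD(5)[OF Q' KX f(1)])
    ultimately have "ev cst h G + f * ev cst ?h K - f * ev cst ?h K \<in> Q'" by (rule pideal_diff[OF Q'])
    then have G0: "G = 0" using ind G by (simp add: indep_mod_def)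
    have "ev cst h G = 0" by (simp add: G0 ev_def)
    then have "f * ev cst ?h K \<in> Q" using Suc.prems(2) unfolding evH by (simp only: add_0)
    then have KQ: "ev cst ?h K \<in> Q" using Q f(2) fX KX unfolding pprime_def by blast
    have "\<forall>\<mu>\<in>keys K. lookup \<mu> s < n"
    proof
      fix \<mu> assume "\<mu> \<in> keys K"
      then have "lookup (single s (Suc 0) + \<mu>) s < Suc n" using Suc.prems(3) kK by blast
      then show "lookup \<mu> s < n" by (simp add: lookup_add)
    qed
    then have "K = 0" using Suc.IH K KQ by blast
    then show ?case using GK(1) G0 by simp
  qed
  show ?thesis unfolding indep_mod_def
  proof (intro ballI impI)
    fix H :: "(nat, 'c) mpoly"
    assume H: "H \<in> polys {..<Suc s}" "ev cst ?h H \<in> Q"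
    have "\<forall>\<mu>\<in>keys H. lookup \<mu> s < Suc (\<Sum>\<mu>\<in>keys H. lookup \<mu> s)"
    proof
      fix \<mu> assume "\<mu> \<in> keys H"
      then have "lookup \<mu> s \<le> (\<Sum>\<mu>\<in>keys H. lookup \<mu> s)" by (rule member_le_sum) auto
      then show "lookup \<mu> s < Suc (\<Sum>\<mu>\<in>keys H. lookup \<mu> s)" by simp
    qed
    then show "H = 0" by (rule main[OF H])
  qed
qed

lemma indep_le_card:
  fixes h :: "nat \<Rightarrow> ('v, 'k::field) mpoly"
  assumes X: "finite X" and h: "\<And>i. i < s \<Longrightarrow> h i \<in> polys X" and ind: "indep_mod h s {0}"
  shows "s \<le> card X"
proof (rule independent_le_growth[where \<Phi> = "\<lambda>p. p" and T = "{\<mu>. keys \<mu> \<subseteq> X}" and c = 0, OF comm_ring_hom_id])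
  show "(mon \<mu> :: ('v, 'k) mpoly) \<in> mp.span (mon ` {\<nu> \<in> {\<mu>. keys \<mu> \<subseteq> X}. tdeg \<nu> \<le> 2 * tdeg \<mu>})"
    if "keys \<mu> \<subseteq> X" for \<mu>
    using that by (intro mp.span_base) auto
  show "keys \<nu> \<subseteq> X \<and> (\<exists>Z\<subseteq>X. card Z \<le> card X \<and> (\<forall>v\<in>X - Z. lookup \<nu> v < 0))"
    if "\<nu> \<in> {\<mu>. keys \<mu> \<subseteq> X}" for \<nu>
    using that by (auto intro!: exI[of _ X])
  show "H = 0" if "H \<in> polys {..<s}" "ev cst h H = 0" for H
    using that ind by (simp add: indep_mod_def)
qed (use X h in auto)

text \<open>Walking down a chain of primes from \<open>P\<close>, each strict inclusion adds one
  element to an algebraically independent family that starts with the variables of \<open>U\<close>.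
  At the bottom the family has \<open>card U + r\<close> members and is independent in the
  polynomial ring itself.\<close>

lemma prime_height_le:
  fixes P :: "('v, 'k::field) mpoly set"
  assumes X: "finite X" and UX: "U \<subseteq> X" and ind: "polys U \<inter> P \<subseteq> {0}"
  shows "prime_height (poly_ring K X) P \<le> enat (card X - card U)"
  unfolding prime_height_def
proof (rule Sup_least, clarify)
  fix r and Q :: "nat \<Rightarrow> ('v, 'k) mpoly set"
  assume Qp: "\<forall>i\<le>r. primeideal (Q i) (poly_ring K X)" and Qs: "\<forall>i<r. Q i \<subset> Q (Suc i)" and Qr: "P = Q r"
  have Qp': "pprime X (Q i)" if "i \<le> r" for i
    using Qp that by (simp add: primeideal_poly_ring_iff)
  have Qi: "pideal X (Q i)" if "i \<le> r" for i
    using Qp'[OF that] by (simp add: pprime_def)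
  have fU: "finite U" using X UX by (rule rev_finite_subset)
  have "\<exists>h. (\<forall>i<card U + j. h i \<in> polys X) \<and> indep_mod h (card U + j) (Q (r - j))" if "j \<le> r" for j
    using that
  proof (induction j)
    case 0
    obtain u where u: "bij_betw u {..<card U} U"
      using ex_bij_betw_nat_finite[OF fU] by (auto simp: atLeast0LessThan)
    have "indep_mod (\<lambda>i. vr (u i)) (card U) (Q r)"
      using u ind Qr by (intro indep_mod_vars[of _ _ U]) (auto simp: bij_betw_def)
    moreover have "vr (u i) \<in> polys X" if "i < card U" for i
      using u UX that by (auto simp: bij_betw_def)
    ultimately show ?case by (intro exI[of _ "\<lambda>i. vr (u i)"]) auto
  next
    case (Suc j)
    then obtain h where h: "\<forall>i<card U + j. h i \<in> polys X" "indep_mod h (card U + j) (Q (r - j))" by auto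
    have j: "Suc (r - Suc j) = r - j" "r - Suc j < r" using Suc.prems by auto
    then have sub: "Q (r - Suc j) \<subset> Q (r - j)" using Qs by metis
    then obtain f where f: "f \<in> Q (r - j)" "f \<notin> Q (r - Suc j)" by auto
    have i: "pideal X (Q (r - j))" by (rule Qi) simp
    have "indep_mod (h(card U + j := f)) (Suc (card U + j)) (Q (r - Suc j))"
      by (rule indep_mod_step[OF Qp'[of "r - Suc j"] i _ f]) (use sub h in auto)
    moreover have "(h(card U + j := f)) i \<in> polys X" if "i < Suc (card U + j)" for i
      using that h pidealD(1)[OF i f(1)] by (auto simp: less_Suc_eq)
    ultimately show ?case by (intro exI[of _ "h(card U + j := f)"]) (simp only: add_Suc_right simp_thms, blast)
  qed
  from this[of r] obtain h where h: "\<forall>i<card U + r. h i \<in> polys X" "indep_mod h (card U + r) (Q 0)" by auto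
  have "indep_mod h (card U + r) {0}"
    using h(2) pidealD(2)[OF Qi[of 0]] by (simp add: indep_mod_def)
  then have "card U + r \<le> card X" using indep_le_card[OF X] h(1) by blast
  then show "enat r \<le> enat (card X - card U)" by simp
qed

text \<open>The chain consists of the extensions of \<open>P \<inter> polys (W j)\<close>, where
  \<open>W j\<close> grows from \<open>U\<close> to \<open>X\<close> one variable at a time. The
  algebraic relation of the new variable over \<open>U\<close>, given by \<open>max\<close>, makes
  each inclusion strict.\<close>

lemma prime_height_ge:
  fixes P :: "('v::linorder, 'k::field) mpoly set"
  assumes X: "finite X" and P: "pprime X P" and UX: "U \<subseteq> X" and ind: "polys U \<inter> P \<subseteq> {0}"
    and max: "\<And>v. v \<in> X - U \<Longrightarrow> \<exists>f. f \<noteq> 0 \<and> f \<in> polys (insert v U) \<inter> P"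
  shows "enat (card X - card U) \<le> prime_height (poly_ring K X) P"
proof -
  have Pi: "pideal X P" using P by (simp add: pprime_def)
  obtain vs where vs: "set vs = X - U" "distinct vs" using finite_distinct_list[of "X - U"] X by auto
  have len: "length vs = card X - card U"
    using distinct_card[OF vs(2)] card_Diff_subset[OF rev_finite_subset[OF X UX] UX] vs(1) by simp
  define W where "W j = U \<union> set (take j vs)" for j
  have WX: "W j \<subseteq> X" for j using UX vs set_take_subset[of j vs] by (auto simp: W_def)
  define Q where "Q j = extend (W j) X (P \<inter> polys (W j))" for j
  have PW: "pprime (W j) (P \<inter> polys (W j))" for j
  proof -
    note sub = subsetD[OF polys_mono[OF WX[of j]]]
    have "pideal (W j) (P \<inter> polys (W j))"
      unfolding pideal_def
      by (auto intro: pidealD(2,3)[OF Pi] pidealD(4)[OF Pi sub] polys_add polys_mult)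
    moreover have "a \<in> P \<or> b \<in> P" if "a \<in> polys (W j)" "b \<in> polys (W j)" "a * b \<in> P" for a b
      using that sub P unfolding pprime_def by blast
    moreover have "1 \<notin> P" using P by (simp add: pprime_def)
    ultimately show ?thesis by (auto simp: pprime_def)
  qed
  have PWi: "pideal (W j) (P \<inter> polys (W j))" for j using PW by (auto simp: pprime_def)
  have prime: "pprime X (Q j)" for j unfolding Q_def by (rule pprime_extend[OF PW WX])
  have Qi: "pideal X (Q j)" for j using prime by (auto simp: pprime_def)
  have WS: "W (Suc j) = insert (vs ! j) (W j)" if "j < length vs" for j
    using that by (auto simp: W_def take_Suc_conv_app_nth)
  have inQ: "P \<inter> polys (W j) \<subseteq> Q j" for j
    using extend_contract[OF PWi WX] by (auto simp: Q_def)
  have step: "Q j \<subset> Q (Suc j)" if j: "j < length vs" for j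
  proof -
    let ?v = "vs ! j"
    have mono: "polys (W j) \<subseteq> polys (W (Suc j))" by (rule polys_mono) (use WS[OF j] in auto)
    have "P \<inter> polys (W j) \<subseteq> Q (Suc j)" using inQ[of "Suc j"] mono by blast
    then have sub: "Q j \<subseteq> Q (Suc j)" unfolding Q_def[of j] by (rule extend_subset[OF Qi])
    have v: "?v \<in> X - U" using vs(1) nth_mem[OF j] by blast
    have vW: "?v \<notin> W j"
      using v vs(2) j by (auto simp: W_def in_set_conv_nth nth_eq_iff_index_eq)
    obtain f where f: "f \<noteq> 0" "f \<in> polys (insert ?v U)" "f \<in> P" using max[OF v] by auto
    have "polys (insert ?v U) \<subseteq> polys (W (Suc j))"
      by (rule polys_mono) (use WS[OF j] in \<open>auto simp: W_def\<close>)
    then have "f \<in> Q (Suc j)" using f inQ[of "Suc j"] by blast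
    moreover have "f \<notin> Q j"
    proof
      assume fQ: "f \<in> Q j"
      \<comment> \<open>The new variable lies outside \<open>W j\<close>, so the coefficients of
        \<open>f\<close> over \<open>W j\<close> involve \<open>U\<close> alone; being in
        \<open>P\<close>, they vanish by \<open>ind\<close>.\<close>
      have "lookup (curry_in (W j) f) \<alpha> = 0" for \<alpha>
      proof -
        have "lookup (curry_in (W j) f) \<alpha> \<in> polys (insert ?v U \<inter> W j)"
          by (rule lookup_curry_in_polys[OF f(2)])
        moreover have "insert ?v U \<inter> W j = U" using vW by (auto simp: W_def)
        moreover have "lookup (curry_in (W j) f) \<alpha> \<in> P" using fQ by (auto simp: Q_def extend_def)
        ultimately show ?thesis using ind by auto
      qed
      then have "curry_in (W j) f = 0" by (intro poly_mapping_eqI) simp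
      then have "f = 0" using uncurry[of f "W j"] by simp
      then show False using f(1) by simp
    qed
    ultimately show ?thesis using sub by blast
  qed
  have "W (length vs) = X" using vs UX by (auto simp: W_def)
  then have "Q (length vs) = P"
    using extend_contract[OF Pi order_refl] pidealD(1)[OF Pi]
    by (auto simp: Q_def extend_def Int_absorb2 subset_iff)
  moreover have "\<forall>i\<le>length vs. primeideal (Q i) (poly_ring K X)"
    using prime by (simp add: primeideal_poly_ring_iff)
  ultimately have "enat (length vs) \<in> {enat r | r. \<exists>Q. (\<forall>i\<le>r. primeideal (Q i) (poly_ring K X)) \<and>
      (\<forall>i<r. Q i \<subset> Q (Suc i)) \<and> Q r = P}"
    using step by blast
  then show ?thesis unfolding prime_height_def len[symmetric] by (rule Sup_upper)
qed

text \<open>An ideal maximal among those disjoint from a multiplicative set is prime; here the set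
  consists of the nonzero polynomials in \<open>U\<close>, and Zorn's lemma provides the
  ideal.\<close>

lemma exists_prime_avoiding:
  fixes I :: "('v::linorder, 'k::field) mpoly set"
  assumes I: "pideal X I" and UX: "U \<subseteq> X" and ind: "polys U \<inter> I \<subseteq> {0}"
  obtains P where "pprime X P" "I \<subseteq> P" "polys U \<inter> P \<subseteq> {0}"
proof -
  let ?A = "{J. pideal X J \<and> I \<subseteq> J \<and> polys U \<inter> J \<subseteq> {0}}"
  have "\<exists>M\<in>?A. \<forall>J\<in>?A. M \<subseteq> J \<longrightarrow> J = M"
  proof (rule subset_Zorn_nonempty)
    show "?A \<noteq> {}" using I ind by blast
    fix C assume C: "C \<noteq> {}" "subset.chain ?A C"
    then have CA: "C \<subseteq> ?A" by (simp add: subset_chain_def)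
    have "pideal X (\<Union>C)" unfolding pideal_def
    proof (intro conjI ballI)
      fix a b assume "a \<in> \<Union>C" "b \<in> \<Union>C"
      then obtain J1 J2 where J: "J1 \<in> C" "J2 \<in> C" "a \<in> J1" "b \<in> J2" by blast
      then have "J1 \<subseteq> J2 \<or> J2 \<subseteq> J1" using C(2) by (auto simp: subset_chain_def)
      then obtain J where "J \<in> C" "a \<in> J" "b \<in> J" using J by blast
      then show "a + b \<in> \<Union>C" using CA pidealD(3) by blast
    next
      obtain J where "J \<in> C" using C(1) by blast
      then show "0 \<in> \<Union>C" using CA pidealD(2) by blast
      show "\<Union>C \<subseteq> polys X" using CA pidealD(1) by blast
    next
      fix a b :: "('v, 'k) mpoly" assume "a \<in> polys X" "b \<in> \<Union>C"
      then show "a * b \<in> \<Union>C" using CA pidealD(4) by blast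
    qed
    then show "\<Union>C \<in> ?A" using CA C(1) by blast
  qed
  then obtain M where MA: "M \<in> ?A" and mx: "\<forall>J\<in>?A. M \<subseteq> J \<longrightarrow> J = M" by (elim bexE)
  have M: "pideal X M" "I \<subseteq> M" "polys U \<inter> M \<subseteq> {0}" using MA by auto
  have max: "J = M" if "pideal X J" "M \<subseteq> J" "polys U \<inter> J \<subseteq> {0}" for J
    using bspec[OF mx, of J] that M(2) by simp
  have U: "\<exists>r m. r \<in> polys X \<and> m \<in> M \<and> m + r * a \<in> polys U \<and> m + r * a \<noteq> 0"
    if a: "a \<in> polys X" "a \<notin> M" for a
  proof -
    let ?J = "{m + r * a | m r. m \<in> M \<and> r \<in> polys X}"
    have J: "pideal X ?J" unfolding pideal_def
    proof (intro conjI ballI)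
      show "?J \<subseteq> polys X" using a(1) pidealD(1)[OF M(1)] by (auto intro: polys_add polys_mult)
      show "0 \<in> ?J" using pidealD(2)[OF M(1)] by (intro CollectI exI[of _ 0]) auto
      fix x y assume "x \<in> ?J" "y \<in> ?J"
      then obtain m r m' r' where xy: "x = m + r * a" "y = m' + r' * a" "m \<in> M" "m' \<in> M" "r \<in> polys X" "r' \<in> polys X"
        by blast
      have "x + y = (m + m') + (r + r') * a" by (simp only: xy(1,2) distrib_right add_ac)
      moreover have "m + m' \<in> M" "r + r' \<in> polys X" using xy pidealD(3)[OF M(1)] polys_add by blast+
      ultimately show "x + y \<in> ?J" by blast
    next
      fix x y :: "('v, 'k) mpoly" assume x: "x \<in> polys X" and "y \<in> ?J"
      then obtain m r where y: "y = m + r * a" "m \<in> M" "r \<in> polys X" by blast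
      have "x * y = x * m + (x * r) * a" by (simp only: y(1) distrib_left mult.assoc)
      moreover have "x * m \<in> M" by (rule pidealD(4)[OF M(1) x y(2)])
      moreover have "x * r \<in> polys X" by (rule polys_mult[OF x y(3)])
      ultimately show "x * y \<in> ?J" by blast
    qed
    have MJ: "M \<subseteq> ?J"
    proof
      fix m assume "m \<in> M"
      then show "m \<in> ?J" by (intro CollectI exI[of _ m] exI[of _ 0]) auto
    qed
    have aJ: "a \<in> ?J" using pidealD(2)[OF M(1)] by (intro CollectI exI[of _ 0] exI[of _ 1]) auto
    have "\<not> polys U \<inter> ?J \<subseteq> {0}"
    proof
      assume "polys U \<inter> ?J \<subseteq> {0}"
      then have "?J = M" by (rule max[OF J MJ])
      then show False using aJ a(2) by simp
    qed
    then obtain x where "x \<in> polys U" "x \<in> ?J" "x \<noteq> 0" by (auto simp: subset_iff)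
    then show ?thesis by blast
  qed
  have "a \<in> M \<or> b \<in> M" if ab: "a \<in> polys X" "b \<in> polys X" "a * b \<in> M" for a b
  proof (rule ccontr)
    assume "\<not> ?thesis"
    then obtain r m r' m' where *: "r \<in> polys X" "m \<in> M" "m + r * a \<in> polys U" "m + r * a \<noteq> 0"
      "r' \<in> polys X" "m' \<in> M" "m' + r' * b \<in> polys U" "m' + r' * b \<noteq> 0"
      using U[OF ab(1)] U[OF ab(2)] by blast
    \<comment> \<open>The left side is a product of two nonzero elements of \<open>polys U\<close>,
      while every summand on the right lies in \<open>M\<close>.\<close>
    have "(m + r * a) * (m' + r' * b) = (m' + r' * b) * m + ((r * a) * m' + (r * r') * (a * b))"
      by (simp only: distrib_left distrib_right ac_simps)
    moreover have "m' + r' * b \<in> polys X" using * polys_mono[OF UX] by blast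
    then have "(m' + r' * b) * m \<in> M" using * pidealD(4)[OF M(1)] by blast
    moreover have "(r * a) * m' \<in> M" using * ab polys_mult pidealD(4)[OF M(1)] by blast
    moreover have "(r * r') * (a * b) \<in> M" using * ab polys_mult pidealD(4)[OF M(1)] by blast
    ultimately have "(m + r * a) * (m' + r' * b) \<in> M" using pidealD(3)[OF M(1)] by simp
    moreover have "(m + r * a) * (m' + r' * b) \<in> polys U" using * polys_mult by blast
    ultimately have "(m + r * a) * (m' + r' * b) = 0" using M(3) by blast
    then show False using * by simp
  qed
  moreover have "1 \<notin> M" using M(3) polys_one[of U] by fastforce
  ultimately have "pprime X M" using M(1) by (simp add: pprime_def)
  then show ?thesis using that M by blast
qed

lemma ideal_height_le:
  fixes I :: "('v::linorder, 'k::field) mpoly set"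
  assumes "finite X" "pideal X I" "U \<subseteq> X" "polys U \<inter> I \<subseteq> {0}"
  shows "ideal_height (poly_ring K X) I \<le> enat (card X - card U)"
proof -
  obtain P where P: "pprime X P" "I \<subseteq> P" "polys U \<inter> P \<subseteq> {0}"
    using exists_prime_avoiding[OF assms(2-4)] .
  then have "prime_height (poly_ring K X) P \<in> {prime_height (poly_ring K X) P | P. primeideal P (poly_ring K X) \<and> I \<subseteq> P}"
    by (auto simp: primeideal_poly_ring_iff)
  then have "ideal_height (poly_ring K X) I \<le> prime_height (poly_ring K X) P"
    unfolding ideal_height_def by (rule Inf_lower)
  also have "\<dots> \<le> enat (card X - card U)" by (rule prime_height_le[OF assms(1,3) P(3)])
  finally show ?thesis .
qed

text \<open>For a prime \<open>P\<close> above \<open>I\<close>, take a set of variables of largest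
  size that is independent modulo \<open>P\<close>. Maximality supplies the relations that
  \<open>prime_height_ge\<close> asks for, and independence modulo \<open>P\<close> implies
  independence modulo \<open>I\<close>.\<close>

lemma ideal_height_ge:
  fixes I :: "('v::linorder, 'k::field) mpoly set"
  assumes X: "finite X" and r: "\<And>U. U \<subseteq> X \<Longrightarrow> polys U \<inter> I \<subseteq> {0} \<Longrightarrow> card U \<le> r"
  shows "enat (card X - r) \<le> ideal_height (poly_ring K X) I"
  unfolding ideal_height_def
proof (rule Inf_greatest, clarify)
  fix P :: "('v, 'k) mpoly set" assume "primeideal P (poly_ring K X)" and IP: "I \<subseteq> P"
  then have P: "pprime X P" by (simp add: primeideal_poly_ring_iff)
  let ?S = "{U. U \<subseteq> X \<and> polys U \<inter> P \<subseteq> {0}}"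
  \<comment> \<open>The empty set is a candidate: a nonzero constant in \<open>P\<close> would be a
    unit.\<close>
  have "polys {} \<inter> P \<subseteq> {0}"
  proof
    fix p assume p: "p \<in> polys {} \<inter> P"
    then have "keys p \<subseteq> {0}" by (auto simp: polys_def)
    then have pc: "p = cst (lookup p 0)"
      by (intro poly_mapping_eqI) (auto simp: lookup_single when_def in_keys_iff)
    show "p \<in> {0}"
    proof (rule ccontr)
      assume "p \<notin> {0}"
      then have "lookup p 0 \<noteq> 0" using pc by auto
      then have "cst (inverse (lookup p 0)) * p = 1"
        by (subst pc) (simp add: mult_single)
      moreover have "cst (inverse (lookup p 0)) * p \<in> P"
        using p P by (intro pidealD(4)[of X]) (auto simp: pprime_def)
      ultimately show False using P by (simp add: pprime_def)
    qed
  qed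
  then have "{} \<in> ?S" by simp
  moreover have "\<forall>U. U \<in> ?S \<longrightarrow> card U \<le> card X" using X by (auto intro: card_mono)
  ultimately have "\<exists>U. U \<in> ?S \<and> (\<forall>U'. U' \<in> ?S \<longrightarrow> card U' \<le> card U)"
    by (intro ex_has_greatest_nat[where P = "\<lambda>U. U \<in> ?S" and k = "{}" and b = "Suc (card X)"])
      (auto simp: less_Suc_eq_le)
  then obtain U where U: "U \<in> ?S" "\<And>U'. U' \<in> ?S \<Longrightarrow> card U' \<le> card U"
    by (elim exE conjE) simp
  have "card U \<le> r" using U(1) IP r by blast
  then have "enat (card X - r) \<le> enat (card X - card U)" by simp
  also have "\<dots> \<le> prime_height (poly_ring K X) P"
  proof (rule prime_height_ge[OF X P])
    fix v assume v: "v \<in> X - U"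
    have "card (insert v U) = Suc (card U)" using v U(1) by (intro card_insert_disjoint) (auto intro: rev_finite_subset[OF X])
    then have "insert v U \<notin> ?S" using U(2)[of "insert v U"] by (intro notI) simp
    then have "\<not> polys (insert v U) \<inter> P \<subseteq> {0}" using v U(1) by simp
    then show "\<exists>f. f \<noteq> 0 \<and> f \<in> polys (insert v U) \<inter> P" by (auto simp: subset_iff)
  qed (use U(1) in auto)
  finally show "enat (card X - r) \<le> prime_height (poly_ring K X) P" .
qed

section \<open>Minors\<close>

text \<open>The Leibniz expansion of the minor with rows \<open>r\<close> and columns
  \<open>c\<close>. Index functions in place of index sets make the action of ring homomorphisms
  entrywise and let the diagonal be named.\<close>

definition sminor :: "nat \<Rightarrow> (nat \<times> nat \<Rightarrow> 'a::comm_ring_1) \<Rightarrow> (nat \<Rightarrow> nat) \<Rightarrow> (nat \<Rightarrow> nat) \<Rightarrow> 'a" where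
  "sminor t f r c = (\<Sum>p | p permutes {0..<t}. signof p * (\<Prod>i=0..<t. f (r i, c (p i))))"

definition minor_index :: "nat \<Rightarrow> nat \<Rightarrow> (nat \<Rightarrow> nat) \<Rightarrow> bool" where
  "minor_index t m r \<longleftrightarrow> (\<forall>i<t. r i < m) \<and> (\<forall>i j. i < j \<longrightarrow> j < t \<longrightarrow> r i < r j)"

lemma minor_index_pick:
  assumes "I \<subseteq> {..<m}" "card I = t"
  shows "minor_index t m (pick I)"
  unfolding minor_index_def
proof (intro conjI allI impI)
  fix i assume "i < t"
  then show "pick I i < m" using pick_in_set_le[of i I] assms by blast
next
  fix i j assume "i < j" "j < t"
  then show "pick I i < pick I j" using pick_mono_le[of j I i] assms by blast
qed

text \<open>Exactly \<open>i\<close> elements of the image lie below \<open>r i\<close>, which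
  determines its place in the increasing enumeration.\<close>

lemma pick_image:
  assumes r: "minor_index t m r" and i: "i < t"
  shows "pick (r ` {..<t}) i = r i"
proof -
  have inj: "inj_on r {..<t}"
    using r by (auto simp: minor_index_def inj_on_def) (metis linorder_neqE_nat order_less_irrefl)
  have less_iff: "r a < r i \<longleftrightarrow> a < i" if "a < t" for a
    using r i that unfolding minor_index_def by (metis linorder_neqE_nat order_less_asym order_less_irrefl)
  have "{a \<in> r ` {..<t}. a < r i} = r ` {..<i}" using less_iff i by auto
  moreover have "card (r ` {..<i}) = i"
    using inj i by (subst card_image) (auto intro: inj_on_subset)
  moreover have "r i \<in> r ` {..<t}" using i by blast
  ultimately show ?thesis using pick_card_in_set[of "r i" "r ` {..<t}"] by (simp only:)
qed

lemma det_submatrix: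
  assumes "I \<subseteq> {..<m}" "J \<subseteq> {..<n}" "card I = t" "card J = t"
  shows "det (submatrix (mat m n f) I J) = sminor t f (pick I) (pick J)"
proof -
  have IJ: "{i. i < m \<and> i \<in> I} = I" "{j. j < n \<and> j \<in> J} = J" using assms by auto
  have "submatrix (mat m n f) I J \<in> carrier_mat t t"
    unfolding submatrix_def by (simp add: IJ assms)
  note det_def'[OF this]
  also have "(\<Sum>p | p permutes {0..<t}. signof p * (\<Prod>i=0..<t. submatrix (mat m n f) I J $$ (i, p i))) =
    sminor t f (pick I) (pick J)"
    unfolding sminor_def
  proof (intro sum.cong refl arg_cong2[where f = "(*)"] prod.cong)
    fix p i assume "p \<in> {p. p permutes {0..<t}}" "i \<in> {0..<t}"
    then have *: "i < t" "p i < t" using permutes_in_image[of p "{0..<t}" i] by auto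
    then have "pick I i < m" "pick J (p i) < n"
      using minor_index_pick assms unfolding minor_index_def by blast+
    then show "submatrix (mat m n f) I J $$ (i, p i) = f (pick I i, pick J (p i))"
      using * unfolding submatrix_def by (simp add: IJ assms)
  qed
  finally show ?thesis .
qed

lemma minors_mat:
  "minors t (mat m n f) = {sminor t f r c | r c. minor_index t m r \<and> minor_index t n c}"
proof (intro equalityI subsetI)
  fix x assume "x \<in> minors t (mat m n f)"
  then obtain I J where IJ: "x = det (submatrix (mat m n f) I J)" "I \<subseteq> {..<m}" "J \<subseteq> {..<n}"
    "card I = t" "card J = t"
    unfolding minors_def by auto
  then show "x \<in> {sminor t f r c | r c. minor_index t m r \<and> minor_index t n c}"
    using det_submatrix[OF IJ(2-5), of f] minor_index_pick[OF IJ(2,4)] minor_index_pick[OF IJ(3,5)] by auto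
next
  fix x assume "x \<in> {sminor t f r c | r c. minor_index t m r \<and> minor_index t n c}"
  then obtain r c where rc: "x = sminor t f r c" "minor_index t m r" "minor_index t n c" by blast
  let ?I = "r ` {..<t}" and ?J = "c ` {..<t}"
  have card: "card (s ` {..<t}) = t" if "minor_index t l s" for s l
  proof -
    have "inj_on s {..<t}"
      using that by (auto simp: minor_index_def inj_on_def) (metis linorder_neqE_nat order_less_irrefl)
    then show ?thesis by (simp add: card_image)
  qed
  have sub: "?I \<subseteq> {..<m}" "?J \<subseteq> {..<n}" using rc by (auto simp: minor_index_def)
  have "det (submatrix (mat m n f) ?I ?J) = sminor t f (pick ?I) (pick ?J)"
    by (rule det_submatrix[OF sub card[OF rc(2)] card[OF rc(3)]])
  also have "\<dots> = sminor t f r c"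
    unfolding sminor_def
  proof (intro sum.cong refl arg_cong2[where f = "(*)"] prod.cong)
    fix p i assume "p \<in> {p. p permutes {0..<t}}" "i \<in> {0..<t}"
    then have "i < t" "p i < t" using permutes_in_image[of p "{0..<t}" i] by auto
    then show "f (pick ?I i, pick ?J (p i)) = f (r i, c (p i))"
      using pick_image rc by simp
  qed
  finally have "x = det (submatrix (mat m n f) ?I ?J)" by (simp only: rc(1))
  then show "x \<in> minors t (mat m n f)"
    unfolding minors_def dim_row_mat dim_col_mat using sub card[OF rc(2)] card[OF rc(3)] by blast
qed

lemma hom_sminor:
  assumes "comm_ring_hom F"
  shows "F (sminor t f r c) = sminor t (\<lambda>v. F (f v)) r c"
proof -
  interpret comm_ring_hom F by fact
  have "F (signof p) = signof p" for p :: "nat \<Rightarrow> nat"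
    by (simp add: sign_def hom_uminus)
  then show ?thesis by (simp add: sminor_def hom_sum hom_mult hom_prod)
qed

text \<open>Pad the factors with a zero column and a zero row.\<close>

lemma sminor_low_rank:
  fixes a b :: "nat \<Rightarrow> nat \<Rightarrow> 'a::comm_ring_1"
  shows "sminor (Suc d) (\<lambda>(i, j). \<Sum>l<d. a i l * b j l) r c = 0"
proof -
  let ?t = "Suc d"
  let ?A = "mat ?t ?t (\<lambda>(i, l). if l < d then a (r i) l else 0)"
  let ?B = "mat ?t ?t (\<lambda>(l, j). if l < d then b (c j) l else 0)"
  have AB: "?A \<in> carrier_mat ?t ?t" "?B \<in> carrier_mat ?t ?t" by auto
  have entry: "(?A * ?B) $$ (i, j) = (\<Sum>l<d. a (r i) l * b (c j) l)" if "i < ?t" "j < ?t" for i j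
  proof -
    have "(?A * ?B) $$ (i, j) = (\<Sum>l\<in>{0..<?t}. (if l < d then a (r i) l else 0) * (if l < d then b (c j) l else 0))"
      using that by (simp add: scalar_prod_def)
    also have "\<dots> = (\<Sum>l\<in>{0..<d}. a (r i) l * b (c j) l)" by simp
    finally show ?thesis by (simp add: atLeast0LessThan)
  qed
  have "det (?A * ?B) = sminor ?t (\<lambda>(i, j). \<Sum>l<d. a i l * b j l) r c"
    unfolding det_def'[OF mult_carrier_mat[OF AB]] sminor_def
  proof (intro sum.cong refl arg_cong2[where f = "(*)"] prod.cong)
    fix p i assume "p \<in> {p. p permutes {0..<?t}}" "i \<in> {0..<?t}"
    then show "(?A * ?B) $$ (i, p i) = (case (r i, c (p i)) of (i, j) \<Rightarrow> \<Sum>l<d. a i l * b j l)"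
      using permutes_in_image[of p "{0..<?t}" i] entry[of i "p i"] by simp
  qed
  moreover have "det ?A = 0"
  proof -
    have "(\<Prod>i=0..<?t. ?A $$ (i, p i)) = 0" if p: "p permutes {0..<?t}" for p
    proof (rule prod_zero)
      obtain i where i: "i \<in> {0..<?t}" "p i = d"
        using permutes_image[OF p] by (metis imageE atLeastLessThan_iff lessI zero_le)
      then show "\<exists>i\<in>{0..<?t}. ?A $$ (i, p i) = 0" by (intro bexI[of _ i]) auto
    qed simp
    then show ?thesis unfolding det_def'[OF AB(1)] by (intro sum.neutral) simp
  qed
  ultimately show ?thesis using det_mult[OF AB] by simp
qed

section \<open>The product map\<close>

definition edge_poly :: "nat \<Rightarrow> nat \<times> nat \<Rightarrow> ((nat + nat) \<times> nat, 'c::comm_ring_1) mpoly" where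
  "edge_poly d v = (\<Sum>l<d. vr (Inl (fst v), l) * vr (Inr (snd v), l))"

definition phi :: "nat \<Rightarrow> ((nat \<times> nat, 'c::comm_ring_1) mpoly) \<Rightarrow> ((nat + nat) \<times> nat, 'c) mpoly" where
  "phi d = ev cst (edge_poly d)"

lemma comm_ring_hom_phi: "comm_ring_hom (phi d)"
  unfolding phi_def by (rule comm_ring_hom_ev[OF comm_ring_hom_cst])

lemma phi_cst [simp]: "phi d (cst c) = cst c"
  by (simp add: phi_def ev_single comm_ring_hom_cst)

lemma phi_vr [simp]: "phi d (vr v) = edge_poly d v"
  by (simp add: phi_def ev_single comm_ring_hom_cst)

lemma phi_sminor: "phi d (sminor (d + 1) vr r c) = 0"
proof -
  have "phi d (sminor (d + 1) vr r c) = sminor (d + 1) (edge_poly d) r c"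
    by (simp add: hom_sminor[OF comm_ring_hom_phi])
  also have "edge_poly d = (\<lambda>(i, j). \<Sum>l<d. vr (Inl i, l) * vr (Inr j, l))"
    by (auto simp: edge_poly_def)
  finally show ?thesis by (simp add: sminor_low_rank)
qed

section \<open>Chains of cells\<close>

definition below :: "nat \<times> nat \<Rightarrow> nat \<times> nat \<Rightarrow> bool" where
  "below a b \<longleftrightarrow> fst a < fst b \<and> snd a < snd b"

definition cell_chain :: "(nat \<times> nat) set \<Rightarrow> (nat \<times> nat) list \<Rightarrow> bool" where
  "cell_chain D xs \<longleftrightarrow> sorted_wrt below xs \<and> set xs \<subseteq> D"

definition good :: "nat \<Rightarrow> (nat \<times> nat) set \<Rightarrow> bool" where
  "good d D \<longleftrightarrow> (\<forall>xs. cell_chain D xs \<longrightarrow> length xs \<le> d)"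

text \<open>The rank function of \<open>D\<close> under \<open>below\<close>. Cells of equal rank
  form an antichain, so a good set splits into \<open>d\<close> antichains, as in Mirsky's
  theorem.\<close>

definition height_in :: "(nat \<times> nat) set \<Rightarrow> nat \<times> nat \<Rightarrow> nat" where
  "height_in D c = Max (length ` {xs. cell_chain D xs \<and> (\<forall>x\<in>set xs. below x c)})"

context
  fixes d D assumes good: "good d D"
begin

lemma height_in_ge: "cell_chain D xs \<Longrightarrow> \<forall>x\<in>set xs. below x c \<Longrightarrow> length xs \<le> height_in D c"
  unfolding height_in_def using good
  by (intro Max_ge) (auto simp: good_def intro: finite_subset[of _ "{..d}"])

lemma height_in_attained:
  obtains xs where "cell_chain D xs" "\<forall>x\<in>set xs. below x c" "length xs = height_in D c"
proof -
  let ?S = "length ` {xs. cell_chain D xs \<and> (\<forall>x\<in>set xs. below x c)}"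
  have "[] \<in> {xs. cell_chain D xs \<and> (\<forall>x\<in>set xs. below x c)}" by (simp add: cell_chain_def)
  then have "?S \<noteq> {}" by blast
  moreover have "finite ?S"
    using good by (auto simp: good_def intro: finite_subset[of _ "{..d}"])
  ultimately have "height_in D c \<in> ?S" unfolding height_in_def by (intro Max_in)
  then show ?thesis using that by auto
qed

lemma height_in_step:
  assumes "c \<in> D" obtains xs where "cell_chain D xs" "length xs = Suc (height_in D c)" "\<forall>x\<in>set xs. x = c \<or> below x c"
proof -
  obtain xs where xs: "cell_chain D xs" "\<forall>x\<in>set xs. below x c" "length xs = height_in D c"
    by (rule height_in_attained)
  then have "cell_chain D (xs @ [c])" using assms by (auto simp: cell_chain_def sorted_wrt_append)
  then show ?thesis using that[of "xs @ [c]"] xs by auto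
qed

lemma height_in_less: "c \<in> D \<Longrightarrow> height_in D c < d"
  using good by (metis height_in_step good_def Suc_le_eq)

lemma height_in_strict: "c \<in> D \<Longrightarrow> below c c' \<Longrightarrow> height_in D c < height_in D c'"
proof -
  assume c: "c \<in> D" and b: "below c c'"
  obtain xs where xs: "cell_chain D xs" "length xs = Suc (height_in D c)" "\<forall>x\<in>set xs. x = c \<or> below x c"
    using height_in_step[OF c] .
  have "\<forall>x\<in>set xs. below x c'" using xs(3) b by (auto simp: below_def)
  then have "length xs \<le> height_in D c'" by (rule height_in_ge[OF xs(1)])
  then show ?thesis using xs(2) by simp
qed

text \<open>Along a chain below \<open>c\<close> both coordinates are strictly increasing natural
  numbers, bounded by those of \<open>c\<close>.\<close>

lemma height_in_le: "height_in D c \<le> min (fst c) (snd c)"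
proof -
  obtain xs where xs: "cell_chain D xs" "\<forall>x\<in>set xs. below x c" "length xs = height_in D c"
    by (rule height_in_attained)
  have *: "length ys \<le> k" if "sorted_wrt (<) ys" "\<forall>y\<in>set ys. y < k" for ys and k :: nat
  proof -
    have "length ys = card (set ys)" using that(1) by (simp add: distinct_card strict_sorted_iff)
    also have "\<dots> \<le> card {..<k}" using that(2) by (intro card_mono) auto
    finally show ?thesis by simp
  qed
  have s: "sorted_wrt below xs" using xs(1) by (simp add: cell_chain_def)
  have "sorted_wrt (<) (map fst xs)" "sorted_wrt (<) (map snd xs)"
    unfolding sorted_wrt_map by (rule sorted_wrt_mono_rel[OF _ s], simp add: below_def)+
  then have "length (map fst xs) \<le> fst c" "length (map snd xs) \<le> snd c"
    using xs(2) by (intro *; auto simp: below_def)+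
  then show ?thesis using xs(3) by simp
qed

text \<open>Sliding every cell along its diagonal until its smaller coordinate equals its height
  is injective, as two cells on one diagonal are comparable.\<close>

lemma card_good_le:
  assumes DX: "D \<subseteq> {..<m} \<times> {..<n}"
  shows "card D \<le> card {v \<in> {..<m} \<times> {..<n}. fst v < d \<or> snd v < d}"
proof (rule card_inj_on_le)
  \<comment> \<open>By \<open>height_in_le\<close> this difference is not truncated, so the smaller
    coordinate of the image is exactly the height.\<close>
  let ?s = "\<lambda>c. min (fst c) (snd c) - height_in D c"
  let ?f = "\<lambda>c. (fst c - ?s c, snd c - ?s c)"
  have min_f: "min (fst (?f c)) (snd (?f c)) = height_in D c" for c
    using height_in_le[of c] by (cases "fst c \<le> snd c") (auto simp: min_def)
  have diag: "int (fst (?f c)) - int (snd (?f c)) = int (fst c) - int (snd c)" for c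
    by (auto simp: min_def of_nat_diff)
  show "inj_on ?f D"
  proof (rule inj_onI)
    fix a b assume ab: "a \<in> D" "b \<in> D" "?f a = ?f b"
    have h: "height_in D a = height_in D b" using min_f[of a] min_f[of b] ab(3) by simp
    have dg: "int (fst a) - int (snd a) = int (fst b) - int (snd b)"
      using diag[of a] diag[of b] ab(3) by simp
    have "\<not> below a b" "\<not> below b a" using height_in_strict[of a b] height_in_strict[of b a] ab h by auto
    then show "a = b" using dg by (auto simp: below_def prod_eq_iff)
  qed
  show "?f ` D \<subseteq> {v \<in> {..<m} \<times> {..<n}. fst v < d \<or> snd v < d}"
  proof clarify
    fix a b assume ab: "(a, b) \<in> D"
    have "min (fst (?f (a, b))) (snd (?f (a, b))) < d" using min_f[of "(a, b)"] height_in_less[OF ab] by simp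
    moreover have "a < m" "b < n" using ab DX by auto
    ultimately show "?f (a, b) \<in> {..<m} \<times> {..<n} \<and> (fst (?f (a, b)) < d \<or> snd (?f (a, b)) < d)"
      by (auto simp: min_def split: if_splits)
  qed
qed simp

end

text \<open>The cell number \<open>i\<close> of a chain, counted from 0, has both coordinates at
  least \<open>i\<close>, so cell number \<open>d\<close> would leave the hook. Hence the bound of
  \<open>card_good_le\<close> is attained.\<close>

lemma good_hook: "good d {v \<in> A. fst v < d \<or> snd v < d}"
  unfolding good_def
proof (intro allI impI)
  fix xs assume xs: "cell_chain {v \<in> A. fst v < d \<or> snd v < d} xs"
  have s: "sorted_wrt below xs" using xs by (simp add: cell_chain_def)
  have "i \<le> fst (xs ! i) \<and> i \<le> snd (xs ! i)" if "i < length xs" for i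
    using that
  proof (induction i)
    case (Suc i)
    then have "below (xs ! i) (xs ! Suc i)" using s by (simp add: sorted_wrt_iff_nth_less)
    then show ?case using Suc by (auto simp: below_def)
  qed simp
  show "length xs \<le> d"
  proof (rule ccontr)
    assume "\<not> length xs \<le> d"
    then have d: "d < length xs" by simp
    then have "xs ! d \<in> {v \<in> A. fst v < d \<or> snd v < d}" using xs nth_mem[OF d] unfolding cell_chain_def by blast
    then show False using \<open>\<And>i. i < length xs \<Longrightarrow> _ i\<close>[OF d] by auto
  qed
qed

lemma good_mono: "good d D \<Longrightarrow> D' \<subseteq> D \<Longrightarrow> good d D'"
  by (auto simp: good_def cell_chain_def)
section \<open>Straightening\<close>

text \<open>Exponents are compared at the smallest variable where they differ, and cells are ordered
  by row and then by column.\<close>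

lemma exp_lessI:
  fixes \<mu> \<nu> :: "'v::linorder \<Rightarrow>\<^sub>0 nat"
  assumes "lookup \<mu> k < lookup \<nu> k" "\<And>k'. k' < k \<Longrightarrow> lookup \<mu> k' = lookup \<nu> k'"
  shows "\<mu> < \<nu>"
  unfolding less_poly_mapping.rep_eq less_fun_def using assms by blast

lemma exp_lessD:
  fixes \<mu> \<nu> :: "'v::linorder \<Rightarrow>\<^sub>0 nat"
  shows "\<mu> < \<nu> \<Longrightarrow> \<exists>k. lookup \<mu> k < lookup \<nu> k \<and> (\<forall>k'<k. lookup \<mu> k' = lookup \<nu> k')"
  by (simp only: less_poly_mapping.rep_eq less_fun_def)

lemma mon_add: "(mon (a + b) :: ('v, 'c::comm_ring_1) mpoly) = mon a * mon b"
  by (simp add: mult_single)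

lemma mon_sum: "finite A \<Longrightarrow> (mon (\<Sum>a\<in>A. f a) :: ('v, 'c::comm_ring_1) mpoly) = (\<Prod>a\<in>A. mon (f a))"
  by (induction A rule: finite_induct) (simp_all add: mon_add)

abbreviation grid :: "nat \<Rightarrow> nat \<Rightarrow> (nat \<times> nat) set" where
  "grid m n \<equiv> {..<m} \<times> {..<n}"

definition perm_exp :: "nat \<Rightarrow> (nat \<Rightarrow> nat) \<Rightarrow> (nat \<Rightarrow> nat) \<Rightarrow> (nat \<Rightarrow> nat) \<Rightarrow> (nat \<times> nat) \<Rightarrow>\<^sub>0 nat" where
  "perm_exp t r c p = (\<Sum>i=0..<t. single (r i, c (p i)) (Suc 0))"

lemma sminor_vr: "sminor t vr r c = (\<Sum>p | p permutes {0..<t}. signof p * mon (perm_exp t r c p))"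
  by (simp add: sminor_def perm_exp_def mon_sum)

lemma tdeg_perm_exp: "tdeg (perm_exp t r c p) = t"
  by (simp add: perm_exp_def tdeg_sum)

lemma lookup_perm_exp: "lookup (perm_exp t r c p) v = card {i. i < t \<and> (r i, c (p i)) = v}"
proof -
  have "lookup (perm_exp t r c p) v = (\<Sum>i\<in>{0..<t}. if (r i, c (p i)) = v then Suc 0 else 0)"
    unfolding perm_exp_def lookup_sum by (intro sum.cong) (auto simp: lookup_single when_def)
  also have "\<dots> = card {i. i < t \<and> (r i, c (p i)) = v}"
    by (simp add: sum.If_cases Int_def)
  finally show ?thesis .
qed

lemma keys_perm_exp: "keys (perm_exp t r c p) = (\<lambda>i. (r i, c (p i))) ` {..<t}"
  by (auto simp: in_keys_iff lookup_perm_exp card_gt_0_iff)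

lemma perm_exp_le_grid:
  assumes "minor_index t m r" "minor_index t n c" "p permutes {0..<t}"
  shows "keys (perm_exp t r c p) \<subseteq> grid m n"
proof -
  have "p i < t" if "i < t" for i using permutes_in_image[OF assms(3), of i] that by auto
  then show ?thesis using assms(1,2) by (auto simp: keys_perm_exp minor_index_def)
qed

lemma minor_index_inj: "minor_index t m r \<Longrightarrow> i < t \<Longrightarrow> j < t \<Longrightarrow> r i = r j \<Longrightarrow> i = j"
  unfolding minor_index_def by (metis linorder_neqE_nat order_less_irrefl)

text \<open>The diagonal is the leading term of a minor. At the first index \<open>s\<close> moved
  by \<open>p\<close>, the permuted term misses the cell \<open>(r s, c s)\<close>, because
  \<open>p s > s\<close>; on all earlier cells the two terms agree.\<close>

lemma perm_exp_less:
  assumes r: "minor_index t m r" and c: "minor_index t n c" and p: "p permutes {0..<t}" and pid: "p \<noteq> id"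
  shows "perm_exp t r c p < perm_exp t r c id"
proof -
  define s where "s = (LEAST i. p i \<noteq> i)"
  obtain i0 where "p i0 \<noteq> i0" using pid by fastforce
  then have s: "p s \<noteq> s" unfolding s_def by (rule LeastI)
  have small: "p i = i" if "i < s" for i using not_less_Least that unfolding s_def by blast
  have st: "s < t" using s permutes_not_in[OF p, of s] by auto
  have pt: "p i < t" if "i < t" for i using permutes_in_image[OF p, of i] that by auto
  have gt: "s < p s"
  proof (rule ccontr)
    assume "\<not> s < p s"
    then have "p s < s" using s by simp
    then have "p (p s) = p s" by (rule small)
    then have "p s = s" using permutes_inj[OF p] by (auto dest: injD)
    then show False using s by simp
  qed
  have rlt: "r i < r j \<longleftrightarrow> i < j" if "i < t" "j < t" for i j
    using r that unfolding minor_index_def by (metis linorder_neqE_nat order_less_asym order_less_irrefl)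
  have clt: "c i < c j" if "i < j" "j < t" for i j using c that by (simp add: minor_index_def)
  show ?thesis
  proof (rule exp_lessI[where k = "(r s, c s)"])
    have "{i. i < t \<and> (r i, c (p i)) = (r s, c s)} = {}"
      using minor_index_inj[OF r _ st] minor_index_inj[OF c _ st] pt s by fastforce
    moreover have "s \<in> {i. i < t \<and> (r i, c (id i)) = (r s, c s)}" using st by simp
    then have "card {i. i < t \<and> (r i, c (id i)) = (r s, c s)} > 0" by (subst card_gt_0_iff) auto
    ultimately show "lookup (perm_exp t r c p) (r s, c s) < lookup (perm_exp t r c id) (r s, c s)"
      by (simp only: lookup_perm_exp card.empty)
  next
    fix k' assume k: "k' < (r s, c s)"
    have "(r i, c (p i)) = k' \<longleftrightarrow> (r i, c (id i)) = k'" if it: "i < t" for i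
    proof (cases "i < s")
      case True then show ?thesis using small by simp
    next
      case False
      then have "r s \<le> r i" "i = s \<or> r s < r i" using rlt[OF st it] rlt[OF it st] it st by (auto simp: not_less order_le_less)
      moreover have "c s < c (p s)" using clt gt pt[OF st] by blast
      ultimately show ?thesis using k by (cases k') auto
    qed
    then have "{i. i < t \<and> (r i, c (p i)) = k'} = {i. i < t \<and> (r i, c (id i)) = k'}" by blast
    then show "lookup (perm_exp t r c p) k' = lookup (perm_exp t r c id) k'"
      by (simp only: lookup_perm_exp)
  qed
qed

definition gen_minors :: "nat \<Rightarrow> nat \<Rightarrow> nat \<Rightarrow> ((nat \<times> nat, 'c::comm_ring_1) mpoly) set" where
  "gen_minors t m n = {sminor t vr r c | r c. minor_index t m r \<and> minor_index t n c}"

definition good_exps :: "nat \<Rightarrow> nat \<Rightarrow> nat \<Rightarrow> (nat \<times> nat \<Rightarrow>\<^sub>0 nat) set" where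
  "good_exps d m n = {\<mu>. keys \<mu> \<subseteq> grid m n \<and> good d (keys \<mu>)}"

text \<open>A strict chain of \<open>d + 1\<close> cells is the diagonal of a minor.\<close>

lemma bad_exp:
  assumes "keys \<alpha> \<subseteq> grid m n" "\<not> good d (keys \<alpha>)"
  obtains r c where "minor_index (d + 1) m r" "minor_index (d + 1) n c" "keys (perm_exp (d + 1) r c id) \<subseteq> keys \<alpha>"
proof -
  obtain ys where ys: "cell_chain (keys \<alpha>) ys" "\<not> length ys \<le> d" using assms(2) by (auto simp: good_def)
  define xs where "xs = take (d + 1) ys"
  have xs: "sorted_wrt below xs" "set xs \<subseteq> keys \<alpha>" "length xs = d + 1"
    using ys set_take_subset[of "d + 1" ys]
    by (auto simp: xs_def cell_chain_def sorted_wrt_take min_def)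
  have xsg: "xs ! i \<in> grid m n" if "i < d + 1" for i
  proof -
    have "xs ! i \<in> set xs" using xs(3) that by simp
    then show ?thesis using xs(2) assms(1) by blast
  qed
  have lt: "below (xs ! i) (xs ! j)" if "i < j" "j < d + 1" for i j
    using xs(1,3) that by (simp add: sorted_wrt_iff_nth_less)
  have "minor_index (d + 1) m (\<lambda>i. fst (xs ! i))" "minor_index (d + 1) n (\<lambda>i. snd (xs ! i))"
    using xsg lt by (auto simp: minor_index_def below_def mem_Times_iff)
  moreover have "keys (perm_exp (d + 1) (\<lambda>i. fst (xs ! i)) (\<lambda>i. snd (xs ! i)) id) \<subseteq> keys \<alpha>"
  proof -
    have "xs ! i \<in> keys \<alpha>" if "i < d + 1" for i
      using xs(2,3) nth_mem[of i xs] that by (simp only: subset_iff)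
    then show ?thesis by (auto simp: keys_perm_exp)
  qed
  ultimately show ?thesis by (rule that)
qed

text \<open>A bad monomial is divisible by the diagonal of a minor; subtracting a multiple of that
  minor replaces it by smaller monomials of the same degree, of which there are finitely
  many.\<close>

lemma straighten:
  assumes "keys \<alpha> \<subseteq> grid m n"
  shows "\<exists>r. r \<in> mp.span (mon ` {\<beta> \<in> good_exps d m n. tdeg \<beta> = tdeg \<alpha>}) \<and>
    (mon \<alpha> :: (nat \<times> nat, 'k::field) mpoly) - r \<in> idg (gen_minors (d + 1) m n)"
proof -
  define S where "S = {\<mu>. keys \<mu> \<subseteq> grid m n \<and> tdeg \<mu> = tdeg \<alpha>}"
  have finS: "finite S"
    by (rule finite_subset[OF _ finite_tdeg_le[of "grid m n" "tdeg \<alpha>"]]) (auto simp: S_def)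
  let ?B = "mon ` {\<beta> \<in> good_exps d m n. tdeg \<beta> = tdeg \<alpha>} :: ((nat \<times> nat, 'k) mpoly) set"
  let ?N = "idg (gen_minors (d + 1) m n) :: ((nat \<times> nat, 'k) mpoly) set"
  have "\<exists>r. r \<in> mp.span ?B \<and> mon \<mu> - r \<in> ?N" if "\<mu> \<in> S" for \<mu>
    using that
  proof (induction "card {\<nu> \<in> S. \<nu> < \<mu>}" arbitrary: \<mu> rule: less_induct)
    case less
    have IH: "\<exists>r. r \<in> mp.span ?B \<and> mon \<nu> - r \<in> ?N" if \<nu>: "\<nu> \<in> S" "\<nu> < \<mu>" for \<nu>
    proof (rule less.hyps[OF _ \<nu>(1)])
      have "{\<xi> \<in> S. \<xi> < \<nu>} \<subset> {\<xi> \<in> S. \<xi> < \<mu>}" using \<nu> by auto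
      then show "card {\<xi> \<in> S. \<xi> < \<nu>} < card {\<xi> \<in> S. \<xi> < \<mu>}"
        using finS by (intro psubset_card_mono) auto
    qed
    show ?case
    proof (cases "good d (keys \<mu>)")
      case True
      then have "mon \<mu> \<in> mp.span ?B"
        using less.prems by (intro mp.span_base imageI) (auto simp: S_def good_exps_def)
      then show ?thesis by (intro exI[of _ "mon \<mu>"]) (simp add: idl.span_zero)
    next
      case False
      have muX: "keys \<mu> \<subseteq> grid m n" using less.prems by (simp add: S_def)
      obtain r c where rc: "minor_index (d + 1) m r" "minor_index (d + 1) n c"
        "keys (perm_exp (d + 1) r c id) \<subseteq> keys \<mu>"
        using bad_exp[OF muX False] .
      let ?e = "perm_exp (d + 1) r c"
      let ?P = "{p. p permutes {0..<d + 1}}"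
      define \<beta> where "\<beta> = \<mu> - ?e id"
      \<comment> \<open>The diagonal term is squarefree, so containment of supports already gives
        divisibility.\<close>
      have le: "lookup (?e id) v \<le> lookup \<mu> v" for v
      proof (cases "v \<in> keys (?e id)")
        case True
        have "card {i. i < d + 1 \<and> (r i, c (id i)) = v} \<le> card {i. i < d + 1 \<and> r i = fst v}"
          by (intro card_mono) auto
        also have "\<dots> \<le> 1"
          using minor_index_inj[OF rc(1)] by (subst One_nat_def, subst card_le_Suc0_iff_eq) auto
        finally have "lookup (?e id) v \<le> 1" by (simp add: lookup_perm_exp)
        moreover have "v \<in> keys \<mu>" using True rc(3) by blast
        then have "1 \<le> lookup \<mu> v" by (simp add: in_keys_iff Suc_le_eq)
        ultimately show ?thesis by simp
      qed (simp add: in_keys_iff)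
      have \<beta>: "\<mu> = \<beta> + ?e id"
        by (rule poly_mapping_eqI) (simp only: \<beta>_def lookup_add lookup_minus le_add_diff_inverse2[OF le])
      have finP: "finite ?P" by (intro finite_permutations) simp
      have S: "\<beta> + ?e p \<in> S" if "p \<in> ?P" for p
      proof -
        have "keys \<beta> \<subseteq> grid m n" using muX unfolding \<beta> keys_add_nat by blast
        moreover have "keys (?e p) \<subseteq> grid m n" using perm_exp_le_grid[OF rc(1,2)] that by blast
        moreover have "tdeg (\<beta> + ?e p) = tdeg \<mu>" unfolding \<beta> tdeg_add tdeg_perm_exp ..
        ultimately show ?thesis using less.prems by (auto simp: S_def keys_add_nat)
      qed
      have "\<exists>s. s \<in> mp.span ?B \<and> mon (\<beta> + ?e p) - s \<in> ?N" if p: "p \<in> ?P - {id}" for p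
      proof (rule IH)
        show "\<beta> + ?e p \<in> S" using S p by blast
        have "?e p < ?e id" using perm_exp_less[OF rc(1,2)] p by blast
        then show "\<beta> + ?e p < \<mu>" unfolding \<beta> by simp
      qed
      then have "\<forall>p. \<exists>s. p \<in> ?P - {id} \<longrightarrow> s \<in> mp.span ?B \<and> mon (\<beta> + ?e p) - s \<in> ?N" by blast
      from choice[OF this] obtain s where
        s: "\<And>p. p \<in> ?P - {id} \<Longrightarrow> s p \<in> mp.span ?B" "\<And>p. p \<in> ?P - {id} \<Longrightarrow> mon (\<beta> + ?e p) - s p \<in> ?N"
        by blast
      have sg: "(signof p :: (nat \<times> nat, 'k) mpoly) = cst (signof p)" for p :: "nat \<Rightarrow> nat"
        by (simp add: sign_def single_uminus)
      define R where "R = (\<Sum>p\<in>?P - {id}. signof p * s p)"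
      have M: "sminor (d + 1) vr r c \<in> ?N"
        using rc by (intro idl.span_base) (auto simp: gen_minors_def)
      have "mon \<beta> * sminor (d + 1) vr r c = (\<Sum>p\<in>?P. signof p * mon (\<beta> + ?e p) :: (nat \<times> nat, 'k) mpoly)"
        unfolding sminor_vr sum_distrib_left
      proof (intro sum.cong refl)
        fix p
        have "mon (\<beta> + ?e p) = (mon \<beta> * mon (?e p) :: (nat \<times> nat, 'k) mpoly)" by (simp add: mult_single)
        then show "mon \<beta> * (signof p * mon (?e p)) = (signof p * mon (\<beta> + ?e p) :: (nat \<times> nat, 'k) mpoly)"
          by (simp only: ac_simps)
      qed
      also have "\<dots> = signof id * mon (\<beta> + ?e id) + (\<Sum>p\<in>?P - {id}. signof p * mon (\<beta> + ?e p))"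
        by (rule sum.remove[OF finP]) (simp add: permutes_id)
      also have "signof id * mon (\<beta> + ?e id) = (mon \<mu> :: (nat \<times> nat, 'k) mpoly)"
        unfolding \<beta>[symmetric] by simp
      finally have eq: "mon \<beta> * sminor (d + 1) vr r c =
        (mon \<mu> :: (nat \<times> nat, 'k) mpoly) + (\<Sum>p\<in>?P - {id}. signof p * mon (\<beta> + ?e p))" .
      have "mon \<mu> - (- R) = mon \<beta> * sminor (d + 1) vr r c - (\<Sum>p\<in>?P - {id}. signof p * (mon (\<beta> + ?e p) - s p))"
      proof -
        have "a - - b = (a + w) - (w - b)" for a b w :: "(nat \<times> nat, 'k) mpoly"
          by simp
        then show ?thesis unfolding eq R_def right_diff_distrib sum_subtractf .
      qed
      also have "\<dots> \<in> ?N"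
        by (intro idl.span_diff idl.span_sum idg_mult M s(2))
      finally have "mon \<mu> - (- R) \<in> ?N" .
      moreover have "- R \<in> mp.span ?B"
        unfolding R_def sg by (intro mp.span_neg mp.span_sum mp.span_scale s(1))
      ultimately show ?thesis by blast
    qed
  qed
  then show ?thesis using assms by (auto simp: S_def)
qed

section \<open>Independence of the good monomials\<close>

lemma mult_of_nat_coeffs:
  fixes p q :: "('v, 'c::comm_ring_1) mpoly"
  assumes "\<And>\<mu>. lookup p \<mu> = of_nat (f \<mu>)" "\<And>\<mu>. lookup q \<mu> = of_nat (g \<mu>)"
  shows "lookup (p * q) \<kappa> = of_nat (\<Sum>x\<in>keys p. \<Sum>y\<in>keys q. if x + y = \<kappa> then f x * g y else 0)"
  unfolding poly_mapping_mult_sum lookup_sum lookup_single of_nat_sum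
  by (intro sum.cong) (auto simp: when_def assms)

text \<open>A positivity device: natural coefficients cannot cancel in characteristic zero, so every
  product of terms is visible in the product (\<open>lookup_mult_nonzero\<close>).\<close>

definition nat_coeffs :: "(('v, 'c::comm_ring_1) mpoly) \<Rightarrow> bool" where
  "nat_coeffs p \<longleftrightarrow> (\<exists>f. \<forall>\<mu>. lookup p \<mu> = of_nat (f \<mu>))"

lemma nat_coeffs_mult: "nat_coeffs p \<Longrightarrow> nat_coeffs q \<Longrightarrow> nat_coeffs (p * q)"
  unfolding nat_coeffs_def
proof (elim exE)
  fix f g assume f: "\<forall>\<mu>. lookup p \<mu> = of_nat (f \<mu>)" and g: "\<forall>\<mu>. lookup q \<mu> = of_nat (g \<mu>)"
  show "\<exists>h. \<forall>\<mu>. lookup (p * q) \<mu> = of_nat (h \<mu>)"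
    by (rule exI, rule allI, rule mult_of_nat_coeffs[OF f[rule_format] g[rule_format]])
qed

lemma nat_coeffs_add: "nat_coeffs p \<Longrightarrow> nat_coeffs q \<Longrightarrow> nat_coeffs (p + q)"
  unfolding nat_coeffs_def
proof (elim exE)
  fix f g assume "\<forall>\<mu>. lookup p \<mu> = of_nat (f \<mu>)" "\<forall>\<mu>. lookup q \<mu> = of_nat (g \<mu>)"
  then show "\<exists>h. \<forall>\<mu>. lookup (p + q) \<mu> = of_nat (h \<mu>)"
    by (intro exI[of _ "\<lambda>\<mu>. f \<mu> + g \<mu>"]) (simp add: lookup_add)
qed

lemma nat_coeffs_mon: "nat_coeffs (mon \<mu>)"
  unfolding nat_coeffs_def by (rule exI[of _ "\<lambda>\<nu>. 1 when \<nu> = \<mu>"]) (auto simp: lookup_single when_def)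

lemma nat_coeffs_zero: "nat_coeffs 0"
  unfolding nat_coeffs_def by (rule exI[of _ "\<lambda>\<nu>. 0"]) simp

lemma nat_coeffs_sum: "(\<And>i. i \<in> A \<Longrightarrow> nat_coeffs (f i)) \<Longrightarrow> nat_coeffs (sum f A)"
  by (induction A rule: infinite_finite_induct) (simp_all add: nat_coeffs_zero nat_coeffs_add)

lemma lookup_mult_nonzero:
  fixes p q :: "('v, 'c::field_char_0) mpoly"
  assumes "nat_coeffs p" "nat_coeffs q" and nz: "lookup p a \<noteq> 0" "lookup q b \<noteq> 0"
  shows "lookup (p * q) (a + b) \<noteq> 0"
proof -
  obtain f g where fg: "\<And>\<mu>. lookup p \<mu> = of_nat (f \<mu>)" "\<And>\<mu>. lookup q \<mu> = of_nat (g \<mu>)"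
    using assms(1,2) unfolding nat_coeffs_def by blast
  have ab: "a \<in> keys p" "b \<in> keys q" using nz by (simp_all add: in_keys_iff)
  have "f a \<noteq> 0" "g b \<noteq> 0" using nz fg by auto
  have "(\<Sum>x\<in>keys p. \<Sum>y\<in>keys q. if x + y = a + b then f x * g y else 0) \<noteq> 0"
  proof
    assume *: "(\<Sum>x\<in>keys p. \<Sum>y\<in>keys q. if x + y = a + b then f x * g y else 0) = 0"
    then have "\<forall>x\<in>keys p. \<forall>y\<in>keys q. (if x + y = a + b then f x * g y else 0) = 0"
      by (simp only: sum_eq_0_iff finite_keys)
    then have "f a * g b = 0" using ab by (metis (full_types))
    then show False using \<open>f a \<noteq> 0\<close> \<open>g b \<noteq> 0\<close> by simp
  qed
  then show ?thesis unfolding mult_of_nat_coeffs[of p f q g, OF fg] by (simp only: of_nat_eq_0_iff) simp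
qed

lemma nat_coeffs_edge_poly: "nat_coeffs (edge_poly d v)"
  unfolding edge_poly_def by (intro nat_coeffs_sum nat_coeffs_mult nat_coeffs_mon)

section \<open>Expanding the image of a monomial into layers\<close>

definition edge_exp :: "nat \<Rightarrow> nat \<times> nat \<Rightarrow> ((nat + nat) \<times> nat) \<Rightarrow>\<^sub>0 nat" where
  "edge_exp l v = single (Inl (fst v), l) (Suc 0) + single (Inr (snd v), l) (Suc 0)"

lemma edge_poly_eq: "(edge_poly d v :: _ \<Rightarrow>\<^sub>0 'c::comm_ring_1) = (\<Sum>l<d. mon (edge_exp l v))"
  unfolding edge_poly_def edge_exp_def mon_add ..

lemma edge_exp_inj: "edge_exp l v = edge_exp l' v' \<longleftrightarrow> l = l' \<and> v = v'"
proof
  assume "edge_exp l v = edge_exp l' v'"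
  then have "keys (edge_exp l v) = keys (edge_exp l' v')" by simp
  then show "l = l' \<and> v = v'" by (auto simp: edge_exp_def keys_add_nat prod_eq_iff doubleton_eq_iff)
qed simp

lemma lookup_edge_poly: "lookup (edge_poly d v :: _ \<Rightarrow>\<^sub>0 'c::comm_ring_1) (edge_exp l w) = (if l < d \<and> v = w then 1 else 0)"
proof -
  have "lookup (edge_poly d v :: _ \<Rightarrow>\<^sub>0 'c) (edge_exp l w) = (\<Sum>k<d. if k = l then (if v = w then 1 else 0) else 0)"
    unfolding edge_poly_eq lookup_sum by (intro sum.cong) (auto simp: lookup_single when_def edge_exp_inj)
  also have "\<dots> = (if l < d \<and> v = w then 1 else 0)" by (simp add: sum.delta)
  finally show ?thesis .
qed

lemma keys_edge_poly: "keys (edge_poly d v) \<subseteq> (\<lambda>l. edge_exp l v) ` {..<d}"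
  unfolding edge_poly_eq by (rule order_trans[OF keys_sum]) auto

text \<open>The exponent of the monomial that selects the summand \<open>l\<close> of every factor \<open>edge_poly\<close>.\<close>

definition layer_exp :: "nat \<Rightarrow> nat \<Rightarrow> nat \<Rightarrow> (nat \<times> nat \<Rightarrow>\<^sub>0 nat) \<Rightarrow> ((nat + nat) \<times> nat) \<Rightarrow>\<^sub>0 nat" where
  "layer_exp m n l \<gamma> = (\<Sum>v\<in>grid m n. single (Inl (fst v), l) (lookup \<gamma> v) + single (Inr (snd v), l) (lookup \<gamma> v))"

lemma layer_exp_add: "layer_exp m n l (\<gamma> + \<delta>) = layer_exp m n l \<gamma> + layer_exp m n l \<delta>"
  unfolding layer_exp_def sum.distrib[symmetric]
  by (intro sum.cong) (simp_all add: lookup_add single_add add_ac)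

lemma layer_exp_zero [simp]: "layer_exp m n l 0 = 0"
  by (simp add: layer_exp_def)

lemma layer_exp_single: "v \<in> grid m n \<Longrightarrow> layer_exp m n l (single v (Suc 0)) = edge_exp l v"
proof -
  assume v: "v \<in> grid m n"
  have "layer_exp m n l (single v (Suc 0)) = (\<Sum>w\<in>grid m n. if w = v then edge_exp l v else 0)"
    unfolding layer_exp_def by (intro sum.cong) (auto simp: lookup_single when_def edge_exp_def)
  then show ?thesis using v by (simp add: sum.delta')
qed

lemma lookup_layer_exp_row:
  "i < m \<Longrightarrow> lookup (layer_exp m n l \<gamma>) (Inl i, l') = (if l = l' then \<Sum>j<n. lookup \<gamma> (i, j) else 0)"
proof -
  assume i: "i < m"
  have "lookup (layer_exp m n l \<gamma>) (Inl i, l') =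
      (\<Sum>(a, b)\<in>grid m n. if a = i then (if l = l' then lookup \<gamma> (a, b) else 0) else 0)"
    unfolding layer_exp_def lookup_sum by (intro sum.cong) (auto simp: lookup_add lookup_single when_def)
  also have "\<dots> = (\<Sum>a<m. \<Sum>b<n. if a = i then (if l = l' then lookup \<gamma> (a, b) else 0) else 0)"
    by (simp add: sum.cartesian_product)
  also have "\<dots> = (\<Sum>a<m. if a = i then (\<Sum>b<n. (if l = l' then lookup \<gamma> (a, b) else 0)) else 0)"
    by (intro sum.cong) auto
  finally show ?thesis using i by (simp add: sum.delta)
qed

lemma lookup_layer_exp_col:
  "j < n \<Longrightarrow> lookup (layer_exp m n l \<gamma>) (Inr j, l') = (if l = l' then \<Sum>i<m. lookup \<gamma> (i, j) else 0)"
proof -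
  assume j: "j < n"
  have "lookup (layer_exp m n l \<gamma>) (Inr j, l') =
      (\<Sum>(a, b)\<in>grid m n. if b = j then (if l = l' then lookup \<gamma> (a, b) else 0) else 0)"
    unfolding layer_exp_def lookup_sum by (intro sum.cong) (auto simp: lookup_add lookup_single when_def)
  also have "\<dots> = (\<Sum>a<m. \<Sum>b<n. if b = j then (if l = l' then lookup \<gamma> (a, b) else 0) else 0)"
    by (rule sum.cartesian_product[symmetric])
  finally show ?thesis using j by (simp add: sum.delta)
qed

definition layers_exp :: "nat \<Rightarrow> nat \<Rightarrow> nat \<Rightarrow> (nat \<Rightarrow> nat \<times> nat \<Rightarrow>\<^sub>0 nat) \<Rightarrow> ((nat + nat) \<times> nat) \<Rightarrow>\<^sub>0 nat" where
  "layers_exp d m n \<gamma> = (\<Sum>l<d. layer_exp m n l (\<gamma> l))"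

text \<open>The exponents of the variables with second index \<open>l\<close> are precisely the row
  sums and column sums of layer \<open>l\<close>.\<close>

lemma layers_margins:
  assumes "layers_exp d m n \<gamma> = layers_exp d m n \<delta>" "l < d"
  shows "i < m \<Longrightarrow> (\<Sum>j<n. lookup (\<gamma> l) (i, j)) = (\<Sum>j<n. lookup (\<delta> l) (i, j))"
    and "j < n \<Longrightarrow> (\<Sum>i<m. lookup (\<gamma> l) (i, j)) = (\<Sum>i<m. lookup (\<delta> l) (i, j))"
proof -
  have r: "lookup (layers_exp d m n \<epsilon>) (Inl i, l) = (\<Sum>j<n. lookup (\<epsilon> l) (i, j))" if "i < m" for \<epsilon> i
    unfolding layers_exp_def lookup_sum using assms(2) that by (simp add: lookup_layer_exp_row sum.delta)
  have c: "lookup (layers_exp d m n \<epsilon>) (Inr j, l) = (\<Sum>i<m. lookup (\<epsilon> l) (i, j))" if "j < n" for \<epsilon> j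
    unfolding layers_exp_def lookup_sum using assms(2) that by (simp add: lookup_layer_exp_col sum.delta)
  show "i < m \<Longrightarrow> (\<Sum>j<n. lookup (\<gamma> l) (i, j)) = (\<Sum>j<n. lookup (\<delta> l) (i, j))"
    using r[of i \<gamma>] r[of i \<delta>] assms(1) by simp
  show "j < n \<Longrightarrow> (\<Sum>i<m. lookup (\<gamma> l) (i, j)) = (\<Sum>i<m. lookup (\<delta> l) (i, j))"
    using c[of j \<gamma>] c[of j \<delta>] assms(1) by simp
qed

text \<open>Multiplying out the edge polynomials means choosing a summand for every factor, that is,
  distributing the cells of \<open>\<beta>\<close>, with multiplicity, over \<open>d\<close>
  layers.\<close>

lemma keys_phi_mon:
  assumes "keys \<beta> \<subseteq> grid m n" "\<kappa> \<in> keys (phi d (mon \<beta>) :: _ \<Rightarrow>\<^sub>0 'c::comm_ring_1)"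
  shows "\<exists>\<gamma>. (\<forall>l. keys (\<gamma> l) \<subseteq> grid m n) \<and> (\<Sum>l<d. \<gamma> l) = \<beta> \<and> \<kappa> = layers_exp d m n \<gamma>"
  using assms
proof (induction \<beta> arbitrary: \<kappa> rule: exp_induct_on)
  case zero
  interpret comm_ring_hom "phi d" by (rule comm_ring_hom_phi)
  have "\<kappa> = 0" using zero by simp
  then show ?case by (intro exI[of _ "\<lambda>_. 0"]) (simp add: layers_exp_def)
next
  case (add v \<mu>)
  interpret comm_ring_hom "phi d" by (rule comm_ring_hom_phi)
  have "(phi d (mon (single v (Suc 0) + \<mu>)) :: _ \<Rightarrow>\<^sub>0 'c) = edge_poly d v * phi d (mon \<mu>)"
    by (simp add: mon_add hom_mult)
  then have "\<kappa> \<in> keys (edge_poly d v * phi d (mon \<mu>) :: _ \<Rightarrow>\<^sub>0 'c)" using add.prems by (simp only:)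
  from subsetD[OF keys_mult this]
  obtain a b where ab: "\<kappa> = a + b" "a \<in> keys (edge_poly d v :: _ \<Rightarrow>\<^sub>0 'c)" "b \<in> keys (phi d (mon \<mu>) :: _ \<Rightarrow>\<^sub>0 'c)"
    by blast
  obtain l where l: "l < d" "a = edge_exp l v" using ab(2) keys_edge_poly by blast
  obtain \<gamma> where g: "\<And>l. keys (\<gamma> l) \<subseteq> grid m n" "(\<Sum>l<d. \<gamma> l) = \<mu>" "b = layers_exp d m n \<gamma>"
    using add.IH[OF ab(3)] by blast
  let ?\<gamma> = "\<lambda>k. (if k = l then single v (Suc 0) else 0) + \<gamma> k"
  have "(\<Sum>l<d. ?\<gamma> l) = single v (Suc 0) + \<mu>"
    unfolding sum.distrib g(2) using l(1) by (simp add: sum.delta)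
  moreover have "layers_exp d m n ?\<gamma> = \<kappa>"
  proof -
    have "layers_exp d m n ?\<gamma> = (\<Sum>k<d. layer_exp m n k (if k = l then single v (Suc 0) else 0)) + b"
      unfolding layers_exp_def layer_exp_add sum.distrib g(3) ..
    also have "(\<Sum>k<d. layer_exp m n k (if k = l then single v (Suc 0) else 0)) = (\<Sum>k<d. if k = l then a else 0)"
      using add.hyps l(2) by (intro sum.cong) (auto simp: layer_exp_single)
    finally show ?thesis using l(1) ab(1) by (simp add: sum.delta)
  qed
  moreover have "keys (?\<gamma> k) \<subseteq> grid m n" for k
    using g(1)[of k] add.hyps(1) by (auto simp: keys_add_nat split: if_splits)
  ultimately show ?case by (intro exI[of _ ?\<gamma>]) simp
qed

lemma nat_coeffs_phi_mon: "nat_coeffs (phi d (mon \<beta>))"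
proof (induction \<beta> rule: exp_induct)
  case zero
  interpret comm_ring_hom "phi d" by (rule comm_ring_hom_phi)
  show ?case using nat_coeffs_mon[of 0] by simp
next
  case (add v \<mu>)
  interpret comm_ring_hom "phi d" by (rule comm_ring_hom_phi)
  show ?case using add by (simp add: mon_add hom_mult nat_coeffs_mult nat_coeffs_edge_poly)
qed

lemma phi_mon_layer_nonzero:
  assumes "keys \<gamma> \<subseteq> grid m n" "l < d"
  shows "lookup (phi d (mon \<gamma>) :: _ \<Rightarrow>\<^sub>0 'k::field_char_0) (layer_exp m n l \<gamma>) \<noteq> 0"
  using assms(1)
proof (induction \<gamma> rule: exp_induct_on)
  case zero
  interpret comm_ring_hom "phi d" by (rule comm_ring_hom_phi)
  show ?case by simp
next
  case (add v \<mu>)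
  interpret comm_ring_hom "phi d" by (rule comm_ring_hom_phi)
  have "lookup (edge_poly d v * phi d (mon \<mu>) :: _ \<Rightarrow>\<^sub>0 'k) (edge_exp l v + layer_exp m n l \<mu>) \<noteq> 0"
    by (rule lookup_mult_nonzero[OF nat_coeffs_edge_poly nat_coeffs_phi_mon _ add.IH])
      (simp add: lookup_edge_poly assms(2))
  then show ?case by (simp add: mon_add hom_mult layer_exp_add layer_exp_single[OF add.hyps(1)])
qed

text \<open>Conversely every distribution over layers does occur, since nothing cancels.\<close>

lemma phi_mon_layers_nonzero:
  assumes "\<And>l. keys (\<gamma> l) \<subseteq> grid m n"
  shows "lookup (phi d (mon (\<Sum>l<d. \<gamma> l)) :: _ \<Rightarrow>\<^sub>0 'k::field_char_0) (layers_exp d m n \<gamma>) \<noteq> 0"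
proof -
  interpret comm_ring_hom "phi d" by (rule comm_ring_hom_phi)
  have "lookup (phi d (mon (\<Sum>l<e. \<gamma> l)) :: _ \<Rightarrow>\<^sub>0 'k) (\<Sum>l<e. layer_exp m n l (\<gamma> l)) \<noteq> 0" if "e \<le> d" for e
    using that
  proof (induction e)
    case (Suc e)
    have "lookup (phi d (mon (\<Sum>l<e. \<gamma> l)) * phi d (mon (\<gamma> e)) :: _ \<Rightarrow>\<^sub>0 'k)
        ((\<Sum>l<e. layer_exp m n l (\<gamma> l)) + layer_exp m n e (\<gamma> e)) \<noteq> 0"
      by (rule lookup_mult_nonzero[OF nat_coeffs_phi_mon nat_coeffs_phi_mon Suc.IH phi_mon_layer_nonzero[OF assms]])
        (use Suc.prems in auto)
    then show ?case by (simp add: mon_add hom_mult)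
  qed simp
  then show ?thesis unfolding layers_exp_def by blast
qed

text \<open>At the first cell \<open>(i, j)\<close> where \<open>\<gamma>\<close> is smaller, the column margins force \<open>\<gamma> \<le> \<alpha>\<close> along row
  \<open>i\<close>, contradicting the row margin.\<close>

lemma antichain_minimal:
  fixes \<alpha> \<gamma> :: "nat \<times> nat \<Rightarrow>\<^sub>0 nat"
  assumes keys: "keys \<alpha> \<subseteq> grid m n"
    and row: "\<And>i. i < m \<Longrightarrow> (\<Sum>j<n. lookup \<gamma> (i, j)) = (\<Sum>j<n. lookup \<alpha> (i, j))"
    and col: "\<And>j. j < n \<Longrightarrow> (\<Sum>i<m. lookup \<gamma> (i, j)) = (\<Sum>i<m. lookup \<alpha> (i, j))"
    and anti: "\<And>a b. a \<in> keys \<alpha> \<Longrightarrow> b \<in> keys \<alpha> \<Longrightarrow> \<not> below a b"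
  shows "\<alpha> \<le> \<gamma>"
proof (rule ccontr)
  assume "\<not> \<alpha> \<le> \<gamma>"
  then have "\<gamma> < \<alpha>" by simp
  then obtain v where v: "lookup \<gamma> v < lookup \<alpha> v" "\<And>k. k < v \<Longrightarrow> lookup \<gamma> k = lookup \<alpha> k"
    using exp_lessD by blast
  obtain i j where ij: "v = (i, j)" by (cases v)
  have vk: "(i, j) \<in> keys \<alpha>" using v(1) ij by (auto simp: in_keys_iff)
  then have im: "i < m" and jn: "j < n" using keys by auto
  have le: "lookup \<gamma> (i, c) \<le> lookup \<alpha> (i, c)" if c: "c < n" for c
  proof (cases "c \<le> j")
    case True
    then show ?thesis using v ij by (cases "c = j") auto
  next
    case False
    show ?thesis
    proof (rule ccontr)
      assume less: "\<not> ?thesis"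
      have "lookup \<alpha> (a, c) \<le> lookup \<gamma> (a, c)" for a
      proof -
        consider "a < i" | "a = i" | "i < a" by linarith
        then show ?thesis
        proof cases
          case 1 then show ?thesis using v(2)[of "(a, c)"] ij by simp
        next
          case 2 then show ?thesis using less by simp
        next
          case 3
          then have "(a, c) \<notin> keys \<alpha>" using anti[OF vk, of "(a, c)"] False by (auto simp: below_def)
          then show ?thesis by (simp add: in_keys_iff)
        qed
      qed
      then have "(\<Sum>a<m. lookup \<alpha> (a, c)) < (\<Sum>a<m. lookup \<gamma> (a, c))"
        using im less by (intro sum_strict_mono_ex1) (auto intro!: bexI[of _ i])
      then show False using col[OF c] by simp
    qed
  qed
  have "(\<Sum>c<n. lookup \<gamma> (i, c)) < (\<Sum>c<n. lookup \<alpha> (i, c))"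
    using le v(1) ij jn by (intro sum_strict_mono_ex1) (auto intro!: bexI[of _ j])
  then show False using row[OF im] by simp
qed

text \<open>The distinguished distribution of a good monomial: layer \<open>l\<close> takes the
  cells of height \<open>l\<close>, so its support is an antichain and
  \<open>antichain_minimal\<close> applies to it.\<close>

definition height_layer :: "(nat \<times> nat \<Rightarrow>\<^sub>0 nat) \<Rightarrow> nat \<Rightarrow> nat \<times> nat \<Rightarrow>\<^sub>0 nat" where
  "height_layer \<alpha> l = rest {v. height_in (keys \<alpha>) v = l} \<alpha>"

lemma sum_height_layers:
  assumes "good d (keys \<alpha>)"
  shows "(\<Sum>l<d. height_layer \<alpha> l) = \<alpha>"
proof (rule poly_mapping_eqI)
  fix v
  show "lookup (\<Sum>l<d. height_layer \<alpha> l) v = lookup \<alpha> v"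
    using height_in_less[OF assms, of v]
    by (auto simp: height_layer_def lookup_sum lookup_rest sum.delta in_keys_iff)
qed

text \<open>The triangularity. If \<open>\<beta>\<close> has a distribution with the same exponent,
  then it has the same margins in every layer as the distinguished one of \<open>\<alpha>\<close>;
  the layerwise inequalities of \<open>antichain_minimal\<close> add up.\<close>

lemma good_minimal:
  assumes \<alpha>: "\<alpha> \<in> good_exps d m n" and \<beta>: "keys \<beta> \<subseteq> grid m n"
    and \<kappa>: "layers_exp d m n (height_layer \<alpha>) \<in> keys (phi d (mon \<beta>))"
  shows "\<alpha> \<le> \<beta>"
proof -
  have g: "good d (keys \<alpha>)" and kX: "keys \<alpha> \<subseteq> grid m n" using \<alpha> by (auto simp: good_exps_def)
  obtain \<gamma> where \<gamma>: "\<forall>l. keys (\<gamma> l) \<subseteq> grid m n" "(\<Sum>l<d. \<gamma> l) = \<beta>"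
    "layers_exp d m n (height_layer \<alpha>) = layers_exp d m n \<gamma>"
    using keys_phi_mon[OF \<beta> \<kappa>] by blast
  have "height_layer \<alpha> l \<le> \<gamma> l" if "l < d" for l
  proof (rule antichain_minimal)
    show "keys (height_layer \<alpha> l) \<subseteq> grid m n" using kX by (auto simp: height_layer_def keys_rest)
    show "\<not> below a b" if "a \<in> keys (height_layer \<alpha> l)" "b \<in> keys (height_layer \<alpha> l)" for a b
      using that height_in_strict[OF g, of a b] by (auto simp: height_layer_def keys_rest)
  qed (use layers_margins[OF \<gamma>(3) that] in auto)
  then have "(\<Sum>l<d. height_layer \<alpha> l) \<le> (\<Sum>l<d. \<gamma> l)" by (intro sum_mono) auto
  then show ?thesis using sum_height_layers[OF g] \<gamma>(2) by simp
qed

text \<open>Look at the layered exponent of the largest exponent \<open>\<alpha>\<close> of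
  \<open>p\<close>. By \<open>good_minimal\<close> no other term of \<open>p\<close> contributes to
  the coefficient of the image there.\<close>

lemma good_independent:
  fixes p :: "(nat \<times> nat, 'k::field_char_0) mpoly"
  assumes "keys p \<subseteq> good_exps d m n" "phi d p = 0"
  shows "p = 0"
proof (rule ccontr)
  assume "p \<noteq> 0"
  then have ne: "keys p \<noteq> {}" by simp
  interpret comm_ring_hom "phi d" by (rule comm_ring_hom_phi)
  define \<alpha> where "\<alpha> = Max (keys p)"
  have \<alpha>: "\<alpha> \<in> keys p" unfolding \<alpha>_def using ne by (intro Max_in) auto
  have \<alpha>g: "\<alpha> \<in> good_exps d m n" using \<alpha> assms(1) by blast
  define \<kappa> where "\<kappa> = layers_exp d m n (height_layer \<alpha>)"
  have "lookup (phi d p) \<kappa> = (\<Sum>\<beta>\<in>keys p. lookup p \<beta> * lookup (phi d (mon \<beta>)) \<kappa>)"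
  proof -
    have "phi d p = phi d (\<Sum>\<beta>\<in>keys p. cst (lookup p \<beta>) * mon \<beta>)"
      using poly_mapping_sum_single[of p] by (simp add: mult_single)
    then show ?thesis by (simp add: hom_sum hom_mult lookup_sum lookup_single_mult)
  qed
  also have "\<dots> = (\<Sum>\<beta>\<in>keys p. if \<beta> = \<alpha> then lookup p \<alpha> * lookup (phi d (mon \<alpha>)) \<kappa> else 0)"
  proof (intro sum.cong refl)
    fix \<beta> assume \<beta>: "\<beta> \<in> keys p"
    have "lookup (phi d (mon \<beta>) :: _ \<Rightarrow>\<^sub>0 'k) \<kappa> = 0" if "\<beta> \<noteq> \<alpha>"
    proof (rule ccontr)
      assume "lookup (phi d (mon \<beta>) :: _ \<Rightarrow>\<^sub>0 'k) \<kappa> \<noteq> 0"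
      then have "\<kappa> \<in> keys (phi d (mon \<beta>) :: _ \<Rightarrow>\<^sub>0 'k)" by (simp add: in_keys_iff)
      moreover have "keys \<beta> \<subseteq> grid m n" using \<beta> assms(1) by (auto simp: good_exps_def)
      ultimately have "\<alpha> \<le> \<beta>" using good_minimal[OF \<alpha>g] unfolding \<kappa>_def by blast
      moreover have "\<beta> \<le> \<alpha>" unfolding \<alpha>_def using \<beta> by (intro Max_ge) auto
      ultimately show False using that by simp
    qed
    then show "lookup p \<beta> * lookup (phi d (mon \<beta>)) \<kappa> = (if \<beta> = \<alpha> then lookup p \<alpha> * lookup (phi d (mon \<alpha>)) \<kappa> else 0)"
      by auto
  qed
  also have "\<dots> = lookup p \<alpha> * lookup (phi d (mon \<alpha>)) \<kappa>" using \<alpha> by simp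
  also have "\<dots> \<noteq> 0"
  proof -
    have "keys (height_layer \<alpha> l) \<subseteq> grid m n" for l
      using \<alpha>g by (auto simp: height_layer_def keys_rest good_exps_def)
    then have "lookup (phi d (mon (\<Sum>l<d. height_layer \<alpha> l)) :: _ \<Rightarrow>\<^sub>0 'k) \<kappa> \<noteq> 0"
      unfolding \<kappa>_def by (rule phi_mon_layers_nonzero)
    moreover have "(\<Sum>l<d. height_layer \<alpha> l) = \<alpha>" using \<alpha>g by (intro sum_height_layers) (simp add: good_exps_def)
    ultimately show ?thesis using \<alpha> by (simp add: in_keys_iff)
  qed
  finally show False using assms(2) by simp
qed

lemma span_mon_keys: "r \<in> mp.span (mon ` G) \<Longrightarrow> keys (r :: ('v, 'k::field) mpoly) \<subseteq> G"
proof (induction rule: mp.span_induct_alt)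
  case (step c x y)
  obtain \<mu> where "\<mu> \<in> G" "x = mon \<mu>" using step(1) by blast
  then have "keys (cst c * x) \<subseteq> G" by (simp add: mult_single)
  then show ?case using step(2) Poly_Mapping.keys_add[of "cst c * x" y] by blast
qed simp

lemma phi_gen_minors: "p \<in> idg (gen_minors (d + 1) m n) \<Longrightarrow> phi d p = 0"
proof (induction rule: idg_induct)
  case zero
  interpret comm_ring_hom "phi d" by (rule comm_ring_hom_phi)
  show ?case by simp
next
  case (step b g x)
  interpret comm_ring_hom "phi d" by (rule comm_ring_hom_phi)
  have "phi d g = 0" using step(1) phi_sminor unfolding gen_minors_def by blast
  then show ?case using step(2) by (simp add: hom_add hom_mult)
qed

lemma straighten_poly:
  fixes p :: "(nat \<times> nat, 'k::field) mpoly"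
  assumes "p \<in> polys (grid m n)"
  shows "\<exists>r. keys r \<subseteq> good_exps d m n \<and> p - r \<in> idg (gen_minors (d + 1) m n)"
  using assms
proof (induction p rule: polys_lin_induct)
  case zero
  show ?case by (intro exI[of _ 0]) (simp add: idl.span_zero)
next
  case (single \<mu> c)
  from straighten[OF single, where 'k = 'k and d = d] obtain r where
    r: "r \<in> mp.span (mon ` {\<beta> \<in> good_exps d m n. tdeg \<beta> = tdeg \<mu>})"
      "(mon \<mu> :: (nat \<times> nat, 'k) mpoly) - r \<in> idg (gen_minors (d + 1) m n)"
    by blast
  have "cst c * r \<in> mp.span (mon ` {\<beta> \<in> good_exps d m n. tdeg \<beta> = tdeg \<mu>})"
    by (rule mp.span_scale[OF r(1)])
  then have "keys (cst c * r) \<subseteq> good_exps d m n" using span_mon_keys by blast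
  moreover have "cst c * (mon \<mu> - r) \<in> idg (gen_minors (d + 1) m n)" by (rule idg_mult[OF r(2)])
  moreover have "cst c * (mon \<mu> - r) = single \<mu> c - cst c * r"
    unfolding right_diff_distrib by (simp add: mult_single)
  ultimately show ?case by (intro exI[of _ "cst c * r"]) simp
next
  case (add p q)
  then obtain r s where "keys r \<subseteq> good_exps d m n" "p - r \<in> idg (gen_minors (d + 1) m n)"
    "keys s \<subseteq> good_exps d m n" "q - s \<in> idg (gen_minors (d + 1) m n)" by blast
  moreover from this have "(p - r) + (q - s) \<in> idg (gen_minors (d + 1) m n)" by (intro idl.span_add)
  ultimately show ?case using Poly_Mapping.keys_add[of r s]
    by (intro exI[of _ "r + s"] conjI) (auto simp only: add_diff_add subset_iff Un_iff)
qed

text \<open>The second fundamental theorem for the general linear group.\<close>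

lemma ker_phi:
  fixes p :: "(nat \<times> nat, 'k::field_char_0) mpoly"
  assumes "p \<in> polys (grid m n)" "phi d p = 0"
  shows "p \<in> idg (gen_minors (d + 1) m n)"
proof -
  interpret comm_ring_hom "phi d" by (rule comm_ring_hom_phi)
  obtain r where r: "keys r \<subseteq> good_exps d m n" "p - r \<in> idg (gen_minors (d + 1) m n)"
    using straighten_poly[OF assms(1), of d] by blast
  have "phi d p - phi d r = 0" using phi_gen_minors[OF r(2)] by (simp add: hom_minus)
  then have "phi d r = 0" using assms(2) by simp
  then have "r = 0" by (rule good_independent[OF r(1)])
  then show ?thesis using r(2) by simp
qed

text \<open>Straightening preserves the degree. The weaker bound \<open>2 * tdeg \<mu>\<close> is
  the form of \<open>independent_le_growth\<close>, which also has to serve the weights of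
  \<open>exists_indep_set\<close>.\<close>

lemma phi_mon_span:
  assumes "keys \<mu> \<subseteq> grid m n"
  shows "(phi d (mon \<mu>) :: _ \<Rightarrow>\<^sub>0 'k::field) \<in>
    mp.span ((\<lambda>\<nu>. phi d (mon \<nu>)) ` {\<nu> \<in> good_exps d m n. tdeg \<nu> \<le> 2 * tdeg \<mu>})"
proof -
  interpret comm_ring_hom "phi d" by (rule comm_ring_hom_phi)
  let ?G = "{\<beta> \<in> good_exps d m n. tdeg \<beta> = tdeg \<mu>}"
  let ?S = "mp.span ((\<lambda>\<nu>. phi d (mon \<nu>) :: _ \<Rightarrow>\<^sub>0 'k) ` {\<nu> \<in> good_exps d m n. tdeg \<nu> \<le> 2 * tdeg \<mu>})"
  from straighten[OF assms, where 'k = 'k and d = d] obtain r where r: "r \<in> mp.span (mon ` ?G)"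
      "(mon \<mu> :: (nat \<times> nat, 'k) mpoly) - r \<in> idg (gen_minors (d + 1) m n)"
    by blast
  have "phi d r \<in> ?S" using r(1)
  proof (induction rule: mp.span_induct_alt)
    case base
    show ?case by (simp add: mp.span_zero)
  next
    case (step c x y)
    then have "phi d x \<in> ?S" by (auto intro!: mp.span_base imageI)
    then have "cst c * phi d x + phi d y \<in> ?S" by (intro mp.span_add mp.span_scale step(2))
    then show ?case by (simp only: hom_add hom_mult phi_cst)
  qed
  moreover have "phi d (mon \<mu>) - phi d r = 0" using phi_gen_minors[OF r(2)] by (simp add: hom_minus)
  ultimately show ?thesis by simp
qed

text \<open>The growth bound with \<open>c = 1\<close> and \<open>Z\<close> the support: a good
  exponent is zero off its support, whose size \<open>card_good_le\<close> bounds.\<close>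

lemma indep_phi_card_le:
  assumes U: "U \<subseteq> grid m n"
    and ind: "\<And>p :: (nat \<times> nat, 'k::field) mpoly. p \<in> polys U \<Longrightarrow> phi d p = 0 \<Longrightarrow> p = 0"
  shows "card U \<le> card {v \<in> grid m n. fst v < d \<or> snd v < d}"
proof -
  have fU: "finite U" using U by (rule finite_subset) auto
  obtain u where u: "bij_betw u {..<card U} U"
    using ex_bij_betw_nat_finite[OF fU] by (auto simp: atLeast0LessThan)
  show ?thesis
  proof (rule independent_le_growth[where \<Phi> = "phi d :: _ \<Rightarrow> _ \<Rightarrow>\<^sub>0 'k" and X = "grid m n"
        and T = "good_exps d m n" and c = 1 and h = "\<lambda>i. vr (u i)", OF comm_ring_hom_phi])
    show "keys \<nu> \<subseteq> grid m n \<and> (\<exists>Z\<subseteq>grid m n. card Z \<le> card {v \<in> grid m n. fst v < d \<or> snd v < d} \<and>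
        (\<forall>v\<in>grid m n - Z. lookup \<nu> v < 1))" if "\<nu> \<in> good_exps d m n" for \<nu>
      using that card_good_le[of d "keys \<nu>" m n]
      by (intro conjI exI[of _ "keys \<nu>"]) (auto simp: good_exps_def in_keys_iff)
    show "vr (u i) \<in> polys (grid m n)" if "i < card U" for i
      using u that U by (auto simp: bij_betw_def)
    fix H :: "(nat, 'k) mpoly"
    assume H: "H \<in> polys {..<card U}" "phi d (ev cst (\<lambda>i. vr (u i)) H) = 0"
    have "ev cst (\<lambda>i. vr (u i)) H \<in> polys U"
      using H(1) by (rule ev_in_polys) (use u in \<open>auto simp: bij_betw_def\<close>)
    then have "ev cst (\<lambda>i. vr (u i)) H = 0" using H(2) by (rule ind)
    then show "H = 0" using u H(1) by (intro rename_zero[of u "{..<card U}"]) (auto simp: bij_betw_def)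
  qed (simp_all add: phi_mon_span)
qed

section \<open>The Fischer inner product\<close>

definition exp_fact :: "('v \<Rightarrow>\<^sub>0 nat) \<Rightarrow> rat" where
  "exp_fact \<mu> = (\<Prod>v\<in>keys \<mu>. fact (lookup \<mu> v))"

lemma exp_fact_pos: "0 < exp_fact \<mu>"
  unfolding exp_fact_def by (intro prod_pos) simp

lemma exp_fact_Suc: "exp_fact (single v (Suc 0) + \<mu>) = of_nat (Suc (lookup \<mu> v)) * exp_fact \<mu>"
proof -
  let ?A = "insert v (keys \<mu>)"
  have sup: "exp_fact \<nu> = (\<Prod>w\<in>?A. fact (lookup \<nu> w))" if "keys \<nu> \<subseteq> ?A" for \<nu>
    unfolding exp_fact_def using that by (intro prod.mono_neutral_left) (auto simp: in_keys_iff)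
  have "exp_fact (single v (Suc 0) + \<mu>) = (\<Prod>w\<in>?A. (if w = v then of_nat (Suc (lookup \<mu> v)) else 1) * fact (lookup \<mu> w))"
    by (subst sup) (auto simp: keys_add_nat lookup_add lookup_single when_def intro!: prod.cong)
  also have "\<dots> = of_nat (Suc (lookup \<mu> v)) * exp_fact \<mu>"
    by (subst sup[of \<mu>]) (simp_all only: prod.distrib subset_insertI prod.delta finite_insert finite_keys insertI1 if_True)
  finally show ?thesis .
qed

text \<open>Distinct monomials are orthogonal, and the factor \<open>exp_fact \<mu>\<close> is what
  makes differentiation adjoint to multiplication by a variable. Rational coefficients are chosen
  for definiteness.\<close>

definition fischer :: "(('v, rat) mpoly) \<Rightarrow> (('v, rat) mpoly) \<Rightarrow> rat" where
  "fischer p q = (\<Sum>\<mu>\<in>keys p. lookup p \<mu> * (lookup q \<mu> * exp_fact \<mu>))"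

lemma fischer_superset: "finite A \<Longrightarrow> keys p \<subseteq> A \<Longrightarrow> fischer p q = (\<Sum>\<mu>\<in>A. lookup p \<mu> * (lookup q \<mu> * exp_fact \<mu>))"
  unfolding fischer_def by (rule sum.mono_neutral_left) (auto simp: in_keys_iff)

lemma fischer_add_left: "fischer (p + p') q = fischer p q + fischer p' q"
proof -
  let ?A = "keys p \<union> keys p'"
  have "fischer (p + p') q = (\<Sum>\<mu>\<in>?A. lookup (p + p') \<mu> * (lookup q \<mu> * exp_fact \<mu>))"
    using Poly_Mapping.keys_add[of p p'] by (intro fischer_superset) auto
  then show ?thesis
    by (simp add: fischer_superset[of ?A] lookup_add distrib_right sum.distrib)
qed

lemma fischer_commute: "fischer p q = fischer q p"
proof -
  let ?A = "keys p \<union> keys q"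
  have "fischer p q = (\<Sum>\<mu>\<in>?A. lookup p \<mu> * (lookup q \<mu> * exp_fact \<mu>))"
    by (rule fischer_superset) auto
  also have "\<dots> = (\<Sum>\<mu>\<in>?A. lookup q \<mu> * (lookup p \<mu> * exp_fact \<mu>))"
    by (intro sum.cong refl mult.left_commute)
  also have "\<dots> = fischer q p"
    by (rule fischer_superset[symmetric]) auto
  finally show ?thesis .
qed

lemma fischer_single: "fischer (single \<mu> c) q = c * (lookup q \<mu> * exp_fact \<mu>)"
  by (cases "c = 0") (simp_all add: fischer_def)

lemma fischer_scale_left: "fischer (cst c * p) q = c * fischer p q"
proof -
  have "fischer (cst c * p) q = (\<Sum>\<mu>\<in>keys p. lookup (cst c * p) \<mu> * (lookup q \<mu> * exp_fact \<mu>))"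
  proof (rule fischer_superset)
    show "keys (cst c * p) \<subseteq> keys p"
    proof
      fix x assume "x \<in> keys (cst c * p)"
      then show "x \<in> keys p" unfolding in_keys_iff lookup_single_mult by (metis mult_zero_right)
    qed
  qed simp
  then show ?thesis by (simp only: lookup_single_mult fischer_def sum_distrib_left mult.assoc)
qed

lemma fischer_zero [simp]: "fischer 0 q = 0"
  by (simp add: fischer_def)

lemma fischer_minus_left: "fischer (- p) q = - fischer p q"
  using fischer_add_left[of p "- p" q] by simp

lemma fischer_diff_left: "fischer (p - p') q = fischer p q - fischer p' q"
  using fischer_add_left[of p "- p'" q] by (simp add: fischer_minus_left)

lemma fischer_add_right: "fischer p (q + q') = fischer p q + fischer p q'"
  using fischer_add_left[of q q' p] by (simp add: fischer_commute)

lemma fischer_scale_right: "fischer p (cst c * q) = c * fischer p q"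
  using fischer_scale_left[of c q p] by (simp add: fischer_commute)

lemma fischer_sum_left: "fischer (sum f A) q = (\<Sum>a\<in>A. fischer (f a) q)"
  by (induction A rule: infinite_finite_induct) (simp_all add: fischer_add_left)

lemma fischer_sum_right: "fischer q (sum f A) = (\<Sum>a\<in>A. fischer q (f a))"
  using fischer_sum_left[of f A q] by (simp add: fischer_commute)

lemma fischer_definite: "fischer p p = 0 \<Longrightarrow> p = 0"
proof (rule ccontr)
  assume 0: "fischer p p = 0" and "p \<noteq> 0"
  then obtain \<mu> where \<mu>: "\<mu> \<in> keys p" using keys_eq_empty by blast
  have "0 < fischer p p"
    unfolding fischer_def
  proof (rule sum_pos2[OF _ \<mu>])
    have "0 < (lookup p \<mu>)\<^sup>2" using \<mu> by (simp add: in_keys_iff)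
    then have "0 < (lookup p \<mu>)\<^sup>2 * exp_fact \<mu>" using exp_fact_pos by (rule mult_pos_pos)
    then show "0 < lookup p \<mu> * (lookup p \<mu> * exp_fact \<mu>)"
      unfolding power2_eq_square mult.assoc .
    show "0 \<le> lookup p i * (lookup p i * exp_fact i)" for i
      unfolding mult.assoc[symmetric]
      by (rule mult_nonneg_nonneg[OF zero_le_square less_imp_le[OF exp_fact_pos]])
  qed simp
  then show False using 0 by simp
qed

section \<open>Partial derivatives and adjointness\<close>

definition pdiff :: "'v \<Rightarrow> (('v, rat) mpoly) \<Rightarrow> (('v, rat) mpoly)" where
  "pdiff v q = Poly_Mapping.mapp (\<lambda>\<mu> c. of_nat (Suc (lookup \<mu> v)) * c)
     (Poly_Mapping.map_key ((+) (single v (Suc 0))) q)"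

lemma lookup_pdiff: "lookup (pdiff v q) \<mu> = of_nat (Suc (lookup \<mu> v)) * lookup q (single v (Suc 0) + \<mu>)"
proof -
  have k: "lookup (Poly_Mapping.map_key ((+) (single v (Suc 0))) q) \<mu> = lookup q (single v (Suc 0) + \<mu>)"
    by (simp add: Poly_Mapping.map_key.rep_eq)
  show ?thesis unfolding pdiff_def lookup_mapp k by (simp add: when_def in_keys_iff k)
qed

lemma pdiff_add: "pdiff v (p + q) = pdiff v p + pdiff v q"
  by (rule poly_mapping_eqI) (simp only: lookup_pdiff lookup_add distrib_left)

lemma pdiff_zero [simp]: "pdiff v 0 = 0"
  by (rule poly_mapping_eqI) (simp add: lookup_pdiff)

lemma pdiff_sum: "pdiff v (sum f A) = (\<Sum>a\<in>A. pdiff v (f a))"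
  by (induction A rule: infinite_finite_induct) (simp_all add: pdiff_add)

lemma pdiff_scale: "pdiff v (cst c * p) = cst c * pdiff v p"
  by (rule poly_mapping_eqI) (simp only: lookup_pdiff lookup_single_mult mult.left_commute)

text \<open>If \<open>v\<close> does not occur in \<open>\<mu>\<close>, the truncated difference of
  exponents is meaningless, but then the coefficient is 0.\<close>

lemma pdiff_single: "pdiff v (single \<mu> c) = single (\<mu> - single v (Suc 0)) (of_nat (lookup \<mu> v) * c)"
proof (rule poly_mapping_eqI)
  fix \<nu>
  show "lookup (pdiff v (single \<mu> c)) \<nu> = lookup (single (\<mu> - single v (Suc 0)) (of_nat (lookup \<mu> v) * c)) \<nu>"
  proof (cases "lookup \<mu> v = 0")
    case True
    then have "\<mu> \<noteq> single v (Suc 0) + \<nu>" by (auto simp: lookup_add)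
    then show ?thesis using True by (simp add: lookup_pdiff lookup_single when_def)
  next
    case False
    have "\<mu> = single v (Suc 0) + \<nu> \<longleftrightarrow> \<mu> - single v (Suc 0) = \<nu>"
    proof
      assume "\<mu> - single v (Suc 0) = \<nu>"
      then show "\<mu> = single v (Suc 0) + \<nu>" using False
        by (auto intro!: poly_mapping_eqI simp: lookup_add lookup_minus lookup_single when_def)
    qed simp
    then have *: "\<mu> - single v (Suc 0) = \<nu> \<longleftrightarrow> \<mu> = single v (Suc 0) + \<nu>" by simp
    show ?thesis
    proof (cases "\<mu> = single v (Suc 0) + \<nu>")
      case True
      then have "lookup \<mu> v = Suc (lookup \<nu> v)" by (simp add: lookup_add)
      moreover have "\<mu> - single v (Suc 0) = \<nu>" using * True by blast
      ultimately show ?thesis by (simp only: lookup_pdiff True[symmetric] lookup_single_eq)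
    next
      case False
      then show ?thesis unfolding lookup_pdiff lookup_single * when_def by simp
    qed
  qed
qed

lemma pdiff_mult: "pdiff v (p * q) = pdiff v p * q + p * pdiff v q"
proof (induction p rule: pm_induct)
  case (single \<mu> c)
  show ?case
  proof (induction q rule: pm_induct)
    case (single \<nu> e)
    have 1: "single (\<mu> - single v (Suc 0) + \<nu>) (of_nat (lookup \<mu> v) * c * e) = single (\<mu> + \<nu> - single v (Suc 0)) (of_nat (lookup \<mu> v) * c * e)"
    proof (cases "lookup \<mu> v = 0")
      case False
      then have "\<mu> - single v (Suc 0) + \<nu> = \<mu> + \<nu> - single v (Suc 0)"
        by (intro poly_mapping_eqI) (auto simp: lookup_add lookup_minus lookup_single when_def)
      then show ?thesis by simp
    qed simp
    have 2: "single (\<mu> + (\<nu> - single v (Suc 0))) (c * (of_nat (lookup \<nu> v) * e)) = single (\<mu> + \<nu> - single v (Suc 0)) (c * (of_nat (lookup \<nu> v) * e))"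
    proof (cases "lookup \<nu> v = 0")
      case False
      then have "\<mu> + (\<nu> - single v (Suc 0)) = \<mu> + \<nu> - single v (Suc 0)"
        by (intro poly_mapping_eqI) (auto simp: lookup_add lookup_minus lookup_single when_def)
      then show ?thesis by simp
    qed simp
    show ?case unfolding pdiff_single mult_single 1 2 single_add[symmetric]
      unfolding lookup_add of_nat_add distrib_right by (simp only: mult_ac)
  next
    case (add p q)
    then show ?case by (simp only: distrib_left pdiff_add add_ac)
  qed simp
next
  case (add p q')
  then show ?case by (simp only: distrib_right pdiff_add add_ac)
qed simp

lemma fischer_adjoint: "fischer (vr v * p) q = fischer p (pdiff v q)"
proof (induction p rule: pm_induct)
  case (single \<mu> c)
  show ?case
    unfolding mult_single fischer_single lookup_pdiff exp_fact_Suc mult_1 by (simp only: mult_ac)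
qed (simp_all add: distrib_left fischer_add_left)

lemma pdiff_vr: "pdiff v (vr w) = (if v = w then 1 else 0)"
  by (auto simp: pdiff_single lookup_single when_def)

text \<open>One Gram-Schmidt step per element: \<open>g\<close> is first made orthogonal to the span
  of \<open>F\<close>, then the component of \<open>p - b1\<close> along the result is
  removed.\<close>

lemma fischer_projection:
  assumes "finite F"
  shows "\<exists>b. b \<in> mp.span F \<and> (\<forall>f\<in>F. fischer (p - b) f = 0)"
  using assms
proof (induction F arbitrary: p rule: finite_induct)
  case empty
  show ?case by (intro exI[of _ 0]) (simp add: mp.span_zero)
next
  case (insert g F)
  obtain b0 where b0: "b0 \<in> mp.span F" "\<forall>f\<in>F. fischer (g - b0) f = 0" using insert.IH by blast
  obtain b1 where b1: "b1 \<in> mp.span F" "\<forall>f\<in>F. fischer (p - b1) f = 0" using insert.IH by blast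
  have perp: "fischer x y = 0" if "\<forall>f\<in>F. fischer x f = 0" "y \<in> mp.span F" for x y
    using that(2)
    by (induction rule: mp.span_induct_alt)
      (use that(1) in \<open>simp_all add: fischer_add_right fischer_scale_right fischer_commute[of x 0]\<close>)
  let ?g = "g - b0"
  \<comment> \<open>If \<open>?g\<close> has norm 0 it vanishes by definiteness, and the value of
    this quotient has no effect.\<close>
  define c where "c = fischer (p - b1) ?g / fischer ?g ?g"
  have sub: "mp.span F \<subseteq> mp.span (insert g F)" by (rule mp.span_mono) auto
  have g: "?g \<in> mp.span (insert g F)"
    using sub b0(1) mp.span_base[of g "insert g F"] by (intro mp.span_diff) auto
  let ?b = "b1 + cst c * ?g"
  have eq: "fischer (p - ?b) f = fischer (p - b1) f - c * fischer ?g f" for f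
    unfolding diff_diff_add[symmetric] fischer_diff_left[of "p - b1"] fischer_scale_left ..
  have "fischer (p - ?b) f = 0" if "f \<in> F" for f using that b0(2) b1(2) by (simp add: eq)
  moreover have "fischer (p - ?b) g = 0"
  proof -
    have "fischer (p - ?b) b0 = 0" by (rule perp[OF _ b0(1)]) (use calculation in blast)
    moreover have "fischer (p - ?b) ?g = 0"
    proof (cases "fischer ?g ?g = 0")
      case True
      then have "?g = 0" by (rule fischer_definite)
      then show ?thesis by (simp add: fischer_commute[of _ 0])
    next
      case False
      then show ?thesis unfolding eq by (simp add: c_def)
    qed
    moreover have "g = ?g + b0" by simp
    ultimately show ?thesis using fischer_add_right[of "p - ?b" ?g b0] by simp
  qed
  moreover have "?b \<in> mp.span (insert g F)" using sub b1(1) g by (intro mp.span_add mp.span_scale) auto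
  ultimately show ?case by blast
qed

lemma pdiff_edge_poly:
  shows "pdiff (Inl i, l) (edge_poly d v) = (if i = fst v \<and> l < d then vr (Inr (snd v), l) else 0)"
    and "pdiff (Inr j, l) (edge_poly d v) = (if j = snd v \<and> l < d then vr (Inl (fst v), l) else 0)"
proof -
  have "pdiff (Inl i, l) (edge_poly d v) = (\<Sum>k<d. if k = l then (if i = fst v then vr (Inr (snd v), l) else 0) else 0)"
    unfolding edge_poly_def pdiff_sum pdiff_mult pdiff_vr by (intro sum.cong) auto
  then show "pdiff (Inl i, l) (edge_poly d v) = (if i = fst v \<and> l < d then vr (Inr (snd v), l) else 0)"
    by (simp add: sum.delta)
  have "pdiff (Inr j, l) (edge_poly d v) = (\<Sum>k<d. if k = l then (if j = snd v then vr (Inl (fst v), l) else 0) else 0)"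
    unfolding edge_poly_def pdiff_sum pdiff_mult pdiff_vr by (intro sum.cong) auto
  then show "pdiff (Inr j, l) (edge_poly d v) = (if j = snd v \<and> l < d then vr (Inl (fst v), l) else 0)"
    by (simp add: sum.delta)
qed

text \<open>\<open>polar\<close> replaces the variables of one vertex by those of another vertex, one factor at a
  time; \<open>lap\<close> is the adjoint of multiplication by \<open>edge_poly\<close>.\<close>

definition polar :: "nat \<Rightarrow> nat + nat \<Rightarrow> nat + nat \<Rightarrow> (((nat + nat) \<times> nat, rat) mpoly) \<Rightarrow> ((nat + nat) \<times> nat, rat) mpoly" where
  "polar d u w h = (\<Sum>l<d. vr (w, l) * pdiff (u, l) h)"

definition lap :: "nat \<Rightarrow> nat \<Rightarrow> nat \<Rightarrow> (((nat + nat) \<times> nat, rat) mpoly) \<Rightarrow> ((nat + nat) \<times> nat, rat) mpoly" where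
  "lap d i j h = (\<Sum>l<d. pdiff (Inr j, l) (pdiff (Inl i, l) h))"

lemma polar_add: "polar d u w (p + q) = polar d u w p + polar d u w q"
  unfolding polar_def pdiff_add distrib_left sum.distrib ..

lemma polar_mult: "polar d u w (p * q) = polar d u w p * q + p * polar d u w q"
  unfolding polar_def pdiff_mult distrib_left sum.distrib sum_distrib_left sum_distrib_right
  by (intro arg_cong2[where f = "(+)"] sum.cong refl) (simp_all only: mult_ac)

lemma polar_cst: "polar d u w (cst c) = 0"
  unfolding polar_def by (simp add: pdiff_single)

lemma polar_edge_poly:
  "polar d (Inl i) (Inl a) (edge_poly d v) = (if i = fst v then edge_poly d (a, snd v) else 0)"
  "polar d (Inr j) (Inr b) (edge_poly d v) = (if j = snd v then edge_poly d (fst v, b) else 0)"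
proof -
  show "polar d (Inl i) (Inl a) (edge_poly d v) = (if i = fst v then edge_poly d (a, snd v) else 0)"
    unfolding polar_def pdiff_edge_poly by (auto simp: edge_poly_def intro!: sum.cong)
  show "polar d (Inr j) (Inr b) (edge_poly d v) = (if j = snd v then edge_poly d (fst v, b) else 0)"
    unfolding polar_def pdiff_edge_poly
    by (auto intro!: sum.cong simp: edge_poly_def mult.commute[of "vr (Inr b, _)"])
qed

lemma lap_add: "lap d i j (p + q) = lap d i j p + lap d i j q"
  unfolding lap_def pdiff_add sum.distrib ..

lemma lap_scale: "lap d i j (cst c * p) = cst c * lap d i j p"
  unfolding lap_def pdiff_scale sum_distrib_left ..

text \<open>The product rule for a second-order operator, ordered by how many derivatives fall on
  the edge polynomial: two give copies of \<open>h\<close>, one gives a polarization of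
  \<open>h\<close>, none gives the last summand.\<close>

lemma lap_edge_mult:
  "lap d i j (edge_poly d v * h) =
     (if i = fst v \<and> j = snd v then (\<Sum>l<d. h) else 0) +
     (if i = fst v then polar d (Inr j) (Inr (snd v)) h else 0) +
     (if j = snd v then polar d (Inl i) (Inl (fst v)) h else 0) + edge_poly d v * lap d i j h"
proof -
  let ?f = "edge_poly d v"
  have "pdiff (Inr j, l) (pdiff (Inl i, l) (?f * h)) =
     (if i = fst v \<and> j = snd v then h else 0) +
     (if i = fst v then vr (Inr (snd v), l) * pdiff (Inr j, l) h else 0) +
     (if j = snd v then vr (Inl (fst v), l) * pdiff (Inl i, l) h else 0) +
     ?f * pdiff (Inr j, l) (pdiff (Inl i, l) h)" if l: "l < d" for l
  proof -
    have "pdiff (Inl i, l) (?f * h) = (if i = fst v then vr (Inr (snd v), l) else 0) * h + ?f * pdiff (Inl i, l) h"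
      using l by (simp add: pdiff_mult pdiff_edge_poly)
    moreover have "pdiff (Inr j, l) ((if i = fst v then vr (Inr (snd v), l) else 0) * h) =
      (if i = fst v \<and> j = snd v then h else 0) + (if i = fst v then vr (Inr (snd v), l) * pdiff (Inr j, l) h else 0)"
      by (simp add: pdiff_mult pdiff_vr)
    moreover have "pdiff (Inr j, l) (?f * pdiff (Inl i, l) h) =
      (if j = snd v then vr (Inl (fst v), l) * pdiff (Inl i, l) h else 0) + ?f * pdiff (Inr j, l) (pdiff (Inl i, l) h)"
      using l by (simp add: pdiff_mult pdiff_edge_poly)
    ultimately show ?thesis by (simp only: pdiff_add add.assoc)
  qed
  then have "lap d i j (?f * h) = (\<Sum>l<d. (if i = fst v \<and> j = snd v then h else 0) +
     (if i = fst v then vr (Inr (snd v), l) * pdiff (Inr j, l) h else 0) +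
     (if j = snd v then vr (Inl (fst v), l) * pdiff (Inl i, l) h else 0) +
     ?f * pdiff (Inr j, l) (pdiff (Inl i, l) h))"
    unfolding lap_def by (intro sum.cong) auto
  also have "\<dots> = (\<Sum>l<d. (if i = fst v \<and> j = snd v then h else 0)) +
     (\<Sum>l<d. (if i = fst v then vr (Inr (snd v), l) * pdiff (Inr j, l) h else 0)) +
     (\<Sum>l<d. (if j = snd v then vr (Inl (fst v), l) * pdiff (Inl i, l) h else 0)) + ?f * lap d i j h"
    unfolding lap_def sum_distrib_left sum.distrib ..
  finally show ?thesis unfolding polar_def by (simp only: if_distrib[of "sum _"] sum.neutral_const cong: if_cong split: if_split) auto
qed

lemma fischer_edge_adjoint: "fischer (edge_poly d (i, j) * p) q = fischer p (lap d i j q)"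
proof -
  have "fischer (edge_poly d (i, j) * p) q = (\<Sum>l<d. fischer (vr (Inl i, l) * (vr (Inr j, l) * p)) q)"
    unfolding edge_poly_def sum_distrib_right fischer_sum_left by (simp only: fst_conv snd_conv mult.assoc)
  then show ?thesis by (simp only: fischer_adjoint lap_def fischer_sum_right)
qed

section \<open>The ring generated by the edge polynomials and the retraction onto it\<close>

context
  fixes d m n :: nat
begin

definition im :: "(((nat + nat) \<times> nat, 'k::field) mpoly) set" where
  "im = phi d ` polys (grid m n)"

interpretation phi: comm_ring_hom "phi d" by (rule comm_ring_hom_phi)

lemma im_add: "p \<in> im \<Longrightarrow> q \<in> im \<Longrightarrow> p + q \<in> im"
  unfolding im_def using polys_add by (fastforce simp: phi.hom_add[symmetric])

lemma im_mult: "p \<in> im \<Longrightarrow> q \<in> im \<Longrightarrow> p * q \<in> im"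
  unfolding im_def using polys_mult by (fastforce simp: phi.hom_mult[symmetric])

lemma im_edge: "v \<in> grid m n \<Longrightarrow> edge_poly d v \<in> im"
  unfolding im_def by (rule image_eqI[of _ _ "vr v"]) auto

lemma im_cst: "cst c \<in> im"
  unfolding im_def by (rule image_eqI[of _ _ "cst c"]) auto

lemma im_zero: "0 \<in> im"
  using im_cst[of 0] by simp

lemma im_diff: "p \<in> im \<Longrightarrow> q \<in> im \<Longrightarrow> p - q \<in> im"
  unfolding im_def using polys_diff by (fastforce simp: phi.hom_minus[symmetric])

lemma im_sum: "(\<And>a. a \<in> A \<Longrightarrow> f a \<in> im) \<Longrightarrow> sum f A \<in> im"
  by (induction A rule: infinite_finite_induct) (auto intro: im_zero im_add)

lemma im_span: "b \<in> mp.span F \<Longrightarrow> F \<subseteq> im \<Longrightarrow> b \<in> im"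
  by (induction rule: mp.span_induct_alt) (auto intro: im_zero im_add im_mult im_cst)

text \<open>\<open>polar\<close> is a derivation that sends an edge polynomial to an edge polynomial
  or to 0; the bounds on \<open>a\<close> and \<open>b\<close> keep the new cell inside the
  grid.\<close>

lemma polar_im:
  assumes "h \<in> im" "(\<exists>i a. u = Inl i \<and> w = Inl a \<and> a < m) \<or> (\<exists>j b. u = Inr j \<and> w = Inr b \<and> b < n)"
  shows "polar d u w h \<in> im"
proof -
  obtain p where p: "p \<in> polys (grid m n)" "h = phi d p" using assms(1) by (auto simp: im_def)
  have "phi d p \<in> im \<and> polar d u w (phi d p) \<in> im" using p(1)
  proof (induction p rule: polys_induct)
    case (const c)
    then show ?case by (simp add: polar_cst im_zero im_cst)
  next
    case (var v)
    have "polar d u w (edge_poly d v) \<in> im"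
      using assms(2) var by (auto simp: polar_edge_poly im_zero intro!: im_edge)
    then show ?case using im_edge[OF var] by simp
  next
    case (add p q)
    then show ?case by (simp add: phi.hom_add polar_add im_add)
  next
    case (mult p q)
    then show ?case by (simp add: phi.hom_mult polar_mult im_add im_mult)
  qed
  then show ?thesis using p(2) by simp
qed

text \<open>\<open>lap\<close> is not a derivation, so the induction runs over monomials: for one
  more edge factor, \<open>lap_edge_mult\<close> expresses the result by polarizations and by
  \<open>lap\<close> of the shorter monomial.\<close>

lemma lap_im:
  assumes "h \<in> im" shows "lap d i j h \<in> im"
proof -
  have mon: "(phi d (mon \<mu>) :: _ \<Rightarrow>\<^sub>0 rat) \<in> im \<and> lap d i j (phi d (mon \<mu>)) \<in> im" if "keys \<mu> \<subseteq> grid m n" for \<mu>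
    using that
  proof (induction \<mu> rule: exp_induct_on)
    case zero
    have "lap d i j 1 = 0"
      unfolding lap_def by (simp add: pdiff_single single_one[symmetric] del: single_one)
    then show ?case using im_cst[of 1] im_zero by simp
  next
    case (add v \<mu>)
    have "phi d (mon (single v (Suc 0) + \<mu>)) = (edge_poly d v * phi d (mon \<mu>) :: _ \<Rightarrow>\<^sub>0 rat)"
      by (simp add: mon_add phi.hom_mult)
    moreover have "(edge_poly d v * phi d (mon \<mu>) :: _ \<Rightarrow>\<^sub>0 rat) \<in> im"
      using add.IH im_edge[OF add.hyps(1)] by (intro im_mult) auto
    moreover have "lap d i j (edge_poly d v * phi d (mon \<mu>)) \<in> im"
      unfolding lap_edge_mult using add.IH add.hyps(1)
      by (intro im_add im_mult im_edge) (auto simp del: sum_constant intro!: im_sum polar_im im_zero)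
    ultimately show ?case by simp
  qed
  obtain p where p: "p \<in> polys (grid m n)" "h = phi d p" using assms(1) by (auto simp: im_def)
  have "lap d i j (phi d p) \<in> im" using p(1)
  proof (induction p rule: polys_lin_induct)
    case zero
    then show ?case by (simp add: lap_def im_zero)
  next
    case (single \<mu> c)
    have "phi d (single \<mu> c) = cst c * phi d (mon \<mu>)"
      using phi.hom_mult[of "cst c" "mon \<mu>"] by (simp add: mult_single)
    then show ?case using mon[OF single] by (simp add: lap_scale im_mult im_cst)
  next
    case (add p q)
    then show ?case by (simp add: phi.hom_add lap_add im_add)
  qed
  then show ?thesis using p(2) by simp
qed

end

lemma tdeg_phi_mon:
  assumes "\<kappa> \<in> keys (phi d (mon \<beta>) :: _ \<Rightarrow>\<^sub>0 'c::comm_ring_1)"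
  shows "tdeg \<kappa> = 2 * tdeg \<beta>"
  using assms
proof (induction \<beta> arbitrary: \<kappa> rule: exp_induct)
  case zero
  interpret comm_ring_hom "phi d" by (rule comm_ring_hom_phi)
  show ?case using zero by simp
next
  case (add v \<mu>)
  interpret comm_ring_hom "phi d" by (rule comm_ring_hom_phi)
  have "(phi d (mon (single v (Suc 0) + \<mu>)) :: _ \<Rightarrow>\<^sub>0 'c) = edge_poly d v * phi d (mon \<mu>)"
    by (simp add: mon_add hom_mult)
  then have "\<kappa> \<in> keys (edge_poly d v * phi d (mon \<mu>) :: _ \<Rightarrow>\<^sub>0 'c)" using add.prems by (simp only:)
  from subsetD[OF keys_mult this]
  obtain a b where ab: "\<kappa> = a + b" "a \<in> keys (edge_poly d v :: _ \<Rightarrow>\<^sub>0 'c)" "b \<in> keys (phi d (mon \<mu>) :: _ \<Rightarrow>\<^sub>0 'c)"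
    by blast
  obtain l where "a = edge_exp l v" using ab(2) keys_edge_poly by blast
  then show ?case using add.IH[OF ab(3)] ab(1) by (simp add: tdeg_add edge_exp_def)
qed

lemma fischer_disjoint: "(\<And>\<mu>. \<mu> \<in> keys p \<Longrightarrow> \<mu> \<notin> keys q) \<Longrightarrow> fischer p q = 0"
  unfolding fischer_def by (intro sum.neutral) (simp add: in_keys_iff)

text \<open>The image is infinite-dimensional, but graded. It suffices to project onto the images of
  the monomials of degree at most \<open>q\<close>; images of larger monomials have degree above
  \<open>2 * q\<close> and share no exponent with \<open>p - b\<close>.\<close>

lemma fischer_projection_im:
  "\<exists>b. b \<in> im d m n \<and> (\<forall>c\<in>im d m n. fischer (p - b) c = 0)"
proof -
  define q where "q = (\<Sum>\<mu>\<in>keys p. tdeg \<mu>)"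
  have pq: "tdeg \<mu> \<le> q" if "\<mu> \<in> keys p" for \<mu>
    unfolding q_def using that by (rule member_le_sum) auto
  let ?M = "{\<mu>. keys \<mu> \<subseteq> grid m n \<and> tdeg \<mu> \<le> q}"
  let ?F = "(\<lambda>\<mu>. phi d (mon \<mu>)) ` ?M :: (((nat + nat) \<times> nat, rat) mpoly) set"
  have "finite ?F" by (intro finite_imageI finite_tdeg_le) auto
  then obtain b where b: "b \<in> mp.span ?F" "\<forall>f\<in>?F. fischer (p - b) f = 0"
    using fischer_projection by blast
  have "?F \<subseteq> im d m n" by (auto simp: im_def intro!: imageI)
  then have b_im: "b \<in> im d m n" by (rule im_span[OF b(1)])
  have b_deg: "tdeg \<kappa> \<le> 2 * q" if "\<kappa> \<in> keys b" for \<kappa>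
  proof -
    have "\<forall>\<kappa>\<in>keys b. tdeg \<kappa> \<le> 2 * q" using b(1)
    proof (induction rule: mp.span_induct_alt)
      case (step c x y)
      have "tdeg \<kappa> \<le> 2 * q" if "\<kappa> \<in> keys x" for \<kappa> using that step(1) tdeg_phi_mon by fastforce
      moreover have "keys (cst c * x) \<subseteq> keys x"
        by (rule subsetI) (metis in_keys_iff lookup_single_mult mult_zero_right)
      ultimately show ?case using step(2) Poly_Mapping.keys_add[of "cst c * x" y] by blast
    qed simp
    then show ?thesis using that by blast
  qed
  have mon: "fischer (p - b) (phi d (mon \<mu>)) = 0" if \<mu>: "keys \<mu> \<subseteq> grid m n" for \<mu>
  proof (cases "tdeg \<mu> \<le> q")
    case True
    then show ?thesis using b(2) \<mu> by blast
  next
    case False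
    show ?thesis
    proof (rule fischer_disjoint, rule notI)
      fix \<kappa> assume k: "\<kappa> \<in> keys (p - b)" "\<kappa> \<in> keys (phi d (mon \<mu>) :: _ \<Rightarrow>\<^sub>0 rat)"
      have "\<kappa> \<in> keys p \<or> \<kappa> \<in> keys b" using k(1) by (auto simp: in_keys_iff lookup_minus)
      then have "tdeg \<kappa> \<le> 2 * q" using pq b_deg by force
      then show False using tdeg_phi_mon[OF k(2)] False by simp
    qed
  qed
  interpret phi: comm_ring_hom "phi d" by (rule comm_ring_hom_phi)
  have "fischer (p - b) (phi d s) = 0" if "s \<in> polys (grid m n)" for s
    using that
  proof (induction s rule: polys_lin_induct)
    case (single \<mu> c)
    have "phi d (single \<mu> c) = cst c * phi d (mon \<mu>)"
      using phi.hom_mult[of "cst c" "mon \<mu>"] by (simp add: mult_single)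
    then show ?case using mon[OF single] by (simp add: fischer_scale_right)
  qed (simp_all add: phi.hom_add fischer_add_right fischer_commute[of _ 0])
  then show ?thesis using b_im by (intro exI[of _ b]) (auto simp: im_def)
qed

text \<open>Linearity over the subring \<open>im\<close> is asked for on its generators: the
  constants and the edge polynomials.\<close>

definition im_retraction ::
  "nat \<Rightarrow> nat \<Rightarrow> nat \<Rightarrow> ((((nat + nat) \<times> nat, 'k::field) mpoly) \<Rightarrow> ((nat + nat) \<times> nat, 'k) mpoly) \<Rightarrow> bool" where
  "im_retraction d m n R \<longleftrightarrow> (\<forall>p. R p \<in> im d m n) \<and> (\<forall>p q. R (p + q) = R p + R q) \<and>
     (\<forall>c p. R (cst c * p) = cst c * R p) \<and> (\<forall>b\<in>im d m n. R b = b) \<and>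
     (\<forall>v\<in>grid m n. \<forall>p. R (edge_poly d v * p) = edge_poly d v * R p)"

lemma im_retractionD:
  assumes "im_retraction d m n R"
  shows "R p \<in> im d m n" "R (p + q) = R p + R q" "R (cst c * p) = cst c * R p"
    "b \<in> im d m n \<Longrightarrow> R b = b" "v \<in> grid m n \<Longrightarrow> R (edge_poly d v * p) = edge_poly d v * R p"
  using assms unfolding im_retraction_def by blast+

text \<open>The orthogonal complement of the subring \<open>im\<close> is a module over it, since \<open>lap\<close> maps \<open>im\<close>
  to itself. Hence the orthogonal projection is linear over \<open>im\<close>.\<close>

lemma ex_retraction_rat: "\<exists>R :: _ \<Rightarrow> _ \<Rightarrow>\<^sub>0 rat. im_retraction d m n R"
proof -
  define R where "R p = (SOME b. b \<in> im d m n \<and> (\<forall>c\<in>im d m n. fischer (p - b) c = 0))" for p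
  have R: "R p \<in> im d m n" "\<And>c. c \<in> im d m n \<Longrightarrow> fischer (p - R p) c = 0" for p
    using someI_ex[OF fischer_projection_im[of d m n p]] unfolding R_def by blast+
  \<comment> \<open>Two candidates differ by an element of the image that is orthogonal to the
    image, hence to itself. Each algebraic law of \<open>R\<close> then follows by checking that its
    right side is a projection.\<close>
  have uniq: "R p = b" if b: "b \<in> im d m n" "\<And>c. c \<in> im d m n \<Longrightarrow> fischer (p - b) c = 0" for p b
  proof -
    have "R p - b \<in> im d m n" by (rule im_diff[OF R(1) b(1)])
    then have "fischer (p - b) (R p - b) - fischer (p - R p) (R p - b) = 0" using R(2) b(2) by simp
    then have "fischer ((p - b) - (p - R p)) (R p - b) = 0" by (simp only: fischer_diff_left[of "p - b"])
    then have "fischer (R p - b) (R p - b) = 0" by simp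
    then show ?thesis using fischer_definite by force
  qed
  have "im_retraction d m n R" unfolding im_retraction_def
  proof (intro conjI allI ballI)
    show "R p \<in> im d m n" for p by (rule R)
    show "R b = b" if "b \<in> im d m n" for b using that by (rule uniq) simp
    show "R (p + q) = R p + R q" for p q
    proof (rule uniq)
      show "fischer (p + q - (R p + R q)) c = 0" if "c \<in> im d m n" for c
        using R(2)[OF that, of p] R(2)[OF that, of q] fischer_add_left[of "p - R p" "q - R q" c]
        by (simp only: add_diff_add add_0_right)
    qed (intro im_add R)
    show "R (cst c * p) = cst c * R p" for c p
    proof (rule uniq)
      show "fischer (cst c * p - cst c * R p) e = 0" if "e \<in> im d m n" for e
        unfolding right_diff_distrib[symmetric] fischer_scale_left using R(2)[OF that] by simp
    qed (intro im_mult im_cst R)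
    show "R (edge_poly d v * p) = edge_poly d v * R p" if v: "v \<in> grid m n" for v p
    proof (rule uniq)
      show "fischer (edge_poly d v * p - edge_poly d v * R p) e = 0" if "e \<in> im d m n" for e
        unfolding right_diff_distrib[symmetric] using fischer_edge_adjoint[of d "fst v" "snd v" "p - R p" e] R(2)[OF lap_im[OF that]]
        by simp
    qed (intro im_mult im_edge v R)
  qed
  then show ?thesis by blast
qed

definition emb :: "(('v, rat) mpoly) \<Rightarrow> ('v, 'k::field_char_0) mpoly" where
  "emb = ev (\<lambda>c. cst (of_rat c)) vr"

lemma comm_ring_hom_of_rat: "comm_ring_hom (\<lambda>c. cst (of_rat c :: 'k::field_char_0))"
  by (rule ring_homI) (simp_all add: of_rat_add of_rat_mult single_add mult_single)

lemma comm_ring_hom_emb: "comm_ring_hom emb"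
  unfolding emb_def by (rule comm_ring_hom_ev[OF comm_ring_hom_of_rat])

lemma emb_single: "emb (single \<mu> c) = single \<mu> (of_rat c)"
  by (simp add: emb_def ev_single[OF comm_ring_hom_of_rat] mult_single flip: mon_eq_evm)

lemma emb_edge_poly: "emb (edge_poly d v) = edge_poly d v"
proof -
  interpret comm_ring_hom emb by (rule comm_ring_hom_emb)
  show ?thesis unfolding edge_poly_eq by (simp add: hom_sum emb_single)
qed

lemma emb_in_polys: "p \<in> polys X \<Longrightarrow> emb p \<in> polys X"
proof (induction p rule: polys_lin_induct)
  case zero
  interpret comm_ring_hom emb by (rule comm_ring_hom_emb)
  show ?case by simp
next
  case (single \<mu> c)
  then show ?case by (simp add: emb_single)
next
  case (add p q)
  interpret comm_ring_hom emb by (rule comm_ring_hom_emb)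
  show ?case using add by (simp add: hom_add polys_add)
qed

lemma emb_phi: "emb (phi d p) = phi d (emb p)"
  by (rule hom_eq_on_polys[OF comm_ring_hom_compose[OF comm_ring_hom_emb comm_ring_hom_phi]
        comm_ring_hom_compose[OF comm_ring_hom_phi comm_ring_hom_emb], where X = UNIV])
    (simp_all add: emb_single emb_edge_poly)

text \<open>Base change: the rational retraction is applied to monomials and extended linearly over
  the larger field. By linearity every property reduces to polynomials coming from the rationals,
  where it is known.\<close>

lemma ex_retraction: "\<exists>R :: _ \<Rightarrow> _ \<Rightarrow>\<^sub>0 'k::field_char_0. im_retraction d m n R"
proof -
  obtain Q where "im_retraction d m n (Q :: _ \<Rightarrow> _ \<Rightarrow>\<^sub>0 rat)" using ex_retraction_rat by blast
  note Q = im_retractionD[OF this]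
  interpret e: comm_ring_hom "emb :: _ \<Rightarrow> ((nat + nat) \<times> nat, 'k) mpoly" by (rule comm_ring_hom_emb)
  interpret phi: comm_ring_hom "phi d :: _ \<Rightarrow> ((nat + nat) \<times> nat, 'k) mpoly" by (rule comm_ring_hom_phi)
  define R where "R = lext cst (\<lambda>\<mu>. emb (Q (mon \<mu>)) :: ((nat + nat) \<times> nat, 'k) mpoly)"
  have R_add: "R (p + q) = R p + R q" for p q
    unfolding R_def by (rule lext_add) (simp_all add: single_add)
  have R_single: "R (single \<mu> c) = cst c * emb (Q (mon \<mu>))" for \<mu> c
    unfolding R_def by (rule lext_single) simp
  have R_zero: "R 0 = 0" by (simp add: R_def)
  have Q0: "Q 0 = 0" using Q(3)[of 0 0] by simp
  have R_scale: "R (cst c * p) = cst c * R p" for c p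
  proof (induction p rule: pm_induct)
    case (single \<mu> a)
    show ?case unfolding mult_single R_single by (simp add: mult.assoc[symmetric] mult_single)
  qed (simp_all add: R_zero R_add distrib_left)
  have R_emb: "R (emb p) = emb (Q p)" for p
  proof (induction p rule: pm_induct)
    case (single \<mu> c)
    have "Q (single \<mu> c) = cst c * Q (mon \<mu>)" using Q(3)[of c "mon \<mu>"] by (simp add: mult_single)
    then show ?case by (simp add: emb_single R_single e.hom_mult)
  qed (simp_all add: R_zero R_add Q Q0 e.hom_add)
  have emb_im: "emb b \<in> im d m n" if "b \<in> im d m n" for b
    using that by (auto simp: im_def emb_phi intro!: imageI emb_in_polys)
  have "im_retraction d m n R" unfolding im_retraction_def
  proof (intro conjI allI ballI R_add R_scale)
    show "R p \<in> im d m n" for p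
    proof (induction p rule: pm_induct)
      case (single \<mu> c)
      show ?case unfolding R_single by (intro im_mult im_cst emb_im Q)
    qed (simp_all add: R_zero R_add im_zero im_add)
    show "R b = b" if "b \<in> im d m n" for b
    proof -
      have "\<exists>p. p \<in> polys (grid m n) \<and> b = phi d p" using that unfolding im_def by blast
      then obtain p where p: "p \<in> polys (grid m n)" "b = phi d p" by blast
      have "R (phi d p) = phi d p" using p(1)
      proof (induction p rule: polys_lin_induct)
        case (single \<mu> c)
        have 1: "phi d (single \<mu> c) = cst c * emb (phi d (mon \<mu>))"
          using phi.hom_mult[of "cst c" "mon \<mu>"] by (simp add: mult_single emb_phi emb_single)
        have "(phi d (mon \<mu>) :: _ \<Rightarrow>\<^sub>0 rat) \<in> im d m n" using single by (auto simp: im_def)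
        then show ?case unfolding 1 R_scale R_emb by (simp add: Q(4))
      qed (simp_all add: R_zero R_add phi.hom_add)
      then show ?thesis using p(2) by simp
    qed
    show "R (edge_poly d v * p) = edge_poly d v * R p" if v: "v \<in> grid m n" for v p
    proof (induction p rule: pm_induct)
      case (single \<mu> c)
      have "edge_poly d v * single \<mu> c = cst c * emb (edge_poly d v * mon \<mu>)"
      proof -
        have "single \<mu> c = cst c * (mon \<mu> :: _ \<Rightarrow>\<^sub>0 'k)" by (simp add: mult_single)
        then show ?thesis
          by (simp only: e.hom_mult emb_edge_poly emb_single of_rat_1 mult.left_commute)
      qed
      then have "R (edge_poly d v * single \<mu> c) = cst c * emb (Q (edge_poly d v * mon \<mu>))"
        by (simp only: R_scale R_emb)
      also have "\<dots> = cst c * (edge_poly d v * emb (Q (mon \<mu>)))"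
        by (simp only: Q(5)[OF v] e.hom_mult emb_edge_poly)
      finally show ?case by (simp only: R_single mult.left_commute)
    qed (simp_all add: R_zero R_add distrib_left)
  qed
  then show ?thesis by blast
qed

text \<open>If the image of \<open>p\<close> is a combination of edge polynomials, the retraction
  moves the coefficients into the image of \<open>phi\<close>, say to \<open>phi d (s v)\<close>.
  Then \<open>p\<close> minus the sum of the \<open>vr v * s v\<close> lies in the kernel, hence in
  the ideal of minors, and \<open>kill E\<close> erases the subtracted sum.\<close>

lemma purity:
  fixes p :: "(nat \<times> nat, 'k::field_char_0) mpoly"
  assumes p: "p \<in> polys (grid m n)" and E: "E \<subseteq> grid m n" and L: "phi d p \<in> idg (edge_poly d ` E)"
  shows "kill E p \<in> idg (kill E ` gen_minors (d + 1) m n)"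
proof -
  interpret phi: comm_ring_hom "phi d" by (rule comm_ring_hom_phi)
  interpret k: comm_ring_hom "kill E" by (rule comm_ring_hom_kill)
  have fin: "finite E" using E by (rule finite_subset) auto
  obtain R where "im_retraction d m n (R :: _ \<Rightarrow> _ \<Rightarrow>\<^sub>0 'k)" using ex_retraction by blast
  note R = im_retractionD[OF this]
  obtain c where c: "phi d p = (\<Sum>v\<in>E. c v * edge_poly d v)" using idg_imageD[OF L fin] by blast
  have R_sum: "R (sum f A) = (\<Sum>a\<in>A. R (f a))" for f :: "nat \<times> nat \<Rightarrow> _" and A
    using R(3)[of 0 0] by (induction A rule: infinite_finite_induct) (simp_all add: R(2))
  have "\<forall>v. \<exists>s. s \<in> polys (grid m n) \<and> R (c v) = phi d s" using R(1) unfolding im_def by blast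
  from choice[OF this] obtain s where s: "\<And>v. s v \<in> polys (grid m n)" "\<And>v. R (c v) = phi d (s v)" by blast
  have "phi d p = R (phi d p)" using p by (simp add: R(4) im_def)
  also have "\<dots> = (\<Sum>v\<in>E. R (edge_poly d v * c v))" unfolding c R_sum by (simp only: mult.commute)
  also have "\<dots> = (\<Sum>v\<in>E. phi d (vr v * s v))"
    using E by (intro sum.cong) (auto simp: R(5) phi.hom_mult s(2))
  finally have "phi d (p - (\<Sum>v\<in>E. vr v * s v)) = 0" by (simp add: phi.hom_minus phi.hom_sum)
  moreover have "p - (\<Sum>v\<in>E. vr v * s v) \<in> polys (grid m n)"
    using p s(1) E by (intro polys_diff polys_sum polys_mult) auto
  ultimately have "p - (\<Sum>v\<in>E. vr v * s v) \<in> idg (gen_minors (d + 1) m n)" by (intro ker_phi)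
  then have "kill E (p - (\<Sum>v\<in>E. vr v * s v)) \<in> idg (kill E ` gen_minors (d + 1) m n)"
    by (rule idg_hom_image[OF comm_ring_hom_kill]) (auto intro: idl.span_base)
  moreover have "kill E (\<Sum>v\<in>E. vr v * s v) = 0"
    by (simp add: k.hom_sum k.hom_mult kill_vr)
  ultimately show ?thesis by (simp add: k.hom_minus)
qed

text \<open>The variables erased by \<open>kill E\<close> are those that \<open>phi\<close> sends to
  the edge polynomials of \<open>E\<close>; so erasing them changes the image of a minor, which is
  0, by an element of their ideal.\<close>

lemma phi_kill_minors:
  assumes "p \<in> idg (kill E ` gen_minors (d + 1) m n)"
  shows "phi d p \<in> idg (edge_poly d ` E)"
proof (rule idg_hom_image[OF comm_ring_hom_phi assms])
  fix g assume "g \<in> kill E ` gen_minors (d + 1) m n"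
  then obtain M where M: "g = kill E M" "phi d M = 0"
    unfolding gen_minors_def using phi_sminor by blast
  interpret phi: comm_ring_hom "phi d" by (rule comm_ring_hom_phi)
  have "phi d (kill E M) - phi d M \<in> idg (edge_poly d ` E)"
    by (rule hom_cong_idg[OF comm_ring_hom_compose[OF comm_ring_hom_phi comm_ring_hom_kill] comm_ring_hom_phi, where X = UNIV])
      (auto simp: kill_vr idl.span_zero intro: idl.span_neg[OF idl.span_base])
  then show "phi d g \<in> idg (edge_poly d ` E)" using M by simp
qed

section \<open>Translation of the ideals of the theorem\<close>

definition cells :: "(nat + nat) set set \<Rightarrow> (nat \<times> nat) set" where
  "cells E = {(i, j). {Inl i, Inr j} \<in> E}"

lemma cells_subset: "E \<subseteq> complete_bip_edges m n \<Longrightarrow> cells E \<subseteq> grid m n"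
  by (auto simp: cells_def complete_bip_edges_def doubleton_eq_iff dest!: subsetD)

definition lss_vars :: "nat \<Rightarrow> nat \<Rightarrow> nat \<Rightarrow> ((nat + nat) \<times> nat) set" where
  "lss_vars d m n = bip_vertices m n \<times> {..<d}"

definition det_id :: "nat \<Rightarrow> nat \<Rightarrow> nat \<Rightarrow> (nat \<times> nat) set \<Rightarrow> (nat \<times> nat, 'k::field) mpoly set" where
  "det_id d m n C = polys (grid m n) \<inter> idg (kill C ` gen_minors (d + 1) m n)"

definition lss_id :: "nat \<Rightarrow> nat \<Rightarrow> nat \<Rightarrow> (nat \<times> nat) set \<Rightarrow> ((nat + nat) \<times> nat, 'k::field) mpoly set" where
  "lss_id d m n C = polys (lss_vars d m n) \<inter> idg (edge_poly d ` C)"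

lemma edge_poly_in_polys: "v \<in> grid m n \<Longrightarrow> edge_poly d v \<in> polys (lss_vars d m n)"
  unfolding edge_poly_def lss_vars_def bip_vertices_def
  by (intro polys_sum polys_mult) (auto simp: mem_Times_iff)

lemma LSS_ideal_eq:
  assumes "E \<subseteq> complete_bip_edges m n"
  shows "LSS_ideal TYPE('k::field) (bip_vertices m n) E d = lss_id d m n (cells E)"
proof -
  have gen: "{\<Sum>l<d. Var (u, l) * Var (v, l) | u v. {u, v} \<in> E} = (edge_poly d ` cells E :: (_, 'k) mpoly set)"
  proof (intro equalityI subsetI)
    fix x :: "(_, 'k) mpoly" assume "x \<in> {\<Sum>l<d. Var (u, l) * Var (v, l) | u v. {u, v} \<in> E}"
    then obtain u v where x: "x = (\<Sum>l<d. Var (u, l) * Var (v, l))" "{u, v} \<in> E" by blast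
    then obtain i j where ij: "{u, v} = {Inl i, Inr j}" using assms by (auto simp: complete_bip_edges_def)
    then have "(i, j) \<in> cells E" using x(2) by (simp add: cells_def)
    \<comment> \<open>Edges are unordered, so each one is met with its ends in either order;
      commutativity makes both sums equal.\<close>
    moreover have "x = edge_poly d (i, j)"
      using ij unfolding x(1) edge_poly_def Var_def doubleton_eq_iff by (auto simp: mult.commute)
    ultimately show "x \<in> edge_poly d ` cells E" by blast
  next
    fix x :: "(_, 'k) mpoly" assume "x \<in> edge_poly d ` cells E"
    then obtain i j where "{Inl i, Inr j} \<in> E" "x = (\<Sum>l<d. Var (Inl i, l) * Var (Inr j, l))"
      by (auto simp: cells_def edge_poly_def Var_def)
    then show "x \<in> {\<Sum>l<d. Var (u, l) * Var (v, l) | u v. {u, v} \<in> E}" by blast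
  qed
  have "edge_poly d ` cells E \<subseteq> (polys (lss_vars d m n) :: (_, 'k) mpoly set)"
    using cells_subset[OF assms] edge_poly_in_polys by blast
  then show ?thesis
    unfolding LSS_ideal_def LSS_ring_def lss_id_def gen lss_vars_def by (rule Idl_poly_ring)
qed

lemma gen_minors_polys: "(gen_minors t m n :: (_ \<Rightarrow>\<^sub>0 'c::comm_ring_1) set) \<subseteq> polys (grid m n)"
proof
  fix x :: "_ \<Rightarrow>\<^sub>0 'c" assume "x \<in> gen_minors t m n"
  then obtain r c where x: "x = sminor t vr r c" "minor_index t m r" "minor_index t n c"
    by (auto simp: gen_minors_def)
  show "x \<in> polys (grid m n)" unfolding x sminor_def
  proof (intro polys_sum polys_mult polys_prod)
    show "(signof p :: _ \<Rightarrow>\<^sub>0 'c) \<in> polys (grid m n)" for p :: "nat \<Rightarrow> nat" by (simp add: sign_def)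
    fix p i assume "p \<in> {p. p permutes {0..<t}}" "i \<in> {0..<t}"
    then have "i < t" "p i < t" using permutes_in_image[of p "{0..<t}" i] by auto
    then show "(vr (r i, c (p i)) :: _ \<Rightarrow>\<^sub>0 'c) \<in> polys (grid m n)" using x by (auto simp: minor_index_def)
  qed
qed

lemma kill_gen_minors_polys: "kill C ` gen_minors t m n \<subseteq> polys (grid m n - C)"
  using gen_minors_polys kill_in_polys by blast

lemma det_ideal_eq:
  "det_ideal TYPE('k::field) (d + 1) (X_gen_graph TYPE('k) m n E) = det_id d m n (cells E)"
proof -
  let ?f = "\<lambda>v. if v \<in> cells E then 0 else vr v :: (_, 'k) mpoly"
  have X: "X_gen_graph TYPE('k) m n E = mat m n ?f"
    unfolding X_gen_graph_def by (rule cong_mat) (auto simp: X_gen_def cells_def Var_def)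
  have "minors (d + 1) (mat m n ?f) = kill (cells E) ` gen_minors (d + 1) m n"
  proof -
    have "sminor (d + 1) ?f r c = kill (cells E) (sminor (d + 1) vr r c)" for r c
      by (simp add: hom_sminor[OF comm_ring_hom_kill] kill_vr)
    then show ?thesis unfolding minors_mat gen_minors_def by (simp only:) blast
  qed
  moreover have "kill (cells E) ` gen_minors (d + 1) m n \<subseteq> (polys (grid m n) :: (_, 'k) mpoly set)"
    using kill_gen_minors_polys[of "cells E" "d + 1" m n] polys_mono[of "grid m n - cells E" "grid m n"] by blast
  ultimately show ?thesis
    unfolding det_ideal_def X gen_ring_def det_id_def by (simp add: Idl_poly_ring)
qed

lemma X_gen_eq: "X_gen K m n = X_gen_graph K m n {}"
  unfolding X_gen_graph_def X_gen_def by (rule cong_mat) auto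

lemma pideal_det_id: "pideal (grid m n) (det_id d m n C)"
  unfolding det_id_def by (rule pideal_idg)

section \<open>Contraction along the product map\<close>

text \<open>The full preimage contains the variables from \<open>C\<close> themselves. Restricted to
  the remaining variables, it becomes the ideal whose extension is \<open>det_id\<close>.\<close>

definition phi_preimage :: "nat \<Rightarrow> nat \<Rightarrow> nat \<Rightarrow> (nat \<times> nat) set \<Rightarrow> (nat \<times> nat, 'k::field) mpoly set" where
  "phi_preimage d m n C = {q \<in> polys (grid m n - C). phi d q \<in> lss_id d m n C}"

lemma phi_in_polys: "p \<in> polys (grid m n) \<Longrightarrow> phi d p \<in> polys (lss_vars d m n)"
  unfolding phi_def by (rule ev_in_polys) (auto intro: edge_poly_in_polys)

lemma phi_in_polys': "p \<in> polys (grid m n - C) \<Longrightarrow> phi d p \<in> polys (lss_vars d m n)"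
  by (rule phi_in_polys) (use polys_mono[of "grid m n - C" "grid m n"] in blast)

lemma pideal_lss_id: "pideal (lss_vars d m n) (lss_id d m n C)"
  unfolding lss_id_def by (rule pideal_idg)

lemma pideal_phi_preimage: "pideal (grid m n - C) (phi_preimage d m n C)"
proof -
  interpret comm_ring_hom "phi d" by (rule comm_ring_hom_phi)
  note L = pidealD[OF pideal_lss_id[of d m n C]]
  show ?thesis unfolding pideal_def phi_preimage_def
    by (auto simp: hom_add hom_mult intro: polys_add polys_mult L(2,3) L(4)[OF phi_in_polys'[of _ m n C]])
qed

text \<open>One inclusion is \<open>phi_kill_minors\<close> on the generators, the other is
  \<open>purity\<close>, since \<open>kill C\<close> is the identity on polynomials avoiding
  \<open>C\<close>.\<close>

lemma det_id_eq_extend: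
  assumes C: "C \<subseteq> grid m n"
  shows "det_id d m n C = (extend (grid m n - C) (grid m n) (phi_preimage d m n C) :: (_, 'k::field_char_0) mpoly set)"
proof
  let ?I = "phi_preimage d m n C :: (_, 'k) mpoly set"
  have ext: "pideal (grid m n) (extend (grid m n - C) (grid m n) ?I)"
    by (rule pideal_extend[OF pideal_phi_preimage]) auto
  have gI: "kill C ` gen_minors (d + 1) m n \<subseteq> ?I"
  proof
    fix g :: "(_, 'k) mpoly" assume g: "g \<in> kill C ` gen_minors (d + 1) m n"
    then have gp: "g \<in> polys (grid m n - C)" using kill_gen_minors_polys by blast
    have "phi d g \<in> idg (edge_poly d ` C)" by (rule phi_kill_minors[OF idl.span_base[OF g]])
    then show "g \<in> ?I" using gp phi_in_polys'[OF gp] by (simp add: phi_preimage_def lss_id_def)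
  qed
  have G: "kill C ` gen_minors (d + 1) m n \<subseteq> extend (grid m n - C) (grid m n) ?I"
  proof
    fix g :: "(_, 'k) mpoly" assume "g \<in> kill C ` gen_minors (d + 1) m n"
    then have g: "g \<in> ?I" using gI by blast
    then have "g \<in> polys (grid m n - C)" by (rule pidealD(1)[OF pideal_phi_preimage])
    then show "g \<in> extend (grid m n - C) (grid m n) ?I"
      using extend_contract[OF pideal_phi_preimage Diff_subset] g by blast
  qed
  have "kill C ` gen_minors (d + 1) m n \<subseteq> (polys (grid m n) :: (_, 'k) mpoly set)"
    using kill_gen_minors_polys[of C "d + 1" m n] polys_mono[of "grid m n - C" "grid m n"] by blast
  note Idl = Idl_poly_ring[OF this, where K = "TYPE('k)"]
  interpret R: ring "poly_ring TYPE('k) (grid m n)" using poly_ring_cring by (rule cring.axioms)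
  show "det_id d m n C \<subseteq> extend (grid m n - C) (grid m n) ?I"
    unfolding det_id_def Idl[symmetric]
    by (rule R.genideal_minimal[OF _ G]) (simp add: ideal_poly_ring_iff ext)
  show "extend (grid m n - C) (grid m n) ?I \<subseteq> det_id d m n C"
  proof (rule extend_subset[OF pideal_det_id], rule subsetI)
    fix q :: "(_, 'k) mpoly" assume q: "q \<in> ?I"
    then have qp: "q \<in> polys (grid m n - C)" by (simp add: phi_preimage_def)
    then have qg: "q \<in> polys (grid m n)" using polys_mono[of "grid m n - C" "grid m n"] by blast
    have "kill C q \<in> idg (kill C ` gen_minors (d + 1) m n)"
      by (rule purity[OF qg C]) (use q in \<open>simp add: phi_preimage_def lss_id_def\<close>)
    moreover have "kill C q = q" by (rule kill_id[OF qp]) auto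
    ultimately show "q \<in> det_id d m n C" using qg by (simp add: det_id_def)
  qed
qed

lemma det_id_prime:
  assumes C: "C \<subseteq> grid m n" and L: "pprime (lss_vars d m n) (lss_id d m n C :: (_, 'k::field_char_0) mpoly set)"
  shows "pprime (grid m n) (det_id d m n C :: (_, 'k) mpoly set)"
proof -
  interpret comm_ring_hom "phi d" by (rule comm_ring_hom_phi)
  have "pprime (grid m n - C) (phi_preimage d m n C :: (_, 'k) mpoly set)"
    unfolding pprime_def
  proof (intro conjI ballI impI pideal_phi_preimage)
    show "1 \<notin> (phi_preimage d m n C :: (_, 'k) mpoly set)"
      using L by (simp add: phi_preimage_def pprime_def)
    fix a b :: "(_, 'k) mpoly"
    assume ab: "a \<in> polys (grid m n - C)" "b \<in> polys (grid m n - C)" "a * b \<in> phi_preimage d m n C"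
    then have "phi d a * phi d b \<in> lss_id d m n C" by (simp add: phi_preimage_def hom_mult)
    then have "phi d a \<in> lss_id d m n C \<or> phi d b \<in> lss_id d m n C"
      using L phi_in_polys'[OF ab(1)] phi_in_polys'[OF ab(2)] unfolding pprime_def by blast
    then show "a \<in> phi_preimage d m n C \<or> b \<in> phi_preimage d m n C"
      using ab by (auto simp: phi_preimage_def)
  qed
  then show ?thesis unfolding det_id_eq_extend[OF C] by (rule pprime_extend) auto
qed

lemma det_id_radical:
  assumes C: "C \<subseteq> grid m n" and L: "pradical (lss_vars d m n) (lss_id d m n C :: (_, 'k::field_char_0) mpoly set)"
  shows "pradical (grid m n) (det_id d m n C :: (_, 'k) mpoly set)"
proof -
  interpret comm_ring_hom "phi d" by (rule comm_ring_hom_phi)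
  have "pradical (grid m n - C) (phi_preimage d m n C :: (_, 'k) mpoly set)"
    unfolding pradical_def
  proof (intro conjI ballI allI impI pideal_phi_preimage)
    fix a :: "(_, 'k) mpoly" and k
    assume a: "a \<in> polys (grid m n - C)" "a ^ k \<in> phi_preimage d m n C"
    then have "phi d a ^ k \<in> lss_id d m n C" by (simp add: phi_preimage_def hom_power)
    then have "phi d a \<in> lss_id d m n C"
      using L phi_in_polys'[OF a(1)] unfolding pradical_def by blast
    then show "a \<in> phi_preimage d m n C" using a by (simp add: phi_preimage_def)
  qed
  then show ?thesis unfolding det_id_eq_extend[OF C] by (rule pradical_extend) auto
qed

section \<open>The upper bound for the height\<close>

lemma lookup_kill: "lookup (kill C p) \<mu> = (if keys \<mu> \<inter> C = {} then lookup p \<mu> else 0)"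
proof (induction p rule: pm_induct)
  case zero
  interpret comm_ring_hom "kill C" by (rule comm_ring_hom_kill)
  show ?case by simp
next
  case (single \<nu> c)
  interpret comm_ring_hom "kill C" by (rule comm_ring_hom_kill)
  have "kill C (single \<nu> c) = cst c * kill C (mon \<nu>)"
    using hom_mult[of "cst c" "mon \<nu>"] by (simp add: mult_single)
  then show ?case by (auto simp: kill_mon lookup_single_mult lookup_single when_def)
next
  case (add p q)
  interpret comm_ring_hom "kill C" by (rule comm_ring_hom_kill)
  show ?case using add by (simp add: hom_add lookup_add)
qed

text \<open>The weight gives the cells of \<open>C\<close> weight one and all other cells weight two, so that the
  part of top weight of a generic minor is the minor with the entries in \<open>C\<close> replaced by zero.\<close>

definition wt :: "'v set \<Rightarrow> ('v \<Rightarrow>\<^sub>0 nat) \<Rightarrow> nat" where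
  "wt C \<mu> = tdeg \<mu> + tdeg (rest (- C) \<mu>)"

lemma wt_add: "wt C (\<mu> + \<nu>) = wt C \<mu> + wt C \<nu>"
  by (simp add: wt_def rest_add tdeg_add)

lemma tdeg_rest_split: "tdeg \<mu> = tdeg (rest C \<mu>) + tdeg (rest (- C) \<mu>)"
  using tdeg_add[of "rest C \<mu>" "rest (- C) \<mu>"] by (simp add: rest_split)

lemma tdeg_eq_0: "tdeg \<mu> = 0 \<longleftrightarrow> \<mu> = 0"
proof
  assume "tdeg \<mu> = 0"
  then have "lookup \<mu> v = 0" for v using lookup_le_tdeg[of \<mu> v] by simp
  then show "\<mu> = 0" by (intro poly_mapping_eqI) simp
qed simp

lemma wt_le: "wt C \<mu> \<le> 2 * tdeg \<mu>"
  using tdeg_rest_split[of \<mu> C] by (simp add: wt_def)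

lemma wt_eq_iff: "wt C \<mu> = 2 * tdeg \<mu> \<longleftrightarrow> keys \<mu> \<inter> C = {}"
proof -
  have "wt C \<mu> = 2 * tdeg \<mu> \<longleftrightarrow> rest C \<mu> = 0"
    using tdeg_rest_split[of \<mu> C] by (auto simp: wt_def tdeg_eq_0[symmetric])
  also have "\<dots> \<longleftrightarrow> keys \<mu> \<inter> C = {}"
    unfolding keys_rest[symmetric] by simp
  finally show ?thesis .
qed

lemma keys_sminor_vr: "\<mu> \<in> keys (sminor t vr r c :: _ \<Rightarrow>\<^sub>0 'c::comm_ring_1) \<Longrightarrow> tdeg \<mu> = t"
proof -
  assume "\<mu> \<in> keys (sminor t vr r c :: _ \<Rightarrow>\<^sub>0 'c)"
  then obtain p where "\<mu> \<in> keys (signof p * mon (perm_exp t r c p) :: _ \<Rightarrow>\<^sub>0 'c)"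
    unfolding sminor_vr using keys_sum by (metis (no_types, lifting) UN_E subsetD)
  then have "\<mu> = perm_exp t r c p" by (auto simp: sign_def split: if_splits)
  then show ?thesis by (simp add: tdeg_perm_exp)
qed

text \<open>The minors with zeros are homogeneous of weight \<open>2 * t\<close>, and they are the
  top parts of the generic minors. So a term of weight \<open>q\<close> in a combination is lifted
  by restoring the generic minor, and terms of other weight are dropped.\<close>

lemma lift_top:
  fixes g :: "(nat \<times> nat, 'k::field) mpoly"
  assumes "g \<in> idg (kill C ` gen_minors t m n)"
  shows "\<exists>g'. g' \<in> idg (gen_minors t m n) \<and> (\<forall>\<mu>. wt C \<mu> = q \<longrightarrow> lookup g' \<mu> = lookup g \<mu>) \<and>
    (\<forall>\<mu>. q < wt C \<mu> \<longrightarrow> lookup g' \<mu> = 0)"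
  using assms
proof (induction rule: idg_induct)
  case zero
  show ?case by (intro exI[of _ 0]) (simp add: idl.span_zero)
next
  case (step b g x)
  obtain x' where x': "x' \<in> idg (gen_minors t m n)" "\<And>\<mu>. wt C \<mu> = q \<Longrightarrow> lookup x' \<mu> = lookup x \<mu>"
    "\<And>\<mu>. q < wt C \<mu> \<Longrightarrow> lookup x' \<mu> = 0" using step(2) by blast
  obtain M :: "(nat \<times> nat, 'k) mpoly" where M: "g = kill C M" "M \<in> gen_minors t m n" using step(1) by blast
  have Mt: "tdeg \<mu> = t" if "lookup M \<mu> \<noteq> 0" for \<mu>
    using M(2) that keys_sminor_vr unfolding gen_minors_def by (auto simp: in_keys_iff)
  have "\<exists>y. y \<in> idg (gen_minors t m n) \<and> (\<forall>\<mu>. wt C \<mu> = q \<longrightarrow> lookup y \<mu> = lookup (b * g) \<mu>) \<and>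
    (\<forall>\<mu>. q < wt C \<mu> \<longrightarrow> lookup y \<mu> = 0)"
  proof (induction b rule: pm_induct)
    case zero
    show ?case by (intro exI[of _ 0]) (simp add: idl.span_zero)
  next
    case (add p p')
    then obtain y y' where y: "y \<in> idg (gen_minors t m n)" "\<And>\<mu>. wt C \<mu> = q \<Longrightarrow> lookup y \<mu> = lookup (p * g) \<mu>"
      "\<And>\<mu>. q < wt C \<mu> \<Longrightarrow> lookup y \<mu> = 0" and
      y': "y' \<in> idg (gen_minors t m n)" "\<And>\<mu>. wt C \<mu> = q \<Longrightarrow> lookup y' \<mu> = lookup (p' * g) \<mu>"
      "\<And>\<mu>. q < wt C \<mu> \<Longrightarrow> lookup y' \<mu> = 0" by blast
    have "y + y' \<in> idg (gen_minors t m n)" by (intro idl.span_add y(1) y'(1))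
    then show ?case using y(2,3) y'(2,3) by (intro exI[of _ "y + y'"]) (simp add: lookup_add distrib_right)
  next
    case (single \<nu> c)
    have wt_split: "wt C \<mu> = wt C \<nu> + wt C (\<mu> - \<nu>)" if "\<forall>v. lookup \<nu> v \<le> lookup \<mu> v" for \<mu>
    proof -
      have "\<nu> + (\<mu> - \<nu>) = \<mu>" by (rule poly_mapping_eqI) (simp only: lookup_add lookup_minus le_add_diff_inverse[OF that[rule_format]])
      then show ?thesis using wt_add[of C \<nu> "\<mu> - \<nu>"] by simp
    qed
    show ?case
    proof (cases "q = wt C \<nu> + 2 * t")
      case True
      have "lookup (single \<nu> c * M) \<mu> = lookup (single \<nu> c * g) \<mu>" if "wt C \<mu> = q" for \<mu>
      proof (cases "\<forall>v. lookup \<nu> v \<le> lookup \<mu> v")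
        case le: True
        have "wt C (\<mu> - \<nu>) = 2 * t" using wt_split[OF le] that True by simp
        then have "lookup M (\<mu> - \<nu>) = lookup g (\<mu> - \<nu>)"
          unfolding M(1) lookup_kill using Mt[of "\<mu> - \<nu>"] wt_eq_iff[of C "\<mu> - \<nu>"] by auto
        then show ?thesis by (simp only: lookup_single_mult_exp)
      qed (simp only: lookup_single_mult_exp if_False)
      moreover have "lookup (single \<nu> c * M) \<mu> = 0" if "q < wt C \<mu>" for \<mu>
      proof (cases "\<forall>v. lookup \<nu> v \<le> lookup \<mu> v")
        case le: True
        have "2 * t < wt C (\<mu> - \<nu>)" using wt_split[OF le] that True by simp
        then have "lookup M (\<mu> - \<nu>) = 0" using Mt[of "\<mu> - \<nu>"] wt_le[of C "\<mu> - \<nu>"] by force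
        then show ?thesis by (simp only: lookup_single_mult_exp mult_zero_right if_cancel)
      qed (simp only: lookup_single_mult_exp if_False)
      moreover have "single \<nu> c * M \<in> idg (gen_minors t m n)" by (rule idg_mult[OF idl.span_base[OF M(2)]])
      ultimately show ?thesis by blast
    next
      case False
      have "lookup (single \<nu> c * g) \<mu> = 0" if "wt C \<mu> = q" for \<mu>
      proof (cases "\<forall>v. lookup \<nu> v \<le> lookup \<mu> v")
        case le: True
        have "wt C (\<mu> - \<nu>) \<noteq> 2 * t" using wt_split[OF le] that False by auto
        then have "lookup g (\<mu> - \<nu>) = 0"
          unfolding M(1) lookup_kill using Mt[of "\<mu> - \<nu>"] wt_eq_iff[of C "\<mu> - \<nu>"] by auto
        then show ?thesis by (simp only: lookup_single_mult_exp mult_zero_right if_cancel)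
      qed (simp only: lookup_single_mult_exp if_False)
      then show ?thesis by (intro exI[of _ 0]) (simp add: idl.span_zero)
    qed
  qed
  then obtain y where y: "y \<in> idg (gen_minors t m n)" "\<And>\<mu>. wt C \<mu> = q \<Longrightarrow> lookup y \<mu> = lookup (b * g) \<mu>"
    "\<And>\<mu>. q < wt C \<mu> \<Longrightarrow> lookup y \<mu> = 0" by blast
  have "y + x' \<in> idg (gen_minors t m n)" by (intro idl.span_add y(1) x'(1))
  then show ?case using y(2,3) x'(2,3) by (intro exI[of _ "y + x'"]) (simp add: lookup_add)
qed

lemma lead_exists:
  fixes g :: "('v::linorder, 'c::zero) mpoly"
  assumes "g \<noteq> 0"
  shows "\<exists>\<eta>\<in>keys g. \<forall>\<mu>\<in>keys g. (wt C \<mu>, \<mu>) \<le> (wt C \<eta>, \<eta>)"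
proof -
  let ?K = "(\<lambda>\<mu>. (wt C \<mu>, \<mu>)) ` keys g"
  have ne: "?K \<noteq> {}" using assms by simp
  have "Max ?K \<in> ?K" using ne by (intro Max_in) auto
  then obtain \<eta> where l: "\<eta> \<in> keys g" "Max ?K = (wt C \<eta>, \<eta>)" by blast
  have "(wt C \<mu>, \<mu>) \<le> (wt C \<eta>, \<eta>)" if "\<mu> \<in> keys g" for \<mu>
    unfolding l(2)[symmetric] using that by (intro Max_ge) auto
  then show ?thesis using l(1) by blast
qed

text \<open>All monomials in the variables of the hook are good.\<close>

lemma hook_indep:
  fixes p :: "(nat \<times> nat, 'k::field_char_0) mpoly"
  assumes "p \<in> polys {v \<in> grid m n. fst v < d \<or> snd v < d}" "phi d p = 0"
  shows "p = 0"
proof (rule good_independent[OF _ assms(2)])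
  show "keys p \<subseteq> good_exps d m n"
    using polysD[OF assms(1)] good_mono[OF good_hook[of d "grid m n"]] unfolding good_exps_def by blast
qed

text \<open>If every set of \<open>r\<close> cells supported an element of the ideal, the monomials avoiding the
  leading terms of these elements would span modulo the generic minors, but they are too few.\<close>

lemma exists_indep_set:
  fixes C :: "(nat \<times> nat) set" and d m n :: nat
  defines "r \<equiv> card {v \<in> grid m n. fst v < d \<or> snd v < d}"
  shows "\<exists>U\<subseteq>grid m n. card U = r \<and> polys U \<inter> det_id d m n C \<subseteq> {0 :: (nat \<times> nat, 'k::field_char_0) mpoly}"
proof (rule ccontr)
  assume no: "\<not> ?thesis"
  let ?Us = "{U. U \<subseteq> grid m n \<and> card U = r}"
  interpret phi: comm_ring_hom "phi d :: (_, 'k) mpoly \<Rightarrow> _" by (rule comm_ring_hom_phi)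
  have "\<forall>U. \<exists>g. U \<in> ?Us \<longrightarrow> g \<noteq> 0 \<and> g \<in> polys U \<and> g \<in> (det_id d m n C :: (_, 'k) mpoly set)"
    using no by blast
  from choice[OF this] obtain g where
    g: "\<And>U. U \<in> ?Us \<Longrightarrow> g U \<noteq> 0" "\<And>U. U \<in> ?Us \<Longrightarrow> g U \<in> polys U"
      "\<And>U. U \<in> ?Us \<Longrightarrow> g U \<in> (det_id d m n C :: (_, 'k) mpoly set)" by blast
  have "\<forall>U. \<exists>\<eta>. U \<in> ?Us \<longrightarrow> \<eta> \<in> keys (g U) \<and> (\<forall>\<mu>\<in>keys (g U). (wt C \<mu>, \<mu>) \<le> (wt C \<eta>, \<eta>))"
    using lead_exists[OF g(1)] by blast
  from choice[OF this] obtain lm where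
    lm: "\<And>U. U \<in> ?Us \<Longrightarrow> lm U \<in> keys (g U)"
      "\<And>U \<mu>. U \<in> ?Us \<Longrightarrow> \<mu> \<in> keys (g U) \<Longrightarrow> (wt C \<mu>, \<mu>) \<le> (wt C (lm U), lm U)" by blast
  \<comment> \<open>The standard monomials: those divisible by none of the chosen leading
    monomials.\<close>
  define T where "T = {\<nu>. keys \<nu> \<subseteq> grid m n \<and> (\<forall>U\<in>?Us. \<not> (\<forall>v. lookup (lm U) v \<le> lookup \<nu> v))}"
  define S where "S q = {\<mu>. keys \<mu> \<subseteq> grid m n \<and> wt C \<mu> \<le> q}" for q
  have finS: "finite (S q)" for q
    by (rule finite_subset[OF _ finite_tdeg_le[of "grid m n" q]]) (auto simp: S_def wt_def)
  let ?sp = "\<lambda>q. mp.span ((\<lambda>\<nu>. phi d (mon \<nu>) :: (_, 'k) mpoly) ` {\<nu> \<in> T. wt C \<nu> \<le> q})"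
  have red: "phi d (mon \<mu>) \<in> ?sp (wt C \<mu>)" if "\<mu> \<in> S q" for \<mu> q
    using that
  proof (induction "card {\<nu> \<in> S q. (wt C \<nu>, \<nu>) < (wt C \<mu>, \<mu>)}" arbitrary: \<mu> rule: less_induct)
    case less
    have IH: "phi d (mon \<nu>) \<in> ?sp (wt C \<mu>)" if \<nu>: "keys \<nu> \<subseteq> grid m n" "(wt C \<nu>, \<nu>) < (wt C \<mu>, \<mu>)" for \<nu>
    proof -
      have le: "wt C \<nu> \<le> wt C \<mu>" using \<nu>(2) by auto
      then have S: "\<nu> \<in> S q" using less.prems \<nu>(1) by (auto simp: S_def)
      have "{\<xi> \<in> S q. (wt C \<xi>, \<xi>) < (wt C \<nu>, \<nu>)} \<subset> {\<xi> \<in> S q. (wt C \<xi>, \<xi>) < (wt C \<mu>, \<mu>)}"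
        using S \<nu>(2) less_trans[OF _ \<nu>(2)] by blast
      then have "card {\<xi> \<in> S q. (wt C \<xi>, \<xi>) < (wt C \<nu>, \<nu>)} < card {\<xi> \<in> S q. (wt C \<xi>, \<xi>) < (wt C \<mu>, \<mu>)}"
        using finS by (intro psubset_card_mono) auto
      then have "phi d (mon \<nu>) \<in> ?sp (wt C \<nu>)" using S by (rule less.hyps)
      moreover have "?sp (wt C \<nu>) \<subseteq> ?sp (wt C \<mu>)" using le by (intro mp.span_mono image_mono) auto
      ultimately show ?thesis by blast
    qed
    have muX: "keys \<mu> \<subseteq> grid m n" using less.prems by (simp add: S_def)
    show ?case
    proof (cases "\<mu> \<in> T")
      case True
      then show ?thesis by (intro mp.span_base imageI) simp
    next
      case False
      then obtain U where U: "U \<in> ?Us" "\<forall>v. lookup (lm U) v \<le> lookup \<mu> v" using muX by (auto simp: T_def)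
      define \<sigma> where "\<sigma> = \<mu> - lm U"
      have \<mu>: "\<mu> = \<sigma> + lm U"
        by (rule poly_mapping_eqI) (simp only: \<sigma>_def lookup_add lookup_minus le_add_diff_inverse2[OF U(2)[rule_format]])
      \<comment> \<open>The multiple of \<open>g U\<close> whose leading exponent is
        \<open>\<mu>\<close>.\<close>
      define h where "h = mon \<sigma> * g U"
      have h_idg: "h \<in> idg (kill C ` gen_minors (d + 1) m n)"
        unfolding h_def using g(3)[OF U(1)] by (intro idg_mult) (simp add: det_id_def)
      have "lookup h \<mu> = lookup (g U) (lm U)"
        unfolding h_def lookup_single_mult_exp by (simp add: \<mu> lookup_add)
      then have h\<mu>: "lookup h \<mu> \<noteq> 0" using lm(1)[OF U(1)] by (simp add: in_keys_iff)
      have h_le: "(wt C \<kappa>, \<kappa>) \<le> (wt C \<mu>, \<mu>)" if \<kappa>: "\<kappa> \<in> keys h" for \<kappa>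
      proof -
        from subsetD[OF keys_mult \<kappa>[unfolded h_def]] obtain \<rho> where \<rho>: "\<kappa> = \<sigma> + \<rho>" "\<rho> \<in> keys (g U)"
          by (auto split: if_splits)
        have "(wt C \<rho>, \<rho>) \<le> (wt C (lm U), lm U)" by (rule lm(2)[OF U(1) \<rho>(2)])
        then show ?thesis unfolding \<mu> \<rho>(1) wt_add by auto
      qed
      \<comment> \<open>The lift keeps the top-weight part, so \<open>\<mu>\<close> stays the
        leading exponent, and it now belongs to the generic ideal, which \<open>phi\<close> sends to
        0. Solving for the term at \<open>\<mu>\<close> leaves smaller exponents.\<close>
      obtain g' where g': "g' \<in> idg (gen_minors (d + 1) m n)" "\<And>\<kappa>. wt C \<kappa> = wt C \<mu> \<Longrightarrow> lookup g' \<kappa> = lookup h \<kappa>"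
        "\<And>\<kappa>. wt C \<mu> < wt C \<kappa> \<Longrightarrow> lookup g' \<kappa> = 0"
        using lift_top[OF h_idg, of "wt C \<mu>"] by blast
      \<comment> \<open>An element of \<open>idg\<close> may involve variables outside the grid;
        erasing them preserves the generic minors.\<close>
      define p where "p = kill (- grid m n) g'"
      have p_lookup: "lookup p \<kappa> = (if keys \<kappa> \<subseteq> grid m n then lookup g' \<kappa> else 0)" for \<kappa>
        unfolding p_def lookup_kill by (auto simp: disjoint_eq_subset_Compl)
      have "p \<in> idg (gen_minors (d + 1) m n)" unfolding p_def
      proof (rule idg_hom_image[OF comm_ring_hom_kill g'(1)])
        fix M :: "(_, 'k) mpoly" assume M: "M \<in> gen_minors (d + 1) m n"
        then have "kill (- grid m n) M = M" using gen_minors_polys by (intro kill_id[of _ "grid m n"]) auto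
        then show "kill (- grid m n) M \<in> idg (gen_minors (d + 1) m n)" using M by (simp add: idl.span_base)
      qed
      then have "phi d p = 0" by (rule phi_gen_minors)
      then have "(\<Sum>\<kappa>\<in>keys p. cst (lookup p \<kappa>) * phi d (mon \<kappa>)) = 0"
      proof -
        assume "phi d p = 0"
        moreover have "p = (\<Sum>\<kappa>\<in>keys p. cst (lookup p \<kappa>) * mon \<kappa>)"
          using poly_mapping_sum_single[of p] by (simp add: mult_single)
        then have "phi d p = phi d (\<Sum>\<kappa>\<in>keys p. cst (lookup p \<kappa>) * mon \<kappa>)" by (rule arg_cong)
        ultimately show ?thesis by (simp add: phi.hom_sum phi.hom_mult)
      qed
      moreover have p\<mu>: "lookup p \<mu> \<noteq> 0" using p_lookup[of \<mu>] muX h\<mu> g'(2) by simp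
      then have "(\<Sum>\<kappa>\<in>keys p. cst (lookup p \<kappa>) * phi d (mon \<kappa>)) =
          cst (lookup p \<mu>) * phi d (mon \<mu>) + (\<Sum>\<kappa>\<in>keys p - {\<mu>}. cst (lookup p \<kappa>) * phi d (mon \<kappa>))"
        by (intro sum.remove) (simp_all add: in_keys_iff)
      ultimately have eq: "cst (lookup p \<mu>) * phi d (mon \<mu>) = - (\<Sum>\<kappa>\<in>keys p - {\<mu>}. cst (lookup p \<kappa>) * phi d (mon \<kappa>))"
        by (simp only: eq_neg_iff_add_eq_0)
      have "cst (lookup p \<mu>) * phi d (mon \<mu>) \<in> ?sp (wt C \<mu>)"
        unfolding eq
      proof (intro mp.span_neg mp.span_sum mp.span_scale IH)
        fix \<kappa> assume \<kappa>: "\<kappa> \<in> keys p - {\<mu>}"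
        then have nz: "lookup g' \<kappa> \<noteq> 0" and kX: "keys \<kappa> \<subseteq> grid m n"
          using p_lookup[of \<kappa>] by (auto simp: in_keys_iff split: if_splits)
        show "keys \<kappa> \<subseteq> grid m n" by (rule kX)
        have "wt C \<kappa> \<le> wt C \<mu>" using g'(3)[of \<kappa>] nz by (meson not_less)
        moreover have "(wt C \<kappa>, \<kappa>) \<le> (wt C \<mu>, \<mu>)" if "wt C \<kappa> = wt C \<mu>"
          using g'(2)[OF that] nz h_le[of \<kappa>] by (simp add: in_keys_iff)
        ultimately show "(wt C \<kappa>, \<kappa>) < (wt C \<mu>, \<mu>)" using \<kappa> by (auto simp: order_le_less)
      qed
      then have "cst (inverse (lookup p \<mu>)) * (cst (lookup p \<mu>) * phi d (mon \<mu>)) \<in> ?sp (wt C \<mu>)"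
        by (rule mp.span_scale)
      moreover have "cst (inverse (lookup p \<mu>)) * (cst (lookup p \<mu>) * phi d (mon \<mu>)) = phi d (mon \<mu>)"
        unfolding mult.assoc[symmetric] using p\<mu> by (simp add: mult_single)
      ultimately show ?thesis by simp
    qed
  qed
  have finU: "finite ?Us" by (rule finite_subset[of _ "Pow (grid m n)"]) auto
  define c where "c = Suc (\<Sum>U\<in>?Us. tdeg (lm U))"
  have lm_c: "lookup (lm U) v < c" if "U \<in> ?Us" for U v
  proof -
    have "tdeg (lm U) \<le> (\<Sum>U\<in>?Us. tdeg (lm U))" by (rule member_le_sum) (use that finU in auto)
    then show ?thesis using lookup_le_tdeg[of "lm U" v] by (simp add: c_def)
  qed
  \<comment> \<open>If \<open>r\<close> entries of \<open>\<nu>\<close> were at least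
    \<open>c\<close>, their cells would form one of the sets \<open>U\<close>. The leading exponent
    of \<open>g U\<close> is supported there with entries below \<open>c\<close>, so it would divide
    \<open>\<nu>\<close>.\<close>
  have sparse: "card {v \<in> grid m n. c \<le> lookup \<nu> v} < r" if \<nu>: "\<nu> \<in> T" for \<nu>
  proof (rule ccontr)
    assume "\<not> ?thesis"
    then obtain U where U: "U \<subseteq> {v \<in> grid m n. c \<le> lookup \<nu> v}" "card U = r"
      by (meson not_less obtain_subset_with_card_n)
    then have Us: "U \<in> ?Us" by auto
    have "lookup (lm U) v \<le> lookup \<nu> v" for v
    proof (cases "v \<in> keys (lm U)")
      case True
      then have "v \<in> U" using polysD[OF g(2)[OF Us] lm(1)[OF Us]] by blast
      then have "c \<le> lookup \<nu> v" using U(1) by blast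
      then show ?thesis using lm_c[OF Us, of v] by simp
    qed (simp add: in_keys_iff)
    then show False using \<nu> Us unfolding T_def by blast
  qed
  show False
  \<comment> \<open>Treated apart because \<open>r - 1\<close> truncates: for \<open>r = 0\<close>
    the set \<open>T\<close> is empty, and 1 would lie in the span of nothing.\<close>
  proof (cases "r = 0")
    case True
    then have "T = {}" using sparse by auto
    then have "phi d (mon 0) \<in> mp.span ({} :: (_, 'k) mpoly set)" using red[of 0 0] by (simp add: S_def wt_def rest_0)
    then show False by simp
  next
    case False
    let ?hook = "{v \<in> grid m n. fst v < d \<or> snd v < d}"
    have fin: "finite ?hook" by (rule finite_subset[of _ "grid m n"]) auto
    obtain u where u: "bij_betw u {..<r} ?hook"
      using ex_bij_betw_nat_finite[OF fin] by (auto simp: atLeast0LessThan r_def)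
    \<comment> \<open>The \<open>r\<close> variables of the hook are independent under
      \<open>phi\<close>, but exponents in \<open>T\<close> are large at no more than
      \<open>r - 1\<close> cells.\<close>
    have "r \<le> r - 1"
    proof (rule independent_le_growth[where \<Phi> = "phi d :: (_, 'k) mpoly \<Rightarrow> _" and X = "grid m n"
          and T = T and c = c and h = "\<lambda>i. vr (u i)", OF comm_ring_hom_phi])
      show "phi d (mon \<mu>) \<in> mp.span ((\<lambda>\<nu>. phi d (mon \<nu>) :: (_, 'k) mpoly) ` {\<nu> \<in> T. tdeg \<nu> \<le> 2 * tdeg \<mu>})"
        if "keys \<mu> \<subseteq> grid m n" for \<mu>
      proof -
        have "{\<nu> \<in> T. wt C \<nu> \<le> wt C \<mu>} \<subseteq> {\<nu> \<in> T. tdeg \<nu> \<le> 2 * tdeg \<mu>}"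
          using wt_le[of C \<mu>] by (auto simp: wt_def)
        note sub = subsetD[OF mp.span_mono[OF image_mono[OF this]]]
        show ?thesis by (rule sub, rule red[of \<mu> "wt C \<mu>"]) (use that in \<open>simp add: S_def\<close>)
      qed
      show "keys \<nu> \<subseteq> grid m n \<and> (\<exists>Z\<subseteq>grid m n. card Z \<le> r - 1 \<and> (\<forall>v\<in>grid m n - Z. lookup \<nu> v < c))"
        if "\<nu> \<in> T" for \<nu>
        using that sparse[OF that] by (intro conjI exI[of _ "{v \<in> grid m n. c \<le> lookup \<nu> v}"]) (auto simp: T_def)
      show "vr (u i) \<in> polys (grid m n)" if "i < r" for i
        using bij_betw_apply[OF u, of i] that by simp
      fix H :: "(nat, 'k) mpoly"
      assume H: "H \<in> polys {..<r}" "phi d (ev cst (\<lambda>i. vr (u i)) H) = 0"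
      have "ev cst (\<lambda>i. vr (u i)) H \<in> polys ?hook"
        using H(1) by (rule ev_in_polys) (use bij_betw_apply[OF u] in simp)
      then have "ev cst (\<lambda>i. vr (u i)) H = 0" using H(2) by (rule hook_indep)
      then show "H = 0" using u H(1) by (intro rename_zero[of u "{..<r}"]) (auto simp: bij_betw_def)
    qed simp_all
    then show False using False by simp
  qed
qed

lemma height_det_id_le:
  "ideal_height (poly_ring TYPE('k) (grid m n)) (det_id d m n C :: (_, 'k::field_char_0) mpoly set) \<le>
     enat (m * n - card {v \<in> grid m n. fst v < d \<or> snd v < d})"
proof -
  obtain U where U: "U \<subseteq> grid m n" "card U = card {v \<in> grid m n. fst v < d \<or> snd v < d}"
    "polys U \<inter> det_id d m n C \<subseteq> {0 :: (_, 'k) mpoly}"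
    using exists_indep_set[where 'k = 'k and d = d and m = m and n = n and C = C] by (elim exE conjE)
  show ?thesis using ideal_height_le[OF _ pideal_det_id U(1,3), where K = "TYPE('k)"] U(2) by simp
qed

section \<open>Regular sequences are quasi-regular\<close>

definition is_form :: "nat \<Rightarrow> nat \<Rightarrow> ((nat, 'a::comm_ring_1) mpoly) \<Rightarrow> bool" where
  "is_form s k F \<longleftrightarrow> (\<forall>\<mu>. lookup F \<mu> \<noteq> 0 \<longrightarrow> keys \<mu> \<subseteq> {..<s} \<and> tdeg \<mu> = k)"

abbreviation evalf :: "(nat \<Rightarrow> 'a) \<Rightarrow> ((nat, 'a::comm_ring_1) mpoly) \<Rightarrow> 'a" where
  "evalf g \<equiv> ev (\<lambda>x. x) g"

text \<open>The \<open>k\<close>-th power of the ideal generated by \<open>g 0\<close>, ...,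
  \<open>g (s - 1)\<close>, written as the set of values of forms; for \<open>k = 0\<close> it is
  the whole ring.\<close>

definition ipow :: "(nat \<Rightarrow> 'a::comm_ring_1) \<Rightarrow> nat \<Rightarrow> nat \<Rightarrow> 'a set" where
  "ipow g s k = {evalf g F | F. is_form s k F}"

lemma comm_ring_hom_evalf: "comm_ring_hom (evalf g)"
  by (rule comm_ring_hom_ev[OF comm_ring_hom_id])

lemma evalf_single: "evalf g (single \<mu> c) = c * evm g \<mu>"
  by (rule ev_single[OF comm_ring_hom_id])

lemma is_form_zero [simp]: "is_form s k 0"
  by (simp add: is_form_def)

lemma is_form_add: "is_form s k F \<Longrightarrow> is_form s k G \<Longrightarrow> is_form s k (F + G)"
  unfolding is_form_def lookup_add by (metis add_0)

lemma is_form_sum: "(\<And>i. i \<in> A \<Longrightarrow> is_form s k (F i)) \<Longrightarrow> is_form s k (sum F A)"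
  by (induction A rule: infinite_finite_induct) (auto intro: is_form_add)

lemma is_form_uminus: "is_form s k F \<Longrightarrow> is_form s k (- F)"
  by (simp add: is_form_def)

lemma is_form_diff: "is_form s k F \<Longrightarrow> is_form s k G \<Longrightarrow> is_form s k (F - G)"
  using is_form_add[of s k F "- G"] is_form_uminus[of s k G] by simp

lemma is_form_cst_mult: "is_form s k F \<Longrightarrow> is_form s k (cst c * F)"
  unfolding is_form_def lookup_single_mult by (metis mult_zero_right)

lemma is_form_single: "keys \<mu> \<subseteq> {..<s} \<Longrightarrow> tdeg \<mu> = k \<Longrightarrow> is_form s k (single \<mu> c)"
  by (simp add: is_form_def lookup_single when_def)

lemma is_form_polys: "is_form s k F \<Longrightarrow> F \<in> polys {..<s}"
  by (rule polysI) (simp add: is_form_def in_keys_iff)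

lemma ipow_add: "x \<in> ipow g s k \<Longrightarrow> y \<in> ipow g s k \<Longrightarrow> x + y \<in> ipow g s k"
proof -
  interpret comm_ring_hom "evalf g" by (rule comm_ring_hom_evalf)
  assume "x \<in> ipow g s k" "y \<in> ipow g s k"
  then obtain F G where "x = evalf g F" "is_form s k F" "y = evalf g G" "is_form s k G"
    by (auto simp: ipow_def)
  then show ?thesis unfolding ipow_def
    by (intro CollectI exI[of _ "F + G"]) (simp add: hom_add is_form_add)
qed

lemma ipow_zero: "0 \<in> ipow g s k"
  unfolding ipow_def using is_form_zero by (auto intro!: exI[of _ 0] simp: ev_def)

lemma ipow_uminus: "x \<in> ipow g s k \<Longrightarrow> - x \<in> ipow g s k"
proof -
  interpret comm_ring_hom "evalf g" by (rule comm_ring_hom_evalf)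
  assume "x \<in> ipow g s k"
  then obtain F where "x = evalf g F" "is_form s k F" by (auto simp: ipow_def)
  then show ?thesis unfolding ipow_def
    by (intro CollectI exI[of _ "- F"]) (simp add: hom_uminus is_form_uminus)
qed

lemma ipow_sum: "(\<And>i. i \<in> A \<Longrightarrow> f i \<in> ipow g s k) \<Longrightarrow> sum f A \<in> ipow g s k"
  by (induction A rule: infinite_finite_induct) (auto intro: ipow_add ipow_zero)

lemma ipow_single: "keys \<mu> \<subseteq> {..<s} \<Longrightarrow> tdeg \<mu> = k \<Longrightarrow> c * evm g \<mu> \<in> ipow g s k"
  unfolding ipow_def by (intro CollectI exI[of _ "single \<mu> c"]) (simp add: evalf_single is_form_single)

text \<open>One factor \<open>g i\<close> of every monomial is moved into its coefficient;
  \<open>ideal_coeffs_form\<close> moves it back.\<close>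

lemma form_ideal_coeffs:
  assumes "y \<in> ipow g s (Suc k)"
  shows "\<exists>F. is_form s k F \<and> (\<forall>\<mu>. lookup F \<mu> \<in> idg (g ` {..<s})) \<and> evalf g F = y"
proof -
  interpret comm_ring_hom "evalf g" by (rule comm_ring_hom_evalf)
  obtain F where F: "is_form s (Suc k) F" "y = evalf g F" using assms by (auto simp: ipow_def)
  have single: "\<exists>G. is_form s k G \<and> (\<forall>\<nu>. lookup G \<nu> \<in> idg (g ` {..<s})) \<and> evalf g G = evalf g (single \<mu> (lookup F \<mu>))" for \<mu>
  proof (cases "lookup F \<mu> = 0")
    case True
    then show ?thesis by (intro exI[of _ 0]) (simp add: idl.span_zero)
  next
    case False
    then have \<mu>: "keys \<mu> \<subseteq> {..<s}" "tdeg \<mu> = Suc k" using F(1) by (auto simp: is_form_def)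
    then have "\<mu> \<noteq> 0" by auto
    then obtain i where i: "i \<in> keys \<mu>" using keys_eq_empty by blast
    define \<nu> where "\<nu> = \<mu> - single i (Suc 0)"
    have eq: "\<mu> = single i (Suc 0) + \<nu>"
      using i by (intro poly_mapping_eqI) (auto simp: \<nu>_def lookup_add lookup_minus lookup_single when_def in_keys_iff)
    let ?G = "single \<nu> (lookup F \<mu> * g i)"
    have "keys \<nu> \<subseteq> {..<s}" "tdeg \<nu> = k" using \<mu> by (simp_all add: eq keys_add_nat tdeg_add)
    then have "is_form s k ?G" by (rule is_form_single)
    moreover have "lookup F \<mu> * g i \<in> idg (g ` {..<s})"
      using i \<mu>(1) by (intro idg_mult idl.span_base imageI) auto
    then have "\<forall>\<xi>. lookup ?G \<xi> \<in> idg (g ` {..<s})" by (simp add: lookup_single when_def idl.span_zero)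
    moreover have "evalf g ?G = evalf g (single \<mu> (lookup F \<mu>))"
      unfolding evalf_single by (subst (3) eq) (simp only: evm_add evm_single power_Suc0_right mult.assoc)
    ultimately show ?thesis by blast
  qed
  then have "\<forall>\<mu>. \<exists>G. is_form s k G \<and> (\<forall>\<nu>. lookup G \<nu> \<in> idg (g ` {..<s})) \<and> evalf g G = evalf g (single \<mu> (lookup F \<mu>))"
    by blast
  from choice[OF this] obtain G where G: "\<And>\<mu>. is_form s k (G \<mu>)"
    "\<And>\<mu> \<nu>. lookup (G \<mu>) \<nu> \<in> idg (g ` {..<s})" "\<And>\<mu>. evalf g (G \<mu>) = evalf g (single \<mu> (lookup F \<mu>))" by blast
  show ?thesis
  proof (intro exI[of _ "\<Sum>\<mu>\<in>keys F. G \<mu>"] conjI allI)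
    show "is_form s k (sum G (keys F))" by (rule is_form_sum) (rule G)
    show "lookup (sum G (keys F)) \<mu> \<in> idg (g ` {..<s})" for \<mu>
      unfolding lookup_sum by (intro idl.span_sum G)
    have "evalf g (sum G (keys F)) = evalf g (\<Sum>\<mu>\<in>keys F. single \<mu> (lookup F \<mu>))"
      unfolding hom_sum G(3) ..
    then show "evalf g (sum G (keys F)) = y" using F(2) poly_mapping_sum_single[of F] by simp
  qed
qed

lemma ideal_coeffs_form:
  assumes F: "is_form s k F" "\<And>\<mu>. lookup F \<mu> \<in> idg (g ` {..<s})"
  shows "evalf g F \<in> ipow g s (Suc k)"
proof -
  interpret comm_ring_hom "evalf g" by (rule comm_ring_hom_evalf)
  have "evalf g F = evalf g (\<Sum>\<mu>\<in>keys F. single \<mu> (lookup F \<mu>))"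
    using poly_mapping_sum_single[of F] by simp
  also have "\<dots> = (\<Sum>\<mu>\<in>keys F. lookup F \<mu> * evm g \<mu>)" by (simp add: hom_sum evalf_single)
  also have "\<dots> \<in> ipow g s (Suc k)"
  proof (rule ipow_sum)
    fix \<mu> assume "\<mu> \<in> keys F"
    then have \<mu>: "keys \<mu> \<subseteq> {..<s}" "tdeg \<mu> = k" using F(1) by (auto simp: is_form_def in_keys_iff)
    obtain c where c: "lookup F \<mu> = (\<Sum>i<s. c i * g i)" using idg_imageD[OF F(2)] by blast
    have "lookup F \<mu> * evm g \<mu> = (\<Sum>i<s. c i * evm g (single i (Suc 0) + \<mu>))"
      unfolding c sum_distrib_right by (simp only: evm_add evm_single power_Suc0_right mult.assoc)
    also have "\<dots> \<in> ipow g s (Suc k)"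
      using \<mu> by (intro ipow_sum ipow_single) (auto simp: keys_add_nat tdeg_add)
    finally show "lookup F \<mu> * evm g \<mu> \<in> ipow g s (Suc k)" .
  qed
  finally show ?thesis .
qed

lemma ipow_Suc_subset: "ipow g s (Suc k) \<subseteq> ipow g s k"
proof
  fix y assume "y \<in> ipow g s (Suc k)"
  from form_ideal_coeffs[OF this] show "y \<in> ipow g s k" unfolding ipow_def by blast
qed

lemma ipow_antimono: "k \<le> l \<Longrightarrow> ipow g s l \<subseteq> ipow g s k"
  by (induction l rule: dec_induct) (use ipow_Suc_subset in blast)+

lemma ipow_mono_vars: "ipow g s k \<subseteq> ipow g (Suc s) k"
proof -
  have "is_form s k F \<Longrightarrow> is_form (Suc s) k F" for F :: "(nat, 'a) mpoly"
    unfolding is_form_def by (metis lessThan_subset_iff order_trans less_imp_le lessI)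
  then show ?thesis by (auto simp: ipow_def)
qed

lemma idg_mono_vars: "a \<in> idg (g ` {..<s}) \<Longrightarrow> a \<in> idg (g ` {..<Suc s})"
  using idl.span_mono[of "g ` {..<s}" "g ` {..<Suc s}"] by (auto simp: image_mono)

text \<open>Equivalently, the associated graded ring of the ideal is a polynomial ring over the
  quotient. In contrast to regularity, the order of the sequence does not matter.\<close>

definition quasi_regular :: "(nat \<Rightarrow> 'a::comm_ring_1) \<Rightarrow> nat \<Rightarrow> bool" where
  "quasi_regular g s \<longleftrightarrow> (\<forall>k F. is_form s k F \<longrightarrow> evalf g F \<in> ipow g s (Suc k) \<longrightarrow>
     (\<forall>\<mu>. lookup F \<mu> \<in> idg (g ` {..<s})))"

lemma quasi_regularI:
  assumes "\<And>k F. is_form s k F \<Longrightarrow> evalf g F = 0 \<Longrightarrow> \<forall>\<mu>. lookup F \<mu> \<in> idg (g ` {..<s})"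
  shows "quasi_regular g s"
  unfolding quasi_regular_def
proof (intro allI impI)
  fix k F \<mu> assume F: "is_form s k F" "evalf g F \<in> ipow g s (Suc k)"
  interpret comm_ring_hom "evalf g" by (rule comm_ring_hom_evalf)
  obtain G where G: "is_form s k G" "\<forall>\<mu>. lookup G \<mu> \<in> idg (g ` {..<s})" "evalf g G = evalf g F"
    using form_ideal_coeffs[OF F(2)] by blast
  have "\<forall>\<mu>. lookup (F - G) \<mu> \<in> idg (g ` {..<s})"
    using assms[OF is_form_diff[OF F(1) G(1)]] G(3) by (simp add: hom_minus)
  then have "lookup (F - G) \<mu> + lookup G \<mu> \<in> idg (g ` {..<s})" using G(2) by (intro idl.span_add) auto
  then show "lookup F \<mu> \<in> idg (g ` {..<s})" by (simp add: lookup_minus)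
qed

text \<open>A nonzerodivisor modulo the ideal stays one modulo its powers: write \<open>a\<close> as
  the value of a form of degree \<open>k\<close>; if \<open>x * a\<close> lies in the next power,
  the coefficients times \<open>x\<close> lie in the ideal, hence so do the coefficients.\<close>

lemma quasi_regular_nonzerodivisor:
  assumes q: "quasi_regular g s" and x: "\<And>a. x * a \<in> idg (g ` {..<s}) \<Longrightarrow> a \<in> idg (g ` {..<s})"
  shows "x * a \<in> ipow g s k \<Longrightarrow> a \<in> ipow g s k"
proof (induction k arbitrary: a)
  case 0
  have "1 * a \<in> ipow g s 0" using ipow_single[of 0 s 0 a g] by simp
  then show ?case by simp
next
  case (Suc k)
  interpret comm_ring_hom "evalf g" by (rule comm_ring_hom_evalf)
  have "a \<in> ipow g s k" using Suc ipow_Suc_subset by blast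
  then obtain F where F: "a = evalf g F" "is_form s k F" by (auto simp: ipow_def)
  have "evalf g (cst x * F) \<in> ipow g s (Suc k)" using Suc.prems F(1) by (simp add: hom_mult evalf_single)
  then have "\<forall>\<mu>. lookup (cst x * F) \<mu> \<in> idg (g ` {..<s})"
    using q is_form_cst_mult[OF F(2)] unfolding quasi_regular_def by blast
  then have "lookup F \<mu> \<in> idg (g ` {..<s})" for \<mu> using x by (simp add: lookup_single_mult)
  then show ?case unfolding F(1) by (rule ideal_coeffs_form[OF F(2)])
qed

text \<open>Induction on \<open>s\<close> and, inside, on the degree. A form vanishing at
  \<open>g\<close> is split as \<open>G + vr s * H\<close> with \<open>G\<close> free of the last
  variable; \<open>H\<close> falls to the induction on the degree, and \<open>G\<close> to that on
  \<open>s\<close>.\<close>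

lemma regular_imp_quasi_regular:
  assumes "\<And>i a. i < s \<Longrightarrow> g i * a \<in> idg (g ` {..<i}) \<Longrightarrow> a \<in> idg (g ` {..<i})"
  shows "quasi_regular g s"
  using assms
proof (induction s)
  case 0
  show ?case
  proof (rule quasi_regularI, rule allI)
    fix k F \<mu> assume F: "is_form 0 k F" "evalf g F = 0"
    have F0: "F = cst (lookup F 0)"
    proof (rule poly_mapping_eqI)
      fix \<nu> show "lookup F \<nu> = lookup (cst (lookup F 0)) \<nu>"
        using F(1) by (cases "\<nu> = 0") (auto simp: is_form_def lookup_single when_def)
    qed
    have "evalf g (cst (lookup F 0)) = lookup F 0" by (simp add: evalf_single)
    then have "lookup F 0 = 0" using F(2) F0 by metis
    then have "F = 0" using F0 by simp
    then show "lookup F \<mu> \<in> idg (g ` {..<0})" by (simp add: idl.span_zero)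
  qed
next
  case (Suc s)
  let ?I = "idg (g ` {..<s})" and ?J = "idg (g ` {..<Suc s})"
  interpret comm_ring_hom "evalf g" by (rule comm_ring_hom_evalf)
  have q: "quasi_regular g s" using Suc by simp
  note reg = Suc.prems
  have main: "\<forall>\<mu>. lookup F \<mu> \<in> ?J" if "is_form (Suc s) k F" "evalf g F \<in> ipow g (Suc s) (Suc k)" for k F
    using that
  proof (induction k arbitrary: F)
    case 0
    obtain G where G: "is_form (Suc s) 0 G" "\<forall>\<mu>. lookup G \<mu> \<in> ?J" "evalf g G = evalf g F"
      using form_ideal_coeffs[OF "0.prems"(2)] by blast
    have cst: "H = cst (lookup H 0)" if H: "is_form (Suc s) 0 H" for H :: "(nat, 'a) mpoly"
    proof (rule poly_mapping_eqI)
      fix \<nu> show "lookup H \<nu> = lookup (cst (lookup H 0)) \<nu>"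
        using H by (cases "\<nu> = 0") (auto simp: is_form_def lookup_single when_def tdeg_eq_0)
    qed
    have ev_c: "evalf g H = lookup H 0" if H: "is_form (Suc s) 0 H" for H
      by (subst cst[OF H]) (simp add: evalf_single)
    have "lookup F 0 = lookup G 0" using ev_c[OF "0.prems"(1)] ev_c[OF G(1)] G(3) by simp
    then have "F = G" using cst[OF "0.prems"(1)] cst[OF G(1)] by simp
    then show ?case using G(2) by simp
  next
    case (Suc k)
    obtain F' where F': "is_form (Suc s) (Suc k) F'" "\<forall>\<mu>. lookup F' \<mu> \<in> ?J" "evalf g F' = evalf g F"
      using form_ideal_coeffs[OF Suc.prems(2)] by blast
    let ?D = "F - F'"
    have D: "is_form (Suc s) (Suc k) ?D" by (rule is_form_diff[OF Suc.prems(1) F'(1)])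
    have D0: "evalf g ?D = 0" using F'(3) by (simp add: hom_minus)
    obtain G H where GH: "?D = G + vr s * H"
      "\<And>\<mu>. lookup \<mu> s \<noteq> 0 \<Longrightarrow> lookup G \<mu> = 0"
      "\<And>\<mu>. lookup \<mu> s = 0 \<Longrightarrow> lookup G \<mu> = lookup ?D \<mu>"
      "\<And>\<mu>. lookup H \<mu> = lookup ?D (single s (Suc 0) + \<mu>)"
      using split_var[of ?D s] by blast
    have G: "is_form s (Suc k) G" unfolding is_form_def
    proof (intro allI impI)
      fix \<mu> assume m: "lookup G \<mu> \<noteq> 0"
      then have ms: "lookup \<mu> s = 0" using GH(2) by blast
      then have "lookup ?D \<mu> \<noteq> 0" using m GH(3) by simp
      then have "keys \<mu> \<subseteq> {..<Suc s}" "tdeg \<mu> = Suc k" using D unfolding is_form_def by blast+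
      moreover have "s \<notin> keys \<mu>" using ms by (simp add: in_keys_iff)
      ultimately show "keys \<mu> \<subseteq> {..<s} \<and> tdeg \<mu> = Suc k" by (auto simp: less_Suc_eq subset_iff)
    qed
    have H: "is_form (Suc s) k H" unfolding is_form_def
    proof (intro allI impI)
      fix \<mu> assume "lookup H \<mu> \<noteq> 0"
      then have "keys (single s (Suc 0) + \<mu>) \<subseteq> {..<Suc s}" "tdeg (single s (Suc 0) + \<mu>) = Suc k"
        using D GH(4) unfolding is_form_def by (metis, metis)
      then show "keys \<mu> \<subseteq> {..<Suc s} \<and> tdeg \<mu> = k" by (simp add: keys_add_nat tdeg_add)
    qed
    have sum0: "evalf g G + g s * evalf g H = 0"
      using D0 unfolding GH(1) by (simp add: hom_add hom_mult evalf_single)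
    have "evalf g G \<in> ipow g s (Suc k)" using G by (auto simp: ipow_def)
    then have "- evalf g G \<in> ipow g s (Suc k)" by (rule ipow_uminus)
    moreover have "- evalf g G = g s * evalf g H" using sum0 by (simp only: neg_eq_iff_add_eq_0)
    ultimately have gH: "g s * evalf g H \<in> ipow g s (Suc k)" by simp
    \<comment> \<open>\<open>g s\<close> is a nonzerodivisor modulo the ideal of its predecessors,
      hence modulo the powers of that ideal.\<close>
    have Hs: "evalf g H \<in> ipow g s (Suc k)"
      by (rule quasi_regular_nonzerodivisor[OF q _ gH]) (rule reg[OF lessI])
    then have "evalf g H \<in> ipow g (Suc s) (Suc k)" using ipow_mono_vars by blast
    then have HJ: "\<forall>\<mu>. lookup H \<mu> \<in> ?J" by (rule Suc.IH[OF H])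
    obtain h where h: "evalf g H = evalf g h" "is_form s (Suc k) h" using Hs by (auto simp: ipow_def)
    \<comment> \<open>Replacing the value of \<open>H\<close> by a form \<open>h\<close> of one
      degree more in the first \<open>s\<close> variables makes the relation homogeneous without the
      last variable.\<close>
    have "evalf g (G + cst (g s) * h) = 0" using sum0 h(1) by (simp add: hom_add hom_mult evalf_single)
    then have "evalf g (G + cst (g s) * h) \<in> ipow g s (Suc (Suc k))" by (simp add: ipow_zero)
    then have "\<forall>\<mu>. lookup (G + cst (g s) * h) \<mu> \<in> ?I"
      using q is_form_add[OF G is_form_cst_mult[OF h(2)]] unfolding quasi_regular_def by blast
    then have "lookup G \<mu> + g s * lookup h \<mu> \<in> ?I" for \<mu>
      by (simp add: lookup_add lookup_single_mult)
    then have Gh: "lookup G \<mu> + g s * lookup h \<mu> \<in> ?J" for \<mu> by (rule idg_mono_vars)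
    have gJ: "lookup h \<mu> * g s \<in> ?J" for \<mu> by (intro idg_mult idl.span_base) auto
    have GJ: "lookup G \<mu> \<in> ?J" for \<mu>
      using idl.span_diff[OF Gh gJ, of \<mu> \<mu>] by (simp add: mult.commute)
    have DJ: "lookup ?D \<mu> \<in> ?J" for \<mu>
    proof (cases "lookup \<mu> s = 0")
      case True
      then show ?thesis using GH(3) GJ by metis
    next
      case False
      then have "\<mu> = single s (Suc 0) + (\<mu> - single s (Suc 0))"
        by (auto intro!: poly_mapping_eqI simp: lookup_add lookup_minus lookup_single when_def)
      then show ?thesis using GH(4) HJ by metis
    qed
    show ?case
    proof
      fix \<mu>
      have "lookup ?D \<mu> + lookup F' \<mu> \<in> ?J" using DJ F'(2) by (intro idl.span_add) auto
      then show "lookup F \<mu> \<in> ?J" by (simp add: lookup_minus)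
    qed
  qed
  then show ?case unfolding quasi_regular_def by blast
qed

section \<open>Change of generators\<close>

lemma prod_cong_idg:
  assumes "\<And>i. i \<in> A \<Longrightarrow> f i - h i \<in> idg J"
  shows "prod f A - prod h A \<in> idg J"
  using assms
proof (induction A rule: infinite_finite_induct)
  case (insert x A)
  have "f x * prod f A - h x * prod h A = f x * (prod f A - prod h A) + prod h A * (f x - h x)"
    by (simp add: algebra_simps)
  moreover have "f x * (prod f A - prod h A) + prod h A * (f x - h x) \<in> idg J"
    using insert by (intro idl.span_add idg_mult) auto
  ultimately show ?case using insert by simp
qed (simp_all add: idl.span_zero)

lemma det_cong_idg:
  assumes A: "A \<in> carrier_mat n n" and B: "B \<in> carrier_mat n n"
    and AB: "\<And>i j. i < n \<Longrightarrow> j < n \<Longrightarrow> A $$ (i, j) - B $$ (i, j) \<in> idg J"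
  shows "det A - det B \<in> idg J"
proof -
  have "det A - det B = (\<Sum>p | p permutes {0..<n}. signof p * ((\<Prod>i=0..<n. A $$ (i, p i)) - (\<Prod>i=0..<n. B $$ (i, p i))))"
    unfolding det_def'[OF A] det_def'[OF B] sum_subtractf[symmetric] right_diff_distrib ..
  also have "\<dots> \<in> idg J"
  proof (intro idl.span_sum idg_mult prod_cong_idg AB)
    fix p i assume "p \<in> {p. p permutes {0..<n}}" "i \<in> {0..<n}"
    then show "i < n" "p i < n" using permutes_in_image[of p "{0..<n}" i] by auto
  qed
  finally show ?thesis .
qed

text \<open>If \<open>f\<close> is obtained from \<open>g\<close> by the matrix \<open>M\<close>,
  this turns a form evaluated at \<open>f\<close> into one of the same degree evaluated at
  \<open>g\<close>.\<close>

definition lin_subst :: "nat \<Rightarrow> (nat \<Rightarrow> nat \<Rightarrow> 'a) \<Rightarrow> ((nat, 'a::comm_ring_1) mpoly) \<Rightarrow> (nat, 'a) mpoly" where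
  "lin_subst s M = ev cst (\<lambda>j. \<Sum>i<s. cst (M j i) * vr i)"

lemma comm_ring_hom_lin_subst: "comm_ring_hom (lin_subst s M)"
  unfolding lin_subst_def by (rule comm_ring_hom_ev[OF comm_ring_hom_cst])

lemma lin_subst_cst: "lin_subst s M (cst c) = cst c"
  by (simp add: lin_subst_def ev_single comm_ring_hom_cst)

lemma lin_subst_vr: "lin_subst s M (vr j) = (\<Sum>i<s. cst (M j i) * vr i)"
  by (simp add: lin_subst_def ev_single comm_ring_hom_cst)

lemma is_form_vr_mult: "i < s \<Longrightarrow> is_form s k F \<Longrightarrow> is_form s (Suc k) (vr i * F)"
  unfolding is_form_def
proof (intro allI impI)
  fix \<mu> assume i: "i < s" and F: "\<forall>\<mu>. lookup F \<mu> \<noteq> 0 \<longrightarrow> keys \<mu> \<subseteq> {..<s} \<and> tdeg \<mu> = k"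
    and nz: "lookup (vr i * F) \<mu> \<noteq> 0"
  have le: "\<forall>v. lookup (single i (Suc 0)) v \<le> lookup \<mu> v" and F\<mu>: "lookup F (\<mu> - single i (Suc 0)) \<noteq> 0"
    using nz unfolding lookup_single_mult_exp by (auto split: if_splits)
  have eq: "\<mu> = single i (Suc 0) + (\<mu> - single i (Suc 0))"
    by (rule poly_mapping_eqI) (simp only: lookup_add lookup_minus le_add_diff_inverse[OF le[rule_format]])
  have *: "keys (\<mu> - single i (Suc 0)) \<subseteq> {..<s}" "tdeg (\<mu> - single i (Suc 0)) = k" using F F\<mu> by blast+
  show "keys \<mu> \<subseteq> {..<s} \<and> tdeg \<mu> = Suc k"
    by (subst (1 2) eq) (use i * in \<open>simp add: keys_add_nat tdeg_add\<close>)
qed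

lemma is_form_lin_subst_mon: "is_form s (tdeg \<mu>) (lin_subst s M (mon \<mu>))"
proof (induction \<mu> rule: exp_induct)
  case zero
  interpret comm_ring_hom "lin_subst s M" by (rule comm_ring_hom_lin_subst)
  show ?case using is_form_single[of 0 s 0 1] by simp
next
  case (add v \<mu>)
  interpret comm_ring_hom "lin_subst s M" by (rule comm_ring_hom_lin_subst)
  have "lin_subst s M (mon (single v (Suc 0) + \<mu>)) = (\<Sum>i<s. cst (M v i) * (vr i * lin_subst s M (mon \<mu>)))"
    unfolding mon_add hom_mult lin_subst_vr sum_distrib_right mult.assoc ..
  moreover have "is_form s (Suc (tdeg \<mu>)) (\<Sum>i<s. cst (M v i) * (vr i * lin_subst s M (mon \<mu>)))"
    by (intro is_form_sum is_form_cst_mult is_form_vr_mult add.IH) simp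
  ultimately show ?case by (simp add: tdeg_add)
qed

lemma lin_subst_expand: "lin_subst s M F = (\<Sum>\<mu>\<in>keys F. cst (lookup F \<mu>) * lin_subst s M (mon \<mu>))"
proof -
  interpret comm_ring_hom "lin_subst s M" by (rule comm_ring_hom_lin_subst)
  have "F = (\<Sum>\<mu>\<in>keys F. cst (lookup F \<mu>) * mon \<mu>)"
    using poly_mapping_sum_single[of F] by (simp add: mult_single)
  then have "lin_subst s M F = lin_subst s M (\<Sum>\<mu>\<in>keys F. cst (lookup F \<mu>) * mon \<mu>)" by (rule arg_cong)
  then show ?thesis by (simp only: hom_sum hom_mult lin_subst_cst)
qed

lemma is_form_lin_subst: "is_form t k F \<Longrightarrow> is_form s k (lin_subst s M F)"
  unfolding lin_subst_expand[of s M F]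
proof (intro is_form_sum is_form_cst_mult)
  fix \<mu> assume "is_form t k F" "\<mu> \<in> keys F"
  then have "tdeg \<mu> = k" by (auto simp: is_form_def in_keys_iff)
  then show "is_form s k (lin_subst s M (mon \<mu>))" using is_form_lin_subst_mon[of s \<mu> M] by simp
qed

lemma lin_subst_coeffs:
  assumes "\<And>\<mu>. lookup F \<mu> \<in> idg J"
  shows "lookup (lin_subst s M F) \<nu> \<in> idg J"
  unfolding lin_subst_expand[of s M F] lookup_sum lookup_single_mult
  by (intro idl.span_sum idg_mult_right assms)

lemma evalf_lin_subst:
  assumes "F \<in> polys {..<t}" "\<And>j. j < t \<Longrightarrow> f j = (\<Sum>i<s. M j i * g i)"
  shows "evalf g (lin_subst s M F) = evalf f F"
proof (rule hom_eq_on_polys[OF comm_ring_hom_compose[OF comm_ring_hom_evalf comm_ring_hom_lin_subst] comm_ring_hom_evalf assms(1)])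
  interpret comm_ring_hom "evalf g" by (rule comm_ring_hom_evalf)
  show "evalf g (lin_subst s M (cst c)) = evalf f (cst c)" for c
    by (simp add: lin_subst_cst evalf_single)
  show "evalf g (lin_subst s M (vr j)) = evalf f (vr j)" if "j \<in> {..<t}" for j
    using assms(2)[of j] that by (simp add: lin_subst_vr hom_sum hom_mult evalf_single)
qed

text \<open>A relation among the new generators becomes one among the old ones, and the adjugate matrix
  undoes the substitution up to a power of the determinant, which is a unit modulo the ideal.\<close>

lemma quasi_regular_change:
  assumes q: "quasi_regular g s"
    and f: "\<And>j. j < s \<Longrightarrow> f j = (\<Sum>i<s. M j i * g i)"
    and NM: "\<And>i k. i < s \<Longrightarrow> k < s \<Longrightarrow> (\<Sum>j<s. N i j * M j k) - (if i = k then 1 else 0) \<in> idg (g ` {..<s})"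
    and F: "is_form s k F" and F0: "evalf f F \<in> ipow f s (Suc k)"
  shows "lookup F \<mu> \<in> idg (g ` {..<s})"
proof -
  let ?L = "idg (g ` {..<s})"
  have pow: "ipow f s l \<subseteq> ipow g s l" for l
  proof
    fix y assume "y \<in> ipow f s l"
    then obtain H where H: "y = evalf f H" "is_form s l H" by (auto simp: ipow_def)
    have "evalf g (lin_subst s M H) = y"
      unfolding H(1) by (rule evalf_lin_subst[OF is_form_polys[OF H(2)] f])
    then show "y \<in> ipow g s l" using is_form_lin_subst[OF H(2), of s M] by (auto simp: ipow_def)
  qed
  have "evalf g (lin_subst s M F) = evalf f F" by (rule evalf_lin_subst[OF is_form_polys[OF F] f])
  then have FM: "\<forall>\<mu>. lookup (lin_subst s M F) \<mu> \<in> ?L"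
    using q is_form_lin_subst[OF F, of s M] F0 pow unfolding quasi_regular_def by (metis subsetD)
  define A where "A = mat s s (\<lambda>(j, i). M j i)"
  define B where "B = mat s s (\<lambda>(i, j). N i j)"
  have AB: "A \<in> carrier_mat s s" "B \<in> carrier_mat s s" by (simp_all add: A_def B_def)
  define D where "D = det A"
  \<comment> \<open>By \<open>NM\<close> the product is the identity modulo the ideal, so
    \<open>det B\<close> inverts \<open>D\<close> there.\<close>
  have "det (B * A) - det (1\<^sub>m s) \<in> ?L"
  proof (rule det_cong_idg)
    fix i k assume ik: "i < s" "k < s"
    have "(B * A) $$ (i, k) = (\<Sum>j<s. N i j * M j k)"
      using ik by (simp add: A_def B_def scalar_prod_def atLeast0LessThan)
    then show "(B * A) $$ (i, k) - 1\<^sub>m s $$ (i, k) \<in> ?L" using NM[OF ik] ik by simp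
  qed (use AB in auto)
  then have unit: "det B * D - 1 \<in> ?L" using det_mult[OF AB(2,1)] by (simp add: D_def)
  define P where "P i j = adj_mat A $$ (i, j)" for i j
  have MP: "(\<Sum>i<s. M j i * P i l) = (if j = l then D else 0)" if "j < s" "l < s" for j l
  proof -
    have "(A * adj_mat A) $$ (j, l) = (\<Sum>i<s. M j i * P i l)"
      using that adj_mat(1)[OF AB(1)] by (simp add: A_def P_def scalar_prod_def atLeast0LessThan)
    then show ?thesis unfolding adj_mat(2)[OF AB(1)] using that by (cases "j = l") (simp_all add: D_def)
  qed
  have scale: "lin_subst s P (lin_subst s M H) = lin_subst s (\<lambda>j l. if j = l then D else 0) H"
    if "H \<in> polys {..<s}" for H
  proof (rule hom_eq_on_polys[OF comm_ring_hom_compose[OF comm_ring_hom_lin_subst comm_ring_hom_lin_subst] comm_ring_hom_lin_subst that])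
    interpret comm_ring_hom "lin_subst s P" by (rule comm_ring_hom_lin_subst)
    show "lin_subst s P (lin_subst s M (vr j)) = lin_subst s (\<lambda>j l. if j = l then D else 0) (vr j)" if j: "j \<in> {..<s}" for j
    proof -
      have "lin_subst s P (lin_subst s M (vr j)) = (\<Sum>i<s. cst (M j i) * (\<Sum>l<s. cst (P i l) * vr l))"
        by (simp only: lin_subst_vr hom_sum hom_mult lin_subst_cst)
      also have "\<dots> = (\<Sum>i<s. \<Sum>l<s. single (single l (Suc 0)) (M j i * P i l))"
        by (simp add: sum_distrib_left mult_single)
      also have "\<dots> = (\<Sum>l<s. single (single l (Suc 0)) (\<Sum>i<s. M j i * P i l))"
        unfolding single_sum by (rule sum.swap)
      also have "\<dots> = (\<Sum>l<s. cst (if j = l then D else 0) * vr l)"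
        using MP j by (intro sum.cong) (auto simp: mult_single)
      finally show ?thesis by (simp only: lin_subst_vr)
    qed
  qed (simp add: lin_subst_cst)
  have diag: "lin_subst s (\<lambda>j l. if j = l then D else 0) (mon \<nu>) = single \<nu> (D ^ tdeg \<nu>)" if "keys \<nu> \<subseteq> {..<s}" for \<nu>
    using that
  proof (induction \<nu> rule: exp_induct_on)
    case zero
    interpret comm_ring_hom "lin_subst s (\<lambda>j l. if j = l then D else 0)" by (rule comm_ring_hom_lin_subst)
    show ?case by simp
  next
    case (add v \<nu>)
    interpret comm_ring_hom "lin_subst s (\<lambda>j l. if j = l then D else 0)" by (rule comm_ring_hom_lin_subst)
    have "lin_subst s (\<lambda>j l. if j = l then D else 0) (vr v) = (\<Sum>l<s. if l = v then single (single v (Suc 0)) D else 0)"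
      unfolding lin_subst_vr by (intro sum.cong) (auto simp: mult_single)
    also have "\<dots> = single (single v (Suc 0)) D" using add.hyps by (simp add: sum.delta)
    finally show ?case unfolding mon_add hom_mult add.IH by (simp add: mult_single tdeg_add)
  qed
  have "lookup (lin_subst s (\<lambda>j l. if j = l then D else 0) F) \<mu> = D ^ k * lookup F \<mu>"
  proof -
    have "lin_subst s (\<lambda>j l. if j = l then D else 0) F = (\<Sum>\<nu>\<in>keys F. single \<nu> (lookup F \<nu> * D ^ k))"
      unfolding lin_subst_expand[of s _ F]
    proof (intro sum.cong refl)
      fix \<nu> assume "\<nu> \<in> keys F"
      then have "keys \<nu> \<subseteq> {..<s}" "tdeg \<nu> = k" using F by (auto simp: is_form_def in_keys_iff)
      then show "cst (lookup F \<nu>) * lin_subst s (\<lambda>j l. if j = l then D else 0) (mon \<nu>) = single \<nu> (lookup F \<nu> * D ^ k)"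
        by (simp add: diag mult_single)
    qed
    also have "\<dots> = cst (D ^ k) * (\<Sum>\<nu>\<in>keys F. single \<nu> (lookup F \<nu>))"
      unfolding sum_distrib_left mult_single by (simp only: add_0 mult.commute)
    also have "\<dots> = cst (D ^ k) * F" using poly_mapping_sum_single[of F] by simp
    finally show ?thesis by (simp only: lookup_single_mult)
  qed
  moreover have "lookup (lin_subst s P (lin_subst s M F)) \<mu> \<in> ?L" by (rule lin_subst_coeffs) (use FM in blast)
  ultimately have "D ^ k * lookup F \<mu> \<in> ?L" by (simp only: scale[OF is_form_polys[OF F]])
  then have 1: "(det B ^ k) * (D ^ k * lookup F \<mu>) \<in> ?L" by (rule idg_mult)
  have "(\<Prod>i<k. det B * D) - (\<Prod>i<k. 1) \<in> ?L" by (rule prod_cong_idg) (rule unit)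
  then have "(det B * D) ^ k - 1 \<in> ?L" by simp
  then have 2: "lookup F \<mu> * ((det B * D) ^ k - 1) \<in> ?L" by (rule idg_mult)
  have "lookup F \<mu> = (det B ^ k) * (D ^ k * lookup F \<mu>) - lookup F \<mu> * ((det B * D) ^ k - 1)"
  proof -
    have "z = x * (y * z) - z * (x * y - 1)" for x y z :: 'a
    proof -
      have "x * (y * z) = z * (x * y)" by (simp only: mult_ac)
      then show ?thesis unfolding right_diff_distrib by simp
    qed
    then show ?thesis unfolding power_mult_distrib .
  qed
  then show ?thesis using idl.span_diff[OF 1 2] by simp
qed

section \<open>Complete intersections\<close>

lemma coeff_idg:
  assumes G: "G \<subseteq> polys Y" and y: "y \<in> idg G"
  shows "lookup (curry_in Y y) \<alpha> \<in> idg G"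
  using y
proof (induction rule: idg_induct)
  case zero
  show ?case by (simp add: idl.span_zero)
next
  case (step b g x)
  have "lookup (curry_in Y (b * g)) \<alpha> = g * lookup (curry_in Y b) \<alpha>"
    using lookup_curry_in_mult_left[of g Y b \<alpha>] step(1) G by (simp only: mult.commute[of b] subsetD)
  moreover have "g * lookup (curry_in Y b) \<alpha> \<in> idg G" by (rule idg_mult_right[OF idl.span_base[OF step(1)]])
  ultimately have "lookup (curry_in Y (b * g)) \<alpha> + lookup (curry_in Y x) \<alpha> \<in> idg G"
    using step(2) by (intro idl.span_add) simp_all
  then show ?case by (simp only: curry_in_add lookup_add)
qed

text \<open>Multiplication by \<open>x\<close> and membership in \<open>idg G\<close> can be tested
  on coefficients over \<open>Y\<close>. This carries regularity from the ring over \<open>Y\<close>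
  to the ring of all variables, where \<open>idg\<close> lives.\<close>

lemma nonzerodivisor_all_vars:
  assumes G: "G \<subseteq> polys Y" and x: "x \<in> polys Y" and nz: "\<And>a. a \<in> polys Y \<Longrightarrow> x * a \<in> idg G \<Longrightarrow> a \<in> idg G"
    and a: "x * a \<in> idg G"
  shows "a \<in> idg G"
proof -
  have "lookup (curry_in Y a) \<alpha> \<in> idg G" for \<alpha>
  proof (rule nz)
    show "lookup (curry_in Y a) \<alpha> \<in> polys Y" using lookup_curry_in_polys[of a UNIV Y \<alpha>] by simp
    show "x * lookup (curry_in Y a) \<alpha> \<in> idg G"
      using coeff_idg[OF G a, of \<alpha>] by (simp only: lookup_curry_in_mult_left[OF x])
  qed
  then have "(\<Sum>\<alpha>\<in>keys (curry_in Y a). mon \<alpha> * lookup (curry_in Y a) \<alpha>) \<in> idg G"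
    by (intro idl.span_sum idg_mult)
  then show ?thesis using uncurry[of a Y] by simp
qed

lemma regular_sequence_quasi_regular:
  fixes fs :: "('v, 'k::field) mpoly list"
  assumes "regular_sequence (poly_ring K Y) fs"
  shows "quasi_regular ((!) fs) (length fs)"
proof (rule regular_imp_quasi_regular)
  fix i a assume i: "i < length fs" and a: "fs ! i * a \<in> idg ((!) fs ` {..<i})"
  have fsY: "set fs \<subseteq> polys Y" using assms by (simp add: regular_sequence_def)
  have take: "(!) fs ` {..<i} = set (take i fs)"
    using nth_image[of i fs] i by (simp add: atLeast0LessThan)
  have tY: "set (take i fs) \<subseteq> polys Y" using fsY set_take_subset[of i fs] by blast
  show "a \<in> idg ((!) fs ` {..<i})"
    unfolding take
  proof (rule nonzerodivisor_all_vars[OF tY])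
    show "fs ! i \<in> polys Y" using fsY i by (simp add: subset_iff)
    show "fs ! i * a \<in> idg (set (take i fs))" using a by (simp only: take)
    fix b assume b: "b \<in> polys Y" "fs ! i * b \<in> idg (set (take i fs))"
    have "fs ! i * b \<in> polys Y" using fsY i b(1) by (intro polys_mult) (simp_all add: subset_iff)
    moreover have "\<forall>a\<in>polys Y. fs ! i * a \<in> Idl\<^bsub>poly_ring K Y\<^esub> (set (take i fs)) \<longrightarrow>
        a \<in> Idl\<^bsub>poly_ring K Y\<^esub> (set (take i fs))"
      using assms i unfolding regular_sequence_def by simp
    ultimately show "b \<in> idg (set (take i fs))"
      using b unfolding Idl_poly_ring[OF tY] by blast
  qed
qed

lemma comm_ring_hom_const_coeff: "comm_ring_hom (\<lambda>p :: ('v, 'c::comm_ring_1) mpoly. lookup p 0)"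
proof -
  have z: "evm (\<lambda>_. 0) \<mu> = (if \<mu> = 0 then 1 else 0 :: 'c)" for \<mu> :: "'v \<Rightarrow>\<^sub>0 nat"
  proof (cases "\<mu> = 0")
    case False
    then obtain v where "v \<in> keys \<mu>" using keys_eq_empty by blast
    then have "evm (\<lambda>_. 0) \<mu> = (0 :: 'c)"
      unfolding evm_def by (intro prod_zero) (auto intro!: bexI[of _ v] simp: in_keys_iff power_0_left)
    then show ?thesis using False by simp
  qed simp
  interpret comm_ring_hom "ev (\<lambda>x. x) (\<lambda>_ :: 'v. 0 :: 'c)" by (rule comm_ring_hom_ev[OF comm_ring_hom_id])
  have "ev (\<lambda>x. x) (\<lambda>_. 0) p = lookup p 0" for p :: "('v, 'c) mpoly"
  proof (induction p rule: pm_induct)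
    case (single \<mu> c)
    show ?case by (simp add: ev_single[OF comm_ring_hom_id] z lookup_single when_def)
  qed (simp_all add: hom_add lookup_add)
  then have "(\<lambda>p. lookup p 0) = ev (\<lambda>x. x) (\<lambda>_ :: 'v. 0 :: 'c)" by (intro ext) simp
  then show ?thesis using comm_ring_hom_axioms by simp
qed

lemma edge_exp_le_iff: "(\<forall>u. lookup (edge_exp l w) u \<le> lookup (edge_exp k v) u) \<longleftrightarrow> l = k \<and> w = v"
proof
  assume le: "\<forall>u. lookup (edge_exp l w) u \<le> lookup (edge_exp k v) u"
  have "keys (edge_exp l w) \<subseteq> keys (edge_exp k v)"
  proof
    fix u assume "u \<in> keys (edge_exp l w)"
    then show "u \<in> keys (edge_exp k v)" using le[rule_format, of u] by (simp add: in_keys_iff)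
  qed
  then show "l = k \<and> w = v" by (auto simp: edge_exp_def keys_add_nat prod_eq_iff)
qed simp

lemma lookup_mult_edge_poly:
  assumes "0 < d"
  shows "lookup (a * edge_poly d w) (edge_exp 0 v) = (if v = w then lookup a 0 else 0 :: 'c::comm_ring_1)"
proof -
  have "lookup (a * edge_poly d w) (edge_exp 0 v) = (\<Sum>l<d. lookup (mon (edge_exp l w) * a) (edge_exp 0 v))"
    unfolding edge_poly_eq sum_distrib_left lookup_sum by (simp only: mult.commute)
  also have "\<dots> = (\<Sum>l<d. if l = 0 then (if v = w then lookup a 0 else 0) else 0)"
  proof (intro sum.cong refl)
    fix l
    show "lookup (mon (edge_exp l w) * a) (edge_exp 0 v) = (if l = 0 then (if v = w then lookup a 0 else 0) else 0)"
      unfolding lookup_single_mult_exp edge_exp_le_iff by auto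
  qed
  finally show ?thesis using assms by (simp add: sum.delta)
qed

text \<open>Different cells have disjoint quadratic monomials, so the coefficient at the monomial of
  \<open>v\<close> in layer 0 isolates the constant term of \<open>a v\<close>. Layer 0 exists
  because \<open>0 < d\<close>.\<close>

lemma edge_relation_const_coeff:
  assumes "finite C" "0 < d" "v \<in> C" "(\<Sum>w\<in>C. a w * edge_poly d w) = 0"
  shows "lookup (a v) 0 = (0 :: 'c::comm_ring_1)"
proof -
  have "0 = (\<Sum>w\<in>C. lookup (a w * edge_poly d w) (edge_exp 0 v))"
    unfolding lookup_sum[symmetric] assms(4) by simp
  also have "\<dots> = (\<Sum>w\<in>C. if v = w then lookup (a w) 0 else 0)"
    by (simp only: lookup_mult_edge_poly[OF assms(2)])
  also have "\<dots> = lookup (a v) 0" using assms(1,3) by (simp add: sum.delta)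
  finally show ?thesis ..
qed

text \<open>Modulo the variables, the two transition matrices are inverse to each other, so the numbers of
  generators are the traces of equal matrices.\<close>

lemma edge_polys_quasi_regular:
  fixes K :: "'k::field_char_0 itself"
  assumes ci: "complete_intersection (lss_id d m n C) (poly_ring K (lss_vars d m n))"
    and C: "C \<subseteq> grid m n" and d: "0 < d" and e: "bij_betw e {..<c} C"
    and F: "is_form c k F" "evalf (\<lambda>j. edge_poly d (e j)) F \<in> ipow (\<lambda>j. edge_poly d (e j)) c (Suc k)"
  shows "lookup F \<mu> \<in> (idg (edge_poly d ` C) :: (_, 'k) mpoly set)"
proof -
  let ?Y = "lss_vars d m n"
  obtain fs :: "(_, 'k) mpoly list" where fs: "regular_sequence (poly_ring K ?Y) fs"
    "lss_id d m n C = Idl\<^bsub>poly_ring K ?Y\<^esub> (set fs)" using ci unfolding complete_intersection_def by blast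
  have fsY: "set fs \<subseteq> polys ?Y" using fs(1) by (simp add: regular_sequence_def)
  have Lfs: "lss_id d m n C = polys ?Y \<inter> idg (set fs)" unfolding fs(2) by (rule Idl_poly_ring[OF fsY])
  define s where "s = length fs"
  define g where "g = (!) fs"
  have g_im: "g ` {..<s} = set fs" unfolding g_def s_def by (auto simp: set_conv_nth)
  define f :: "nat \<Rightarrow> (_, 'k) mpoly" where "f j = edge_poly d (e j)" for j
  have f_im: "f ` {..<c} = edge_poly d ` C" using e unfolding f_def bij_betw_def by auto
  have "set fs \<subseteq> lss_id d m n C" using fsY idl.span_superset[of "set fs"] by (simp add: Lfs)
  then have sub1: "set fs \<subseteq> idg (edge_poly d ` C)" by (auto simp: lss_id_def)
  have "edge_poly d ` C \<subseteq> (polys ?Y :: (_, 'k) mpoly set)" using C edge_poly_in_polys by blast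
  then have "edge_poly d ` C \<subseteq> (lss_id d m n C :: (_, 'k) mpoly set)"
    using idl.span_superset unfolding lss_id_def by blast
  then have sub2: "edge_poly d ` C \<subseteq> idg (set fs)" by (auto simp: Lfs)
  have L: "idg (g ` {..<s}) = idg (edge_poly d ` C)"
    unfolding g_im using idg_minimal[OF sub1] idg_minimal[OF sub2] by blast
  let ?L = "idg (g ` {..<s})"
  have "\<forall>j. \<exists>M. j < c \<longrightarrow> f j = (\<Sum>i<s. M i * g i)"
  proof (intro allI)
    fix j
    show "\<exists>M. j < c \<longrightarrow> f j = (\<Sum>i<s. M i * g i)"
    proof (cases "j < c")
      case True
      then have "f j \<in> ?L" unfolding L f_im[symmetric] by (intro idl.span_base imageI) simp
      then show ?thesis using idg_imageD[of "f j" g "{..<s}"] by blast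
    qed simp
  qed
  from choice[OF this] obtain M where M: "\<And>j. j < c \<Longrightarrow> f j = (\<Sum>i<s. M j i * g i)" by blast
  have "\<forall>i. \<exists>N. i < s \<longrightarrow> g i = (\<Sum>j<c. N j * f j)"
  proof (intro allI)
    fix i
    show "\<exists>N. i < s \<longrightarrow> g i = (\<Sum>j<c. N j * f j)"
    proof (cases "i < s")
      case True
      then have "g i \<in> idg (f ` {..<c})" unfolding f_im L[symmetric] by (intro idl.span_base imageI) simp
      then show ?thesis using idg_imageD[of "g i" f "{..<c}"] by blast
    qed simp
  qed
  from choice[OF this] obtain N where N: "\<And>i. i < s \<Longrightarrow> g i = (\<Sum>j<c. N i j * f j)" by blast
  have q: "quasi_regular g s" unfolding g_def s_def by (rule regular_sequence_quasi_regular[OF fs(1)])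
  have NM: "(\<Sum>j<c. N i j * M j l) - (if i = l then 1 else 0) \<in> ?L" if il: "i < s" "l < s" for i l
  proof -
    let ?a = "\<lambda>l. (\<Sum>j<c. N i j * M j l) - (if i = l then 1 else 0)"
    \<comment> \<open>Row \<open>i\<close> of \<open>N * M\<close> minus the identity is a linear
      form that vanishes at \<open>g\<close>; quasi-regularity puts its coefficients into the
      ideal.\<close>
    define H where "H = (\<Sum>l<s. single (single l (Suc 0)) (?a l))"
    interpret ev: comm_ring_hom "evalf g" by (rule comm_ring_hom_evalf)
    have H: "is_form s 1 H" unfolding H_def by (intro is_form_sum is_form_single) auto
    have "evalf g H = (\<Sum>l<s. ?a l * g l)" by (simp only: H_def ev.hom_sum evalf_single evm_single power_Suc0_right)
    also have "\<dots> = (\<Sum>l<s. (\<Sum>j<c. N i j * M j l) * g l) - (\<Sum>l<s. (if i = l then 1 else 0) * g l)"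
      unfolding left_diff_distrib sum_subtractf ..
    also have "(\<Sum>l<s. (if i = l then 1 else 0) * g l) = (\<Sum>l<s. if l = i then g i else 0)"
      by (intro sum.cong) auto
    also have "\<dots> = g i" using il by (simp add: sum.delta)
    also have "(\<Sum>l<s. (\<Sum>j<c. N i j * M j l) * g l) = (\<Sum>j<c. N i j * (\<Sum>l<s. M j l * g l))"
      unfolding sum_distrib_right sum_distrib_left mult.assoc by (rule sum.swap)
    also have "\<dots> = (\<Sum>j<c. N i j * f j)" using M by (intro sum.cong) auto
    also have "\<dots> = g i" using N[OF il(1)] ..
    finally have "evalf g H \<in> ipow g s (Suc 1)" by (simp add: ipow_zero)
    then have "lookup H (single l (Suc 0)) \<in> ?L" using q H unfolding quasi_regular_def by blast
    moreover have "l' = l" if "single l' (Suc 0) = single l (Suc 0)" for l'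
      using arg_cong[OF that, of keys] by simp
    then have "lookup H (single l (Suc 0)) = (\<Sum>l'<s. if l' = l then ?a l else 0)"
      unfolding H_def lookup_sum lookup_single by (intro sum.cong) (auto simp: when_def)
    ultimately show ?thesis using il(2) by (simp add: sum.delta)
  qed
  interpret c0: comm_ring_hom "\<lambda>p :: (_, 'k) mpoly. lookup p 0" by (rule comm_ring_hom_const_coeff)
  have L0: "lookup y 0 = 0" if "y \<in> ?L" for y
    using that unfolding L
  proof (induction rule: idg_induct)
    case (step b x z)
    then obtain v where "x = edge_poly d v" by blast
    have "keys (edge_exp l v) \<noteq> {}" for l by (simp add: edge_exp_def keys_add_nat)
    then have "edge_exp l v \<noteq> 0" for l by (metis keys_zero)
    then have "lookup x 0 = 0"
      unfolding \<open>x = edge_poly d v\<close> edge_poly_eq lookup_sum lookup_single by (simp add: when_def)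
    then show ?case using step(2) by (simp add: c0.hom_add c0.hom_mult)
  qed simp
  define N0 where "N0 i j = lookup (N i j) 0" for i j
  define M0 where "M0 j i = lookup (M j i) 0" for i j
  have NM0: "(\<Sum>j<c. N0 i j * M0 j i) = 1" if "i < s" for i
    using L0[OF NM[OF that that]] by (simp add: c0.hom_minus c0.hom_sum c0.hom_mult N0_def M0_def)
  \<comment> \<open>Quasi-regularity of the edge polynomials is not yet available, so the opposite
    product is treated by their linear independence, and only on the diagonal, which the trace
    needs.\<close>
  have MN0: "(\<Sum>i<s. M0 j i * N0 i j) = 1" if j: "j < c" for j
  proof -
    let ?a = "\<lambda>w. (\<Sum>i<s. M j i * N i (inv_into {..<c} e w)) - (if w = e j then 1 else 0)"
    have inv: "inv_into {..<c} e (e k) = k" if "k < c" for k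
      using e that by (intro inv_into_f_f) (auto simp: bij_betw_def)
    have "(\<Sum>w\<in>C. ?a w * edge_poly d w) = (\<Sum>k<c. ?a (e k) * f k)"
      unfolding f_def by (rule sum.reindex_bij_betw[OF e, symmetric])
    also have "\<dots> = (\<Sum>k<c. ((\<Sum>i<s. M j i * N i k) - (if k = j then 1 else 0)) * f k)"
      using e j by (intro sum.cong) (auto simp: inv bij_betw_def dest: inj_onD)
    also have "\<dots> = (\<Sum>k<c. (\<Sum>i<s. M j i * N i k) * f k) - (\<Sum>k<c. (if k = j then 1 else 0) * f k)"
      unfolding left_diff_distrib sum_subtractf ..
    also have "(\<Sum>k<c. (if k = j then 1 else 0) * f k) = (\<Sum>k<c. if k = j then f j else 0)"
      by (intro sum.cong) auto
    also have "\<dots> = f j" using j by (simp add: sum.delta)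
    also have "(\<Sum>k<c. (\<Sum>i<s. M j i * N i k) * f k) = (\<Sum>i<s. M j i * (\<Sum>k<c. N i k * f k))"
      unfolding sum_distrib_right sum_distrib_left mult.assoc by (rule sum.swap)
    also have "\<dots> = (\<Sum>i<s. M j i * g i)" using N by (intro sum.cong) auto
    also have "\<dots> = f j" using M[OF j] ..
    finally have rel: "(\<Sum>w\<in>C. ?a w * edge_poly d w) = 0" by simp
    have "e j \<in> C" using bij_betw_apply[OF e, of j] j by simp
    then have "lookup (?a (e j)) 0 = 0"
      using C by (intro edge_relation_const_coeff[OF _ d _ rel]) (auto intro: finite_subset)
    then show ?thesis using j by (simp add: inv c0.hom_minus c0.hom_sum c0.hom_mult N0_def M0_def)
  qed
  \<comment> \<open>Both traces are sums of ones; in characteristic zero they determine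
    \<open>s\<close> and \<open>c\<close>.\<close>
  have "of_nat s = (\<Sum>i<s. \<Sum>j<c. N0 i j * M0 j i)" using NM0 by simp
  also have "\<dots> = (\<Sum>j<c. \<Sum>i<s. M0 j i * N0 i j)" by (subst sum.swap) (simp only: mult.commute)
  also have "\<dots> = of_nat c" using MN0 by simp
  finally have sc: "s = c" by simp
  have "lookup F \<mu> \<in> ?L"
  proof (rule quasi_regular_change[OF q])
    show "f j = (\<Sum>i<s. M j i * g i)" if "j < s" for j using M that sc by simp
    show "(\<Sum>j<s. N i j * M j l) - (if i = l then 1 else 0) \<in> ?L" if "i < s" "l < s" for i l
      using NM[OF that] sc by simp
    show "is_form s k F" using F(1) sc by simp
    show "evalf f F \<in> ipow f s (Suc k)" using F(2) unfolding sc f_def .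
  qed
  then show ?thesis by (simp only: L)
qed

text \<open>Quasi-regularity is applied to the part of a relation that has lowest degree in the edge
  polynomials.\<close>

lemma complete_intersection_indep:
  fixes p :: "(nat \<times> nat, 'k::field_char_0) mpoly"
  assumes ci: "complete_intersection (lss_id d m n C) (poly_ring TYPE('k) (lss_vars d m n))"
    and C: "C \<subseteq> grid m n" and d: "0 < d" and U: "U \<subseteq> grid m n"
    and ind: "polys U \<inter> det_id d m n C \<subseteq> {0 :: (nat \<times> nat, 'k) mpoly}"
    and p: "p \<in> polys (U \<union> C)" and p0: "phi d p = 0"
  shows "p = 0"
proof (rule ccontr)
  assume "p \<noteq> 0"
  interpret phi: comm_ring_hom "phi d :: (nat \<times> nat, 'k) mpoly \<Rightarrow> _" by (rule comm_ring_hom_phi)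
  define c where "c = card C"
  have finC: "finite C" using C by (rule finite_subset) auto
  obtain e where e: "bij_betw e {..<c} C"
    using ex_bij_betw_nat_finite[OF finC] by (auto simp: atLeast0LessThan c_def)
  define f :: "nat \<Rightarrow> (_, 'k) mpoly" where "f j = edge_poly d (e j)" for j
  \<comment> \<open>\<open>p\<close> is read as a polynomial in the variables from \<open>C\<close>,
    with coefficients \<open>q \<alpha>\<close> in those of \<open>U - C\<close>.\<close>
  define q where "q \<alpha> = lookup (curry_in (- C) p) \<alpha>" for \<alpha>
  let ?K = "keys (curry_in (- C) p)"
  have p_eq: "p = (\<Sum>\<alpha>\<in>?K. mon \<alpha> * q \<alpha>)" unfolding q_def by (rule uncurry)
  have Kne: "?K \<noteq> {}" using \<open>p \<noteq> 0\<close> p_eq by auto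
  have K_C: "keys \<alpha> \<subseteq> C" if "\<alpha> \<in> ?K" for \<alpha> using keys_curry_in[OF p that] by blast
  have qU: "q \<alpha> \<in> polys (U - C)" for \<alpha>
  proof -
    have "q \<alpha> \<in> polys ((U \<union> C) \<inter> - C)" unfolding q_def by (rule lookup_curry_in_polys[OF p])
    moreover have "(U \<union> C) \<inter> - C = U - C" by blast
    ultimately show ?thesis by simp
  qed
  \<comment> \<open>Quasi-regularity speaks of forms in numbered variables; \<open>ren\<close>
    transports exponents on \<open>C\<close> along the enumeration \<open>e\<close>.\<close>
  define ren where "ren \<alpha> = (\<Sum>j<c. single j (lookup \<alpha> (e j)))" for \<alpha> :: "nat \<times> nat \<Rightarrow>\<^sub>0 nat"
  have lookup_ren: "lookup (ren \<alpha>) j = (if j < c then lookup \<alpha> (e j) else 0)" for \<alpha> j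
    by (auto simp: ren_def lookup_sum lookup_single when_def sum.delta' cong: if_cong)
  have keys_ren: "keys (ren \<alpha>) \<subseteq> {..<c}" for \<alpha>
    by (auto simp: in_keys_iff lookup_ren split: if_splits)
  have tdeg_ren: "tdeg (ren \<alpha>) = tdeg \<alpha>" if "keys \<alpha> \<subseteq> C" for \<alpha>
  proof -
    have "tdeg (ren \<alpha>) = (\<Sum>j<c. lookup \<alpha> (e j))"
      by (subst tdeg_superset[OF _ keys_ren]) (simp_all add: lookup_ren)
    also have "\<dots> = (\<Sum>v\<in>C. lookup \<alpha> v)" by (rule sum.reindex_bij_betw[OF e])
    finally show ?thesis by (simp add: tdeg_superset[OF finC that])
  qed
  have evm_ren: "evm f (ren \<alpha>) = phi d (mon \<alpha>)" if "keys \<alpha> \<subseteq> C" for \<alpha>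
  proof -
    have "evm f (ren \<alpha>) = (\<Prod>j<c. f j ^ lookup \<alpha> (e j))"
      by (subst evm_superset[OF _ keys_ren]) (simp_all add: lookup_ren)
    also have "\<dots> = (\<Prod>v\<in>C. edge_poly d v ^ lookup \<alpha> v)"
      unfolding f_def by (rule prod.reindex_bij_betw[OF e])
    also have "\<dots> = evm (edge_poly d) \<alpha>" by (rule evm_superset[OF finC that, symmetric])
    also have "\<dots> = phi d (mon \<alpha>)" by (simp add: phi_def ev_single comm_ring_hom_cst)
    finally show ?thesis .
  qed
  have inj: "\<alpha> = \<beta>" if "keys \<alpha> \<subseteq> C" "keys \<beta> \<subseteq> C" "ren \<alpha> = ren \<beta>" for \<alpha> \<beta>
  proof (rule poly_mapping_eqI)
    fix v
    show "lookup \<alpha> v = lookup \<beta> v"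
    proof (cases "v \<in> C")
      case True
      then obtain j where "j < c" "v = e j" using e unfolding bij_betw_def by blast
      then show ?thesis using lookup_ren[of \<alpha> j] lookup_ren[of \<beta> j] that(3) by simp
    next
      case False
      then have "v \<notin> keys \<alpha>" "v \<notin> keys \<beta>" using that by blast+
      then show ?thesis by (simp add: in_keys_iff)
    qed
  qed
  define k where "k = Min (tdeg ` ?K)"
  have k_le: "k \<le> tdeg \<alpha>" if "\<alpha> \<in> ?K" for \<alpha> unfolding k_def using that by (intro Min_le) auto
  have "k \<in> tdeg ` ?K" unfolding k_def using Kne by (intro Min_in) auto
  then obtain \<alpha>0 where \<alpha>0: "\<alpha>0 \<in> ?K" "tdeg \<alpha>0 = k" by blast
  let ?K1 = "{\<alpha> \<in> ?K. tdeg \<alpha> = k}"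
  \<comment> \<open>The part of lowest degree \<open>k\<close>. As the image of \<open>p\<close> is
    0, its value is minus that of the remaining terms, which lies in the next power of the
    ideal.\<close>
  define F where "F = (\<Sum>\<alpha>\<in>?K1. single (ren \<alpha>) (phi d (q \<alpha>)))"
  have F_form: "is_form c k F"
    unfolding F_def using K_C tdeg_ren by (intro is_form_sum is_form_single keys_ren) auto
  interpret ev: comm_ring_hom "evalf f" by (rule comm_ring_hom_evalf)
  have evF: "evalf f F = (\<Sum>\<alpha>\<in>?K1. phi d (q \<alpha>) * evm f (ren \<alpha>))"
    by (simp only: F_def ev.hom_sum evalf_single)
  have "phi d p = (\<Sum>\<alpha>\<in>?K. phi d (mon \<alpha> * q \<alpha>))"
    unfolding phi.hom_sum[symmetric] by (rule arg_cong[OF p_eq])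
  then have "0 = (\<Sum>\<alpha>\<in>?K. phi d (mon \<alpha> * q \<alpha>))" by (simp only: p0)
  also have "\<dots> = (\<Sum>\<alpha>\<in>?K. phi d (q \<alpha>) * evm f (ren \<alpha>))"
  proof (intro sum.cong refl)
    fix \<alpha> assume "\<alpha> \<in> ?K"
    then show "phi d (mon \<alpha> * q \<alpha>) = phi d (q \<alpha>) * evm f (ren \<alpha>)"
      by (simp only: phi.hom_mult evm_ren[OF K_C] mult.commute)
  qed
  also have "\<dots> = (\<Sum>\<alpha>\<in>?K - ?K1. phi d (q \<alpha>) * evm f (ren \<alpha>)) + evalf f F"
    unfolding evF by (rule sum.subset_diff) auto
  finally have "- (\<Sum>\<alpha>\<in>?K - ?K1. phi d (q \<alpha>) * evm f (ren \<alpha>)) = evalf f F"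
    by (intro minus_unique) (rule sym)
  then have "evalf f F = - (\<Sum>\<alpha>\<in>?K - ?K1. phi d (q \<alpha>) * evm f (ren \<alpha>))" by (rule sym)
  moreover have "(\<Sum>\<alpha>\<in>?K - ?K1. phi d (q \<alpha>) * evm f (ren \<alpha>)) \<in> ipow f c (Suc k)"
  proof (rule ipow_sum)
    fix \<alpha> assume \<alpha>: "\<alpha> \<in> ?K - ?K1"
    then have "Suc k \<le> tdeg \<alpha>" using k_le[of \<alpha>] by auto
    moreover have "phi d (q \<alpha>) * evm f (ren \<alpha>) \<in> ipow f c (tdeg \<alpha>)"
      using \<alpha> K_C tdeg_ren by (intro ipow_single keys_ren) blast
    ultimately show "phi d (q \<alpha>) * evm f (ren \<alpha>) \<in> ipow f c (Suc k)" using ipow_antimono by blast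
  qed
  ultimately have F_pow: "evalf f F \<in> ipow f c (Suc k)" by (simp only: ipow_uminus)
  have "lookup F (ren \<alpha>0) \<in> idg (edge_poly d ` C)"
    by (rule edge_polys_quasi_regular[OF ci C d e F_form F_pow[unfolded f_def]])
  moreover have "lookup F (ren \<alpha>0) = phi d (q \<alpha>0)"
  proof -
    have "lookup F (ren \<alpha>0) = (\<Sum>\<alpha>\<in>?K1. if \<alpha> = \<alpha>0 then phi d (q \<alpha>0) else 0)"
      unfolding F_def lookup_sum lookup_single
    proof (intro sum.cong refl)
      fix \<alpha> assume "\<alpha> \<in> ?K1"
      then have "ren \<alpha> = ren \<alpha>0 \<longleftrightarrow> \<alpha> = \<alpha>0" using inj K_C \<alpha>0(1) by blast
      then show "(phi d (q \<alpha>) when ren \<alpha> = ren \<alpha>0) = (if \<alpha> = \<alpha>0 then phi d (q \<alpha>0) else 0)"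
        by (auto simp: when_def)
    qed
    also have "\<dots> = phi d (q \<alpha>0)" using \<alpha>0 by simp
    finally show ?thesis .
  qed
  ultimately have qL: "phi d (q \<alpha>0) \<in> idg (edge_poly d ` C)" by simp
  \<comment> \<open>\<open>purity\<close> pulls the lowest coefficient back into
    \<open>det_id\<close>, where the independence of \<open>U\<close> forces it to vanish, against
    the choice of \<open>\<alpha>0\<close>.\<close>
  have q_grid: "q \<alpha>0 \<in> polys (grid m n)" using qU[of \<alpha>0] polys_mono[of "U - C" "grid m n"] U by blast
  have "kill C (q \<alpha>0) \<in> idg (kill C ` gen_minors (d + 1) m n)" by (rule purity[OF q_grid C qL])
  moreover have "kill C (q \<alpha>0) = q \<alpha>0" by (rule kill_id[OF qU]) auto
  ultimately have "q \<alpha>0 \<in> det_id d m n C" using q_grid by (simp add: det_id_def)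
  moreover have "q \<alpha>0 \<in> polys U" using qU[of \<alpha>0] polys_mono[of "U - C" U] by blast
  ultimately have "q \<alpha>0 = 0" using ind by blast
  then show False using \<alpha>0(1) by (simp add: q_def in_keys_iff)
qed

text \<open>The hypothesis makes \<open>U\<close> together with \<open>C\<close> independent modulo
  the kernel of \<open>phi\<close>, so \<open>indep_phi_card_le\<close> bounds its size by that of
  the hook. It is met by \<open>complete_intersection_indep\<close> and, for empty \<open>C\<close>,
  by \<open>ker_phi\<close>.\<close>

lemma height_det_id:
  assumes C: "C \<subseteq> grid m n"
    and indep: "\<And>U p :: (_, 'k::field_char_0) mpoly. U \<subseteq> grid m n \<Longrightarrow>
      polys U \<inter> det_id d m n C \<subseteq> {0 :: (_, 'k) mpoly} \<Longrightarrow> p \<in> polys (U \<union> C) \<Longrightarrow> phi d p = 0 \<Longrightarrow> p = 0"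
  shows "ideal_height (poly_ring TYPE('k) (grid m n)) (det_id d m n C) =
     enat (m * n - card {v \<in> grid m n. fst v < d \<or> snd v < d})"
proof (rule antisym[OF height_det_id_le])
  let ?r = "card {v \<in> grid m n. fst v < d \<or> snd v < d}"
  have "enat (card (grid m n) - ?r) \<le> ideal_height (poly_ring TYPE('k) (grid m n)) (det_id d m n C)"
  proof (rule ideal_height_ge)
    fix U assume U: "U \<subseteq> grid m n" "polys U \<inter> det_id d m n C \<subseteq> {0 :: (_, 'k) mpoly}"
    have UC: "U \<union> C \<subseteq> grid m n" using U(1) C by blast
    have "card U \<le> card (U \<union> C)" using finite_subset[OF UC] by (intro card_mono) auto
    also have "\<dots> \<le> ?r" by (rule indep_phi_card_le[OF UC indep[OF U]])
    finally show "card U \<le> ?r" .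
  qed simp
  then show "enat (m * n - ?r) \<le> ideal_height (poly_ring TYPE('k) (grid m n)) (det_id d m n C)" by simp
qed

lemma height_generic:
  "ideal_height (poly_ring TYPE('k::field_char_0) (grid m n)) (det_id d m n {}) =
     enat (m * n - card {v \<in> grid m n. fst v < d \<or> snd v < d})"
proof (rule height_det_id)
  fix U and p :: "(nat \<times> nat, 'k) mpoly"
  assume U: "U \<subseteq> grid m n" "polys U \<inter> det_id d m n {} \<subseteq> {0 :: (_, 'k) mpoly}" "p \<in> polys (U \<union> {})" "phi d p = 0"
  have pg: "p \<in> polys (grid m n)" using U(1,3) polys_mono[OF U(1)] by auto
  have kill: "kill {} x = x" for x :: "(nat \<times> nat, 'k) mpoly" using kill_id[of x UNIV "{}"] by simp
  have "p \<in> idg (gen_minors (d + 1) m n)" by (rule ker_phi[OF pg U(4)])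
  then have "p \<in> det_id d m n {}" using pg by (simp add: det_id_def kill)
  then show "p = 0" using U(2,3) by auto
qed simp

theorem proposition7p4:
  fixes m n d :: nat and E :: "(nat + nat) set set"
  assumes "1 \<le> d"
    and "E \<subseteq> complete_bip_edges m n"
  shows
    "(is_radical_ideal (LSS_ideal TYPE('k::field_char_0) (bip_vertices m n) E d)
         (LSS_ring TYPE('k) (bip_vertices m n) d)
       \<longrightarrow> is_radical_ideal (det_ideal TYPE('k) (d + 1) (X_gen_graph TYPE('k) m n E))
             (gen_ring TYPE('k) m n)) \<and>
     (complete_intersection (LSS_ideal TYPE('k) (bip_vertices m n) E d)
         (LSS_ring TYPE('k) (bip_vertices m n) d)
       \<longrightarrow> has_maximal_height TYPE('k) (d + 1) m n E) \<and>
     (primeideal (LSS_ideal TYPE('k) (bip_vertices m n) E d)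
         (LSS_ring TYPE('k) (bip_vertices m n) d)
       \<longrightarrow> primeideal (det_ideal TYPE('k) (d + 1) (X_gen_graph TYPE('k) m n E))
             (gen_ring TYPE('k) m n))"
proof (intro conjI impI)
  note C = cells_subset[OF assms(2)]
  note L = LSS_ideal_eq[OF assms(2), where 'k = 'k and d = d]
  have R: "LSS_ring TYPE('k) (bip_vertices m n) d = poly_ring TYPE('k) (lss_vars d m n)"
    by (simp add: LSS_ring_def lss_vars_def)
  {
    assume "is_radical_ideal (LSS_ideal TYPE('k) (bip_vertices m n) E d) (LSS_ring TYPE('k) (bip_vertices m n) d)"
    then show "is_radical_ideal (det_ideal TYPE('k) (d + 1) (X_gen_graph TYPE('k) m n E)) (gen_ring TYPE('k) m n)"
      unfolding L R det_ideal_eq gen_ring_def is_radical_ideal_poly_ring_iff by (rule det_id_radical[OF C])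
  }
  {
    assume "primeideal (LSS_ideal TYPE('k) (bip_vertices m n) E d) (LSS_ring TYPE('k) (bip_vertices m n) d)"
    then show "primeideal (det_ideal TYPE('k) (d + 1) (X_gen_graph TYPE('k) m n E)) (gen_ring TYPE('k) m n)"
      unfolding L R det_ideal_eq gen_ring_def primeideal_poly_ring_iff by (rule det_id_prime[OF C])
  }
  assume "complete_intersection (LSS_ideal TYPE('k) (bip_vertices m n) E d) (LSS_ring TYPE('k) (bip_vertices m n) d)"
  then have ci: "complete_intersection (lss_id d m n (cells E)) (poly_ring TYPE('k) (lss_vars d m n))"
    unfolding L R .
  have "ideal_height (poly_ring TYPE('k) (grid m n)) (det_id d m n (cells E)) =
     enat (m * n - card {v \<in> grid m n. fst v < d \<or> snd v < d})"
    \<comment> \<open>Here \<open>1 \<le> d\<close> enters: for \<open>d = 0\<close> every edge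
      polynomial is 0, and a nonempty family of zeros is not quasi-regular.\<close>
    by (rule height_det_id[OF C complete_intersection_indep[OF ci C]]) (use assms(1) in auto)
  moreover have "cells {} = {}" by (simp add: cells_def)
  ultimately show "has_maximal_height TYPE('k) (d + 1) m n E"
    unfolding has_maximal_height_def gen_ring_def X_gen_eq det_ideal_eq by (simp only: height_generic)
qed

end
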